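(* Let $a,b,c\in UC_b^2(\mathbb{R})$ with $\inf_{x\in\mathbb{R}}a(x)>0$. Let the operator $H$ in $UC_b(\mathbb{R})$ with domain $D(H)=HC_b^2(\mathbb{R})$ be defined by $(H\varphi)(x)=a(x)\varphi''(x)+b(x)\varphi'(x)+c(x)\varphi(x)$. For $x\in\mathbb{R}$, $t\ge0$, $f\in UC_b(\mathbb{R})$ put $$(S(t)f)(x)=\int_{-1}^{1}\frac12\bigl(1+c(x)t\bigr)f\Bigl(x+(6a(x)t)^{1/2}y+b(x)t\Bigr)dy+\int_{-1}^{1}\Bigl(\sum_{j=0}^{6}\beta_j(t,x)y^j\Bigr)f\bigl(x+yt^{1/4}\bigr)dy,$$ where, with $$P=ac''+bc'+c^2,\qquad Q=ab''+2ac'+bb',\qquad R=aa''+2ab'+ba'$$ (functions of $x$), $$\beta_0(t,x)=\tfrac{1225}{1024}P(x)t^2-\tfrac{11025}{512}R(x)t^{3/2}+\tfrac{14553}{64}a(x)^2t,$$ $$\beta_1(t,x)=\tfrac{3675}{256}Q(x)t^{7/4}-\tfrac{19845}{32}a(x)a'(x)t^{5/4},$$ $$\beta_2(t,x)=-\tfrac{11025}{1024}P(x)t^2+\tfrac{178605}{512}R(x)t^{3/2}-\tfrac{280665}{64}a(x)^2t,$$ $$\beta_3(t,x)=-\tfrac{6615}{128}Q(x)t^{7/4}+\tfrac{42525}{16}a(x)a'(x)t^{5/4},$$ $$\beta_4(t,x)=\tfrac{24255}{1024}P(x)t^2-\tfrac{467775}{512}R(x)t^{3/2}+\tfrac{800415}{64}a(x)^2t,$$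 $$\beta_5(t,x)=\tfrac{10395}{256}Q(x)t^{7/4}-\tfrac{72765}{32}a(x)a'(x)t^{5/4},$$ $$\beta_6(t,x)=-\tfrac{15015}{1024}P(x)t^2+\tfrac{315315}{512}R(x)t^{3/2}-\tfrac{567567}{64}a(x)^2t.$$ Then: 1. $H$ is closable, its closure $\overline{H}$ is the generator of a $C_0$-semigroup $(e^{t\overline{H}})_{t\ge0}$ in $UC_b(\mathbb{R})$, and $\|e^{t\overline{H}}\|\le e^{\gamma t}$ for all $t\ge0$, where $\gamma=\sup_{x\in\mathbb{R}}c(x)$. 2. The Cauchy problem $$u'_t(t,x)=a(x)u''_{xx}(t,x)+b(x)u'_x(t,x)+c(x)u(t,x),\qquad u(0,x)=u_0(x)\qquad(t\ge0,\ x\in\mathbb{R})$$ has a mild solution for every $u_0\in UC_b(\mathbb{R})$ and a classical solution for every $u_0\in D(\overline{H})\supset HC_b^2(\mathbb{R})$; in both cases it is given by $u(t,x)=(e^{t\overline{H}}u_0)(x)$. 3. For each $f\in C_b^\infty(\mathbb{R})$, as $t\to+0$, $S(t)f=f+tHf+\frac{1}{2}t^2H^2f+o(t^2)$ in the norm of $UC_b(\mathbb{R})$. 4. If $a,b,c\in HC_b^6(\mathbb{R})$, then there exist non-negative constants $w,C_0,C_1,\dots,C_8$, depending on $a,b,c$ only (independent of $f$, $t$, $n$), such that for all $f\in UC_b^8(\mathbb{R})$, all $t>0$ and all positive integers $n\ge t$, $$\bigl\|S(t/n)^nf-e^{t\overline{H}}f\bigr\|\le e^{wt}\,\frac{t^3}{n^2}\sum_{j=0}^{8}C_j\|f^{(j)}\|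 .$$ 5. For all $\mathcal{T}>0$ and all $g\in UC_b(\mathbb{R})$, $$\lim_{\mathcal{T}\le n\to\infty}\ \sup_{t\in(0,\mathcal{T}]}\bigl\|S(t/n)^ng-e^{t\overline{H}}g\bigr\|=0 .$$
   Context: $UC_b(\mathbb{R})$ is the Banach space of all bounded uniformly continuous functions $\mathbb{R}\to\mathbb{R}$ with the uniform norm $\|f\|=\sup_{x\in\mathbb{R}}|f(x)|$; operator norms are taken with respect to it. For $n\ge1$, $UC_b^n(\mathbb{R})=\{f\in UC_b(\mathbb{R}): f',f'',\dots,f^{(n)}\in UC_b(\mathbb{R})\}$, and $C_b^\infty(\mathbb{R})=\bigcap_{n\ge1}UC_b^n(\mathbb{R})$. $HC_b^k(\mathbb{R})$ is the set of $k$ times differentiable functions $f:\mathbb{R}\to\mathbb{R}$ such that $f,f',\dots,f^{(k)}$ are all bounded and Hölder continuous on $\mathbb{R}$ (a function $g$ is Hölder continuous if there are $K\ge0$ and $\theta\in(0,1]$ with $|g(x)-g(y)|\le K|x-y|^\theta$ for all $x,y$; the exponent may depend on the function). For a bounded operator $B$, $B^n$ is the composition of $n$ copies of $B$. For a generator $L$ of a $C_0$-semigroup, $(e^{tL})_{t\ge0}$ denotes the semigroup it generates. In item 3, $H^2f=H(Hf)$ is computed by applying the differential expression $a\,\partial_x^2+b\,\partial_x+c$ twice. Solutions of the Cauchy problem are understood through the abstract Cauchy problem $U'(t)=\overline{H}U(t)$ $(t\ge0)$, $U(0)=u_0$ in $UC_b(\mathbb{R})$, with $u(t,x)=(U(t))(x)$.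 A classical solution is a function $U:[0,\infty)\to UC_b(\mathbb{R})$ that is continuously differentiable with respect to the norm, with $U(t)\in D(\overline{H})$ for all $t\ge0$, satisfying this problem. A mild solution is a norm-continuous function $U:[0,\infty)\to UC_b(\mathbb{R})$ such that for all $t\ge0$ one has $\int_0^tU(s)\,ds\in D(\overline{H})$ and $U(t)=u_0+\overline{H}\int_0^tU(s)\,ds$. *)

theory Defs
  imports "HOL-Analysis.Analysis" "HOL-Library.Landau_Symbols"
begin

section \<open>Function classes\<close>

definition UCb :: "(real \<Rightarrow> real) set" where
  "UCb = {f. bounded (range f) \<and> uniformly_continuous_on UNIV f}"

definition UCb_n :: "nat \<Rightarrow> (real \<Rightarrow> real) set" where
  "UCb_n n = {f \<in> UCb. (\<forall>k<n. \<forall>x. (deriv ^^ k) f field_differentiable at x) \<and>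
                       (\<forall>k\<in>{1..n}. (deriv ^^ k) f \<in> UCb)}"

definition Cb_inf :: "(real \<Rightarrow> real) set" where
  "Cb_inf = (\<Inter>n\<in>{1..}. UCb_n n)"

definition hoelder :: "(real \<Rightarrow> real) \<Rightarrow> bool" where
  "hoelder g \<longleftrightarrow> (\<exists>K\<ge>0. \<exists>\<theta>. 0 < \<theta> \<and> \<theta> \<le> 1 \<and> (\<forall>x y. \<bar>g x - g y\<bar> \<le> K * \<bar>x - y\<bar> powr \<theta>))"

definition HCb :: "nat \<Rightarrow> (real \<Rightarrow> real) set" where
  "HCb k = {f. (\<forall>j<k. \<forall>x. (deriv ^^ j) f field_differentiable at x) \<and>
               (\<forall>j\<le>k. bounded (range ((deriv ^^ j) f)) \<and> hoelder ((deriv ^^ j) f))}"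


section \<open>Bounded uniformly continuous functions on metric spaces\<close>

text \<open>Closure properties, stated for arbitrary domains because the integrands of the
  Chernoff operator below are functions of two variables.\<close>

definition buc_on :: "'a::metric_space set \<Rightarrow> ('a \<Rightarrow> real) \<Rightarrow> bool" where
  "buc_on S f \<longleftrightarrow> bounded (f ` S) \<and> uniformly_continuous_on S f"

lemma UCb_iff_buc: "f \<in> UCb \<longleftrightarrow> buc_on UNIV f"
  by (simp add: UCb_def buc_on_def)

lemma buc_on_const [intro]: "buc_on S (\<lambda>_. k)"
  by (auto simp: buc_on_def bounded_def image_def intro: uniformly_continuous_on_const)

lemma buc_on_add [intro]:
  assumes "buc_on S f" "buc_on S g" shows "buc_on S (\<lambda>x. f x + g x)"
  using assms by (auto simp: buc_on_def intro: bounded_plus_comp uniformly_continuous_on_add)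

lemma buc_on_mult [intro]:
  assumes "buc_on S f" "buc_on S g" shows "buc_on S (\<lambda>x. f x * g x)"
proof -
  obtain M where M: "\<And>x. x \<in> S \<Longrightarrow> \<bar>f x\<bar> \<le> M" "M > 0"
    using assms(1) by (auto simp: buc_on_def bounded_pos)
  obtain N where N: "\<And>x. x \<in> S \<Longrightarrow> \<bar>g x\<bar> \<le> N" "N > 0"
    using assms(2) by (auto simp: buc_on_def bounded_pos)
  have "\<bar>f x * g x\<bar> \<le> M * N" if "x \<in> S" for x
    using M(1)[OF that] N(1)[OF that] by (auto simp: abs_mult intro: mult_mono)
  then have b: "bounded ((\<lambda>x. f x * g x) ` S)"
    by (auto simp: bounded_iff)
  have "uniformly_continuous_on S (\<lambda>x. f x * g x)"
    unfolding uniformly_continuous_on_def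
  proof (intro allI impI)
    fix e :: real assume "e > 0"
    then have e1: "e / (2 * M) > 0" and e2: "e / (2 * N) > 0" using M N by auto
    obtain d1 where d1: "d1 > 0" "\<And>x y. x \<in> S \<Longrightarrow> y \<in> S \<Longrightarrow> dist y x < d1 \<Longrightarrow> dist (f y) (f x) < e / (2 * N)"
      using assms(1) e2 unfolding buc_on_def uniformly_continuous_on_def by metis
    obtain d2 where d2: "d2 > 0" "\<And>x y. x \<in> S \<Longrightarrow> y \<in> S \<Longrightarrow> dist y x < d2 \<Longrightarrow> dist (g y) (g x) < e / (2 * M)"
      using assms(2) e1 unfolding buc_on_def uniformly_continuous_on_def by metis
    show "\<exists>d>0. \<forall>x\<in>S. \<forall>x'\<in>S. dist x' x < d \<longrightarrow> dist (f x' * g x') (f x * g x) < e"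
    proof (intro exI[of _ "min d1 d2"] conjI ballI impI)
      fix x y assume xy: "x \<in> S" "y \<in> S" "dist y x < min d1 d2"
      have 1: "\<bar>f y - f x\<bar> < e / (2 * N)" and 2: "\<bar>g y - g x\<bar> < e / (2 * M)"
        using d1(2)[of x y] d2(2)[of x y] xy by (auto simp: dist_real_def)
      have "f y * g y - f x * g x = f y * (g y - g x) + (f y - f x) * g x"
        by (simp add: algebra_simps)
      then have "\<bar>f y * g y - f x * g x\<bar> \<le> \<bar>f y\<bar> * \<bar>g y - g x\<bar> + \<bar>f y - f x\<bar> * \<bar>g x\<bar>"
        by (metis abs_mult abs_triangle_ineq)
      also have "\<dots> \<le> M * \<bar>g y - g x\<bar> + \<bar>f y - f x\<bar> * N"
        using M(1)[OF xy(2)] N(1)[OF xy(1)] by (intro add_mono mult_mono) auto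
      also have "\<dots> < M * (e / (2 * M)) + (e / (2 * N)) * N"
        using 1 2 M(2) N(2) by (intro add_strict_mono mult_strict_left_mono mult_strict_right_mono)
      also have "\<dots> = e" using M(2) N(2) by (simp add: field_simps)
      finally show "dist (f y * g y) (f x * g x) < e" by (simp add: dist_real_def)
    qed (use d1 d2 in auto)
  qed
  with b show ?thesis by (simp add: buc_on_def)
qed

lemma buc_on_sum [intro]:
  "(\<And>i. i \<in> I \<Longrightarrow> buc_on S (f i)) \<Longrightarrow> buc_on S (\<lambda>x. \<Sum>i\<in>I. f i x)"
  by (induction I rule: infinite_finite_induct) auto

lemma buc_on_power [intro]: "buc_on S f \<Longrightarrow> buc_on S (\<lambda>x. f x ^ n)"
  by (induction n) auto

lemma buc_on_cmult: "buc_on S f \<Longrightarrow> buc_on S (\<lambda>x. k * f x)"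
  by auto

lemma buc_on_minus [intro]: "buc_on S f \<Longrightarrow> buc_on S (\<lambda>x. - f x)"
  using buc_on_cmult[of S f "-1"] by simp

lemma buc_on_diff [intro]: "buc_on S f \<Longrightarrow> buc_on S g \<Longrightarrow> buc_on S (\<lambda>x. f x - g x)"
  using buc_on_add[of S f "\<lambda>x. - g x"] by auto

lemma buc_on_compose:
  assumes "f \<in> UCb" "uniformly_continuous_on S g"
  shows "buc_on S (\<lambda>x. f (g x))"
proof -
  have "(\<lambda>x. f (g x)) ` S \<subseteq> range f" by auto
  moreover have "uniformly_continuous_on (g ` S) f"
    using assms(1) unfolding UCb_def uniformly_continuous_on_def by blast
  ultimately show ?thesis
    using assms bounded_subset uniformly_continuous_on_compose
    unfolding buc_on_def UCb_def by blast
qed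

lemma buc_on_sqrt:
  assumes "buc_on S f" shows "buc_on S (\<lambda>x. sqrt (f x))"
proof -
  have "compact (closure (f ` S))"
    using assms by (simp add: buc_on_def)
  then have K: "compact (sqrt ` closure (f ` S))" "uniformly_continuous_on (closure (f ` S)) sqrt"
    by (auto intro!: compact_continuous_image compact_uniformly_continuous continuous_on_real_sqrt
             continuous_on_id)
  then have "uniformly_continuous_on (f ` S) sqrt"
    using closure_subset unfolding uniformly_continuous_on_def by (meson subsetD)
  moreover have "(\<lambda>x. sqrt (f x)) ` S \<subseteq> sqrt ` closure (f ` S)"
    using closure_subset by fastforce
  ultimately show ?thesis
    using assms K(1) uniformly_continuous_on_compose bounded_subset compact_imp_bounded
    unfolding buc_on_def by blast
qed

lemma uniformly_continuous_on_fst: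
  fixes S :: "('a::metric_space \<times> 'b::metric_space) set"
  shows "uniformly_continuous_on S fst"
  unfolding uniformly_continuous_on_def
proof (intro allI impI exI conjI ballI)
  show "dist (fst y) (fst x) < e" if "dist y x < e" for x y :: "'a \<times> 'b" and e :: real
    using dist_fst_le[of y x] that by simp
qed

lemma buc_on_fst: "f \<in> UCb \<Longrightarrow> buc_on S (\<lambda>p. f (fst p))"
  by (rule buc_on_compose[OF _ uniformly_continuous_on_fst])

lemma buc_on_snd: "buc_on (UNIV \<times> {-1..1}) (\<lambda>p::real \<times> real. snd p)"
proof -
  have "bounded (snd ` (UNIV \<times> {-1..1::real}))"
    by (rule bounded_subset[of "{-1..1}"]) auto
  moreover have "uniformly_continuous_on (UNIV \<times> {-1..1}) (\<lambda>p::real \<times> real. snd p)"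
    unfolding uniformly_continuous_on_def
  proof (intro allI impI exI conjI ballI)
    show "dist (snd y) (snd x) < e" if "dist y x < e" for x y :: "real \<times> real" and e
      using dist_snd_le[of y x] that by simp
  qed
  ultimately show ?thesis by (simp add: buc_on_def)
qed

lemma UCb_integral:
  fixes g :: "real \<Rightarrow> real \<Rightarrow> real"
  assumes "buc_on (UNIV \<times> {-1..1}) (\<lambda>p. g (fst p) (snd p))"
  shows "(\<lambda>x. integral {-1..1} (g x)) \<in> UCb"
proof -
  let ?U = "UNIV \<times> {-1..1} :: (real \<times> real) set"
  obtain M where M: "\<And>x y. y \<in> {-1..1} \<Longrightarrow> \<bar>g x y\<bar> \<le> M"
    using assms by (force simp: buc_on_def bounded_iff)
  have uc: "uniformly_continuous_on ?U (\<lambda>p. g (fst p) (snd p))"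
    using assms by (simp add: buc_on_def)
  have cont: "continuous_on {-1..1} (g x)" for x
    using continuous_on_compose2[OF uniformly_continuous_imp_continuous[OF uc], of "{-1..1}" "Pair x"]
      continuous_on_Pair[OF continuous_on_const continuous_on_id, of "{-1..1}" x]
    by auto
  have int: "g x integrable_on {-1..1}" for x
    using cont by (rule integrable_continuous_interval)
  have "\<bar>integral {-1..1} (g x)\<bar> \<le> 2 * M" for x
    using integral_bound[OF _ cont, of x M] M by (simp add: mult.commute)
  then have b: "bounded (range (\<lambda>x. integral {-1..1} (g x)))"
    by (auto simp: bounded_iff)
  have "uniformly_continuous_on UNIV (\<lambda>x. integral {-1..1} (g x))"
    unfolding uniformly_continuous_on_def
  proof (intro allI impI)
    fix e :: real assume "e > 0"
    then have "e / 4 > 0" by simp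
    then obtain d where d: "d > 0" "\<And>p q. p \<in> ?U \<Longrightarrow> q \<in> ?U \<Longrightarrow> dist q p < d \<Longrightarrow>
        dist (g (fst q) (snd q)) (g (fst p) (snd p)) < e / 4"
      using uc unfolding uniformly_continuous_on_def by metis
    show "\<exists>d>0. \<forall>x\<in>UNIV. \<forall>x'\<in>UNIV. dist x' x < d \<longrightarrow>
        dist (integral {-1..1} (g x')) (integral {-1..1} (g x)) < e"
    proof (intro exI[of _ d] conjI ballI impI)
      fix x x' :: real assume xx: "dist x' x < d"
      have le: "norm (g x' y - g x y) \<le> e / 4" if "y \<in> {-1..1}" for y
        using d(2)[of "(x, y)" "(x', y)"] that xx by (auto simp: dist_Pair_Pair dist_real_def)
      have "norm (integral {-1..1} (\<lambda>y. g x' y - g x y)) \<le> e / 4 * (1 - (-1))"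
        using le by (intro integral_bound continuous_on_diff cont) auto
      then show "dist (integral {-1..1} (g x')) (integral {-1..1} (g x)) < e"
        using \<open>e > 0\<close> by (simp add: dist_real_def integral_diff[OF int int])
    qed (rule d)
  qed
  with b show ?thesis by (simp add: UCb_def)
qed

lemma HCb_subset_UCb_n: "HCb k \<subseteq> UCb_n k"
proof -
  have uc: "uniformly_continuous_on UNIV g" if g: "hoelder g" for g
  proof -
    obtain K \<theta> where K: "K \<ge> 0" "0 < \<theta>" "\<And>x y. \<bar>g x - g y\<bar> \<le> K * \<bar>x - y\<bar> powr \<theta>"
      using g by (auto simp: hoelder_def)
    show ?thesis unfolding uniformly_continuous_on_def
    proof (intro allI impI)
      fix e :: real assume e: "e > 0"
      define d where "d = (e / (K + 1)) powr (1 / \<theta>)"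
      have d: "d > 0" using e K by (simp add: d_def)
      have "dist (g y) (g x) < e" if "dist y x < d" for x y
      proof -
        have "\<bar>y - x\<bar> powr \<theta> \<le> d powr \<theta>"
          using that K by (intro powr_mono2) (auto simp: dist_real_def)
        also have "d powr \<theta> = e / (K + 1)"
          using K e by (simp add: d_def powr_powr)
        finally have "\<bar>g y - g x\<bar> \<le> K * (e / (K + 1))"
          using K by (meson mult_left_mono order_trans)
        also have "\<dots> < e" using K e by (simp add: field_simps)
        finally show ?thesis by (simp add: dist_real_def)
      qed
      with d show "\<exists>d>0. \<forall>x\<in>UNIV. \<forall>x'\<in>UNIV. dist x' x < d \<longrightarrow> dist (g x') (g x) < e" by blast
    qed
  qed
  show ?thesis
  proof
    fix f assume f: "f \<in> HCb k"
    have *: "(deriv ^^ j) f \<in> UCb" if "j \<le> k" for j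
      using f that uc by (auto simp: HCb_def UCb_def)
    have "f \<in> UCb" using *[of 0] by simp
    with * show "f \<in> UCb_n k"
      using f by (simp add: UCb_n_def HCb_def)
  qed
qed

lemma UCb_n_0: "UCb_n 0 = UCb"
  by (auto simp: UCb_n_def)

lemma UCb_n_Suc:
  "f \<in> UCb_n (Suc n) \<longleftrightarrow> f \<in> UCb \<and> (\<forall>x. f field_differentiable at x) \<and> deriv f \<in> UCb_n n"
proof -
  have A: "(\<forall>k<Suc n. P k) \<longleftrightarrow> P 0 \<and> (\<forall>k<n. P (Suc k))" for P :: "nat \<Rightarrow> bool"
    by (auto simp: less_Suc_eq_0_disj)
  have B: "(\<forall>k\<in>{1..Suc n}. P k) \<longleftrightarrow> P 1 \<and> (\<forall>k\<in>{1..n}. P (Suc k))" for P :: "nat \<Rightarrow> bool"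
  proof -
    have "{1..Suc n} = insert 1 (Suc ` {1..n})" 
      by (simp add: image_Suc_atLeastAtMost atLeastAtMost_insertL)
    then show ?thesis by (simp only: ball_simps)
  qed
  show ?thesis
    unfolding UCb_n_def mem_Collect_eq A[of "\<lambda>k. \<forall>x. (deriv ^^ k) f field_differentiable at x"]
      B[of "\<lambda>k. (deriv ^^ k) f \<in> UCb"] funpow_Suc_right o_apply funpow_0
    by auto
qed

lemma UCb_n_mono: "m \<le> n \<Longrightarrow> UCb_n n \<subseteq> UCb_n m"
  by (auto simp: UCb_n_def)

lemma UCb_n_imp_UCb: "f \<in> UCb_n n \<Longrightarrow> f \<in> UCb"
  by (auto simp: UCb_n_def)

lemma UCb_n_deriv: "f \<in> UCb_n (n + k) \<Longrightarrow> (deriv ^^ k) f \<in> UCb_n n"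
proof (induction k arbitrary: f)
  case (Suc k)
  then have "deriv f \<in> UCb_n (n + k)" by (simp add: UCb_n_Suc)
  from Suc.IH[OF this] show ?case by (simp add: funpow_Suc_right del: funpow.simps)
qed simp

lemma UCb_n_add:
  "f \<in> UCb_n n \<Longrightarrow> g \<in> UCb_n n \<Longrightarrow> (\<lambda>x. f x + g x) \<in> UCb_n n"
proof (induction n arbitrary: f g)
  case 0
  then show ?case by (auto simp: UCb_n_0 UCb_iff_buc)
next
  case (Suc n)
  then have fd: "\<And>x. f field_differentiable at x" "\<And>x. g field_differentiable at x"
    by (auto simp: UCb_n_Suc)
  have "deriv (\<lambda>x. f x + g x) = (\<lambda>x. deriv f x + deriv g x)"
    using fd by auto
  moreover have "(\<lambda>x. f x + g x) \<in> UCb"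
    using Suc.prems by (auto simp: UCb_n_Suc UCb_iff_buc)
  ultimately show ?case
    using Suc fd by (auto simp: UCb_n_Suc intro: field_differentiable_add)
qed

lemma UCb_n_mult:
  "f \<in> UCb_n n \<Longrightarrow> g \<in> UCb_n n \<Longrightarrow> (\<lambda>x. f x * g x) \<in> UCb_n n"
proof (induction n arbitrary: f g)
  case 0
  then show ?case by (auto simp: UCb_n_0 UCb_iff_buc)
next
  case (Suc n)
  then have fd: "\<And>x. f field_differentiable at x" "\<And>x. g field_differentiable at x"
    by (auto simp: UCb_n_Suc)
  have "deriv (\<lambda>x. f x * g x) = (\<lambda>x. f x * deriv g x + deriv f x * g x)"
    using fd by auto
  moreover have "(\<lambda>x. f x * g x) \<in> UCb"
    using Suc.prems by (auto simp: UCb_n_Suc UCb_iff_buc)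
  moreover have "f \<in> UCb_n n" "g \<in> UCb_n n"
    using Suc.prems UCb_n_mono[of n "Suc n"] by auto
  moreover have "deriv f \<in> UCb_n n" "deriv g \<in> UCb_n n"
    using Suc.prems by (auto simp: UCb_n_Suc)
  ultimately show ?case
    using Suc.IH fd by (auto simp: UCb_n_Suc intro!: field_differentiable_mult UCb_n_add)
qed


section \<open>The Banach space of bounded uniformly continuous functions\<close>

typedef ucb = UCb
  morphisms apply_ucb Abs_ucb
  by (rule exI[of _ "\<lambda>_. 0"]) (auto simp: UCb_iff_buc)

lemma apply_ucb_mem [simp]: "apply_ucb f \<in> UCb"
  by (rule apply_ucb)

lemma apply_ucb_buc [intro]: "buc_on UNIV (apply_ucb f)"
  using apply_ucb by (simp add: UCb_iff_buc)

lemma ucb_eqI: "(\<And>x. apply_ucb f x = apply_ucb g x) \<Longrightarrow> f = g"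
  by (simp add: apply_ucb_inject[symmetric] fun_eq_iff)

instantiation ucb :: real_vector
begin

definition "0 = Abs_ucb (\<lambda>_. 0)"
definition "f + g = Abs_ucb (\<lambda>x. apply_ucb f x + apply_ucb g x)"
definition "- f = Abs_ucb (\<lambda>x. - apply_ucb f x)"
definition "f - g = Abs_ucb (\<lambda>x. apply_ucb f x - apply_ucb g x)"
definition "r *\<^sub>R f = Abs_ucb (\<lambda>x. r * apply_ucb f x)"

lemma apply_ucb_zero [simp]: "apply_ucb 0 x = 0"
  unfolding zero_ucb_def by (subst Abs_ucb_inverse) (auto simp: UCb_iff_buc)

lemma apply_ucb_add [simp]: "apply_ucb (f + g) x = apply_ucb f x + apply_ucb g x"
  unfolding plus_ucb_def by (subst Abs_ucb_inverse) (auto simp: UCb_iff_buc)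

lemma apply_ucb_uminus [simp]: "apply_ucb (- f) x = - apply_ucb f x"
  unfolding uminus_ucb_def by (subst Abs_ucb_inverse) (auto simp: UCb_iff_buc)

lemma apply_ucb_diff [simp]: "apply_ucb (f - g) x = apply_ucb f x - apply_ucb g x"
  unfolding minus_ucb_def by (subst Abs_ucb_inverse) (auto simp: UCb_iff_buc)

lemma apply_ucb_scaleR [simp]: "apply_ucb (r *\<^sub>R f) x = r * apply_ucb f x"
  unfolding scaleR_ucb_def by (subst Abs_ucb_inverse) (auto simp: UCb_iff_buc)

instance
  by standard (auto intro!: ucb_eqI simp: algebra_simps)

end

instantiation ucb :: real_normed_vector
begin

definition norm_ucb :: "ucb \<Rightarrow> real" where
  "norm_ucb f = (SUP x. \<bar>apply_ucb f x\<bar>)"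
definition dist_ucb :: "ucb \<Rightarrow> ucb \<Rightarrow> real" where
  "dist_ucb f g = norm (f - g)"
definition sgn_ucb :: "ucb \<Rightarrow> ucb" where
  "sgn_ucb f = f /\<^sub>R norm f"
definition uniformity_ucb :: "(ucb \<times> ucb) filter" where
  "uniformity_ucb = (INF e\<in>{0<..}. principal {(x, y). dist x y < e})"
definition open_ucb :: "ucb set \<Rightarrow> bool" where
  "open_ucb S = (\<forall>x\<in>S. \<forall>\<^sub>F (x', y) in uniformity. x' = x \<longrightarrow> y \<in> S)"

lemma bdd_above_ucb: "bdd_above (range (\<lambda>x. \<bar>apply_ucb f x\<bar>))"
  using apply_ucb[of f] by (auto simp: UCb_def bounded_iff bdd_above_def)

lemma abs_apply_ucb_le: "\<bar>apply_ucb f x\<bar> \<le> norm f"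
  unfolding norm_ucb_def by (rule cSUP_upper[OF _ bdd_above_ucb]) simp

lemma norm_ucb_leI: "(\<And>x. \<bar>apply_ucb f x\<bar> \<le> B) \<Longrightarrow> norm f \<le> B"
  unfolding norm_ucb_def by (rule cSUP_least) auto

instance
proof
  fix f g :: ucb and r :: real
  have nn: "norm h \<ge> 0" for h :: ucb
    using abs_apply_ucb_le[of h 0] by linarith
  show "(norm f = 0) = (f = 0)"
  proof
    assume "norm f = 0"
    then show "f = 0"
      using abs_apply_ucb_le[of f] by (intro ucb_eqI) simp
  next
    assume "f = 0"
    then have "norm f \<le> 0" by (auto intro: norm_ucb_leI)
    with nn[of f] show "norm f = 0" by simp
  qed
  show "norm (f + g) \<le> norm f + norm g"
    using abs_apply_ucb_le[of f] abs_apply_ucb_le[of g]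
    by (intro norm_ucb_leI) (simp, metis abs_triangle_ineq add_mono order_trans)
  have le: "norm (s *\<^sub>R h) \<le> \<bar>s\<bar> * norm h" for s and h :: ucb
    using abs_apply_ucb_le[of h] by (intro norm_ucb_leI) (simp add: abs_mult mult_left_mono)
  show "norm (r *\<^sub>R f) = \<bar>r\<bar> * norm f"
  proof (cases "r = 0")
    case True
    then show ?thesis using le[of 0 f] nn[of "0 *\<^sub>R f"] by simp
  next
    case False
    have "norm f \<le> \<bar>inverse r\<bar> * norm (r *\<^sub>R f)"
      using le[of "inverse r" "r *\<^sub>R f"] False by simp
    then have "\<bar>r\<bar> * norm f \<le> norm (r *\<^sub>R f)"
      using False by (simp add: field_simps)
    with le[of r f] show ?thesis by simp
  qed
qed (simp_all only: dist_ucb_def sgn_ucb_def uniformity_ucb_def open_ucb_def)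

end

instance ucb :: banach
proof
  fix X :: "nat \<Rightarrow> ucb"
  assume C: "Cauchy X"
  have le: "\<bar>apply_ucb (X m) x - apply_ucb (X n) x\<bar> \<le> norm (X m - X n)" for m n x
    using abs_apply_ucb_le[of "X m - X n" x] by simp
  have "uniformly_Cauchy_on UNIV (\<lambda>n. apply_ucb (X n))"
    unfolding uniformly_Cauchy_on_def
    using C le unfolding Cauchy_def dist_norm real_norm_def by (meson le_less_trans)
  then obtain g where g: "uniform_limit UNIV (\<lambda>n. apply_ucb (X n)) g sequentially"
    using Cauchy_uniformly_convergent uniformly_convergent_on_def by blast
  have lim: "\<exists>N. \<forall>n\<ge>N. \<forall>x. \<bar>apply_ucb (X n) x - g x\<bar> < e" if "e > 0" for e
    using g that unfolding uniform_limit_sequentially_iff dist_real_def by blast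
  have "g \<in> UCb"
  proof -
    obtain N where N: "\<And>x. \<bar>apply_ucb (X N) x - g x\<bar> < 1"
      using lim[of 1] by auto
    have "\<bar>g x\<bar> \<le> norm (X N) + 1" for x
      using N[of x] abs_apply_ucb_le[of "X N" x] by linarith
    then have "bounded (range g)" by (auto simp: bounded_iff)
    moreover have "uniformly_continuous_on UNIV g"
      unfolding uniformly_continuous_on_def
    proof (intro allI impI)
      fix e :: real assume "e > 0"
      then have e: "e / 3 > 0" by simp
      obtain N where N: "\<And>x. \<bar>apply_ucb (X N) x - g x\<bar> < e / 3"
        using lim[OF e] by auto
      obtain d where d: "d > 0"
        "\<And>x y. dist y x < d \<Longrightarrow> dist (apply_ucb (X N) y) (apply_ucb (X N) x) < e / 3"
        using apply_ucb[of "X N"] e unfolding UCb_def uniformly_continuous_on_def by blast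
      have "dist (g y) (g x) < e" if "dist y x < d" for x y
        using d(2)[OF that] N[of x] N[of y] unfolding dist_real_def by linarith
      with d(1) show "\<exists>d>0. \<forall>x\<in>UNIV. \<forall>y\<in>UNIV. dist y x < d \<longrightarrow> dist (g y) (g x) < e" by blast
    qed
    ultimately show ?thesis by (simp add: UCb_def)
  qed
  then obtain G where G: "apply_ucb G = g"
    using Abs_ucb_inverse by blast
  have "X \<longlonglongrightarrow> G"
    unfolding LIMSEQ_def
  proof (intro allI impI)
    fix e :: real assume e: "e > 0"
    then obtain N where N: "\<And>n x. n \<ge> N \<Longrightarrow> \<bar>apply_ucb (X n) x - g x\<bar> < e / 2"
      using lim[of "e / 2"] by auto
    have "dist (X n) G < e" if "n \<ge> N" for n
    proof -
      have "norm (X n - G) \<le> e / 2"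
        using N[OF that] by (intro norm_ucb_leI) (simp add: G less_imp_le)
      with e show ?thesis by (simp add: dist_norm)
    qed
    then show "\<exists>N. \<forall>n\<ge>N. dist (X n) G < e" by blast
  qed
  then show "convergent X" by (rule convergentI)
qed


section \<open>Unbounded operators and semigroups\<close>

text \<open>A (partially defined) operator is represented by its graph: its domain is
  \<open>Domain A\<close> and its closure has graph \<open>closure A\<close>.\<close>

definition closable :: "('a::real_normed_vector \<times> 'a) set \<Rightarrow> bool" where
  "closable A \<longleftrightarrow> single_valued (closure A)"

text \<open>Only the values of a semigroup at \<open>t \<ge> 0\<close> matter.\<close>

definition C0_semigroup :: "(real \<Rightarrow> 'a::banach \<Rightarrow>\<^sub>L 'a) \<Rightarrow> bool" where
  "C0_semigroup T \<longleftrightarrow> T 0 = id_blinfun \<and>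
     (\<forall>s\<ge>0. \<forall>t\<ge>0. T (s + t) = T s o\<^sub>L T t) \<and>
     (\<forall>x. continuous_on {0..} (\<lambda>t. T t x))"

definition generator_graph :: "(real \<Rightarrow> 'a::banach \<Rightarrow>\<^sub>L 'a) \<Rightarrow> ('a \<times> 'a) set" where
  "generator_graph T = {(x, y). ((\<lambda>h. (T h x - x) /\<^sub>R h) \<longlongrightarrow> y) (at_right 0)}"

definition generates :: "('a::banach \<times> 'a) set \<Rightarrow> (real \<Rightarrow> 'a \<Rightarrow>\<^sub>L 'a) \<Rightarrow> bool" where
  "generates L T \<longleftrightarrow> C0_semigroup T \<and> generator_graph T = L"

text \<open>The semigroup \<open>e\<^bsup>tL\<^esup>\<close>; a generator determines it uniquely at all \<open>t \<ge> 0\<close>, so the choice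
  is immaterial there.\<close>

definition semigroup_of :: "('a::banach \<times> 'a) set \<Rightarrow> real \<Rightarrow> 'a \<Rightarrow>\<^sub>L 'a" where
  "semigroup_of L = (SOME T. generates L T)"

definition classical_solution ::
    "('a::banach \<times> 'a) set \<Rightarrow> 'a \<Rightarrow> (real \<Rightarrow> 'a) \<Rightarrow> bool" where
  "classical_solution L u0 U \<longleftrightarrow> U 0 = u0 \<and>
     (\<exists>U'. continuous_on {0..} U' \<and>
        (\<forall>t\<ge>0. (U has_vector_derivative U' t) (at t within {0..}) \<and> (U t, U' t) \<in> L))"

definition mild_solution ::
    "('a::banach \<times> 'a) set \<Rightarrow> 'a \<Rightarrow> (real \<Rightarrow> 'a) \<Rightarrow> bool" where
  "mild_solution L u0 U \<longleftrightarrow> continuous_on {0..} U \<and>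
     (\<forall>t\<ge>0. \<exists>y. (integral {0..t} U, y) \<in> L \<and> U t = u0 + y)"


section \<open>The differential operator and its Chernoff function\<close>

definition diff_expr ::
    "(real \<Rightarrow> real) \<Rightarrow> (real \<Rightarrow> real) \<Rightarrow> (real \<Rightarrow> real) \<Rightarrow> (real \<Rightarrow> real) \<Rightarrow> real \<Rightarrow> real" where
  "diff_expr a b c f x = a x * (deriv ^^ 2) f x + b x * deriv f x + c x * f x"

text \<open>Meaningful when \<open>diff_expr a b c f\<close> belongs to \<open>UCb\<close>; see the lemmas below.\<close>

definition diff_op ::
    "(real \<Rightarrow> real) \<Rightarrow> (real \<Rightarrow> real) \<Rightarrow> (real \<Rightarrow> real) \<Rightarrow> ucb \<Rightarrow> ucb" where
  "diff_op a b c f = Abs_ucb (diff_expr a b c (apply_ucb f))"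

definition H_graph ::
    "(real \<Rightarrow> real) \<Rightarrow> (real \<Rightarrow> real) \<Rightarrow> (real \<Rightarrow> real) \<Rightarrow> (ucb \<times> ucb) set" where
  "H_graph a b c = {(f, diff_op a b c f) | f. apply_ucb f \<in> HCb 2}"

lemma diff_expr_UCb_n:
  assumes "a \<in> UCb_n n" "b \<in> UCb_n n" "c \<in> UCb_n n" "f \<in> UCb_n (n + 2)"
  shows "diff_expr a b c f \<in> UCb_n n"
proof -
  have 2: "(deriv ^^ 2) f \<in> UCb_n n"
    using assms(4) by (rule UCb_n_deriv)
  have "f \<in> UCb_n (n + 1)"
    using assms(4) UCb_n_mono[of "n + 1" "n + 2"] by auto
  then have 1: "deriv f \<in> UCb_n n"
    using UCb_n_deriv[of f n 1] by simp
  have 0: "f \<in> UCb_n n"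
    using assms(4) UCb_n_mono[of n "n + 2"] by auto
  show ?thesis
    unfolding diff_expr_def by (intro UCb_n_add UCb_n_mult assms 0 1 2)
qed

lemma apply_diff_op:
  assumes "a \<in> UCb" "b \<in> UCb" "c \<in> UCb" "apply_ucb f \<in> UCb_n 2"
  shows "apply_ucb (diff_op a b c f) = diff_expr a b c (apply_ucb f)"
proof -
  have "diff_expr a b c (apply_ucb f) \<in> UCb"
    using diff_expr_UCb_n[of a 0 b c "apply_ucb f"] assms by (simp add: UCb_n_0 numeral_2_eq_2)
  then show ?thesis by (simp add: diff_op_def Abs_ucb_inverse)
qed

lemma apply_diff_op_twice:
  assumes "a \<in> UCb_n 2" "b \<in> UCb_n 2" "c \<in> UCb_n 2" "apply_ucb f \<in> Cb_inf"
  shows "apply_ucb (diff_op a b c (diff_op a b c f)) =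
         diff_expr a b c (diff_expr a b c (apply_ucb f))"
proof -
  have abc: "a \<in> UCb" "b \<in> UCb" "c \<in> UCb" using assms UCb_n_imp_UCb by auto
  have f: "apply_ucb f \<in> UCb_n 2" "apply_ucb f \<in> UCb_n (2 + 2)"
    using assms(4) by (auto simp: Cb_inf_def)
  have "diff_expr a b c (apply_ucb f) \<in> UCb_n 2"
    by (rule diff_expr_UCb_n[OF assms(1-3) f(2)])
  then show ?thesis using apply_diff_op abc f(1) by metis
qed

lemma apply_H:
  assumes "a \<in> UCb" "b \<in> UCb" "c \<in> UCb" "(f, g) \<in> H_graph a b c"
  shows "apply_ucb g = diff_expr a b c (apply_ucb f)"
proof -
  have "apply_ucb f \<in> UCb_n 2" and g: "g = diff_op a b c f"
    using assms(4) HCb_subset_UCb_n[of 2] by (auto simp: H_graph_def)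
  then show ?thesis using apply_diff_op assms(1-3) by blast
qed

definition coefP :: "(real \<Rightarrow> real) \<Rightarrow> (real \<Rightarrow> real) \<Rightarrow> (real \<Rightarrow> real) \<Rightarrow> real \<Rightarrow> real" where
  "coefP a b c x = a x * (deriv ^^ 2) c x + b x * deriv c x + (c x)\<^sup>2"

definition coefQ :: "(real \<Rightarrow> real) \<Rightarrow> (real \<Rightarrow> real) \<Rightarrow> (real \<Rightarrow> real) \<Rightarrow> real \<Rightarrow> real" where
  "coefQ a b c x = a x * (deriv ^^ 2) b x + 2 * a x * deriv c x + b x * deriv b x"

definition coefR :: "(real \<Rightarrow> real) \<Rightarrow> (real \<Rightarrow> real) \<Rightarrow> real \<Rightarrow> real" where
  "coefR a b x = a x * (deriv ^^ 2) a x + 2 * a x * deriv b x + b x * deriv a x"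

text \<open>The polynomial with coefficients \<open>beta a b c j t x\<close> has the moments
  \<open>P t^2 / 2\<close>, \<open>Q t^(7/4) / 2\<close>, \<open>R t^(3/2)\<close>, \<open>6 a a' t^(5/4)\<close>, \<open>24/5 a^2 t\<close>, \<open>0\<close>, \<open>0\<close> of orders 0 to 6
  on \<open>[-1, 1]\<close>.\<close>

definition beta ::
    "(real \<Rightarrow> real) \<Rightarrow> (real \<Rightarrow> real) \<Rightarrow> (real \<Rightarrow> real) \<Rightarrow> nat \<Rightarrow> real \<Rightarrow> real \<Rightarrow> real" where
  "beta a b c j t x =
     [1225 / 1024 * coefP a b c x * t ^ 2 - 11025 / 512 * coefR a b x * t powr (3 / 2)
        + 14553 / 64 * (a x)\<^sup>2 * t,
      3675 / 256 * coefQ a b c x * t powr (7 / 4) - 19845 / 32 * a x * deriv a x * t powr (5 / 4),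
      - (11025 / 1024) * coefP a b c x * t ^ 2 + 178605 / 512 * coefR a b x * t powr (3 / 2)
        - 280665 / 64 * (a x)\<^sup>2 * t,
      - (6615 / 128) * coefQ a b c x * t powr (7 / 4) + 42525 / 16 * a x * deriv a x * t powr (5 / 4),
      24255 / 1024 * coefP a b c x * t ^ 2 - 467775 / 512 * coefR a b x * t powr (3 / 2)
        + 800415 / 64 * (a x)\<^sup>2 * t,
      10395 / 256 * coefQ a b c x * t powr (7 / 4) - 72765 / 32 * a x * deriv a x * t powr (5 / 4),
      - (15015 / 1024) * coefP a b c x * t ^ 2 + 315315 / 512 * coefR a b x * t powr (3 / 2)
        - 567567 / 64 * (a x)\<^sup>2 * t] ! j"

definition chernoff_expr ::
    "(real \<Rightarrow> real) \<Rightarrow> (real \<Rightarrow> real) \<Rightarrow> (real \<Rightarrow> real) \<Rightarrow> real \<Rightarrow> (real \<Rightarrow> real) \<Rightarrow> real \<Rightarrow> real" where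
  "chernoff_expr a b c t f x =
     integral {-1..1} (\<lambda>y. 1 / 2 * (1 + c x * t) * f (x + sqrt (6 * a x * t) * y + b x * t)) +
     integral {-1..1} (\<lambda>y. (\<Sum>j=0..6. beta a b c j t x * y ^ j) * f (x + y * t powr (1 / 4)))"

definition chernoff ::
    "(real \<Rightarrow> real) \<Rightarrow> (real \<Rightarrow> real) \<Rightarrow> (real \<Rightarrow> real) \<Rightarrow> real \<Rightarrow> ucb \<Rightarrow> ucb" where
  "chernoff a b c t f = Abs_ucb (chernoff_expr a b c t (apply_ucb f))"

lemma beta_UCb:
  assumes "a \<in> UCb_n 2" "b \<in> UCb_n 2" "c \<in> UCb_n 2" "j \<le> 6"
  shows "beta a b c j t \<in> UCb"
proof -
  have *: "buc_on UNIV g" "buc_on UNIV (deriv g)" "buc_on UNIV ((deriv ^^ 2) g)"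
    if "g \<in> UCb_n 2" for g
    using that by (simp_all add: UCb_iff_buc[symmetric] numeral_2_eq_2 UCb_n_Suc UCb_n_0)
  note abc = *[OF assms(1)] *[OF assms(2)] *[OF assms(3)]
  have PQR: "buc_on UNIV (coefP a b c)" "buc_on UNIV (coefQ a b c)" "buc_on UNIV (coefR a b)"
    unfolding coefP_def coefQ_def coefR_def
    by (intro buc_on_add buc_on_mult buc_on_power buc_on_const abc)+
  have "j = 0 \<or> j = 1 \<or> j = 2 \<or> j = 3 \<or> j = 4 \<or> j = 5 \<or> j = 6"
    using assms(4) by linarith
  then have "buc_on UNIV (beta a b c j t)"
    by (elim disjE; hypsubst; unfold beta_def[abs_def];
        simp only: nth_Cons_0 nth_Cons_numeral nth_Cons_Suc One_nat_def
          diff_Suc_1 pred_numeral_simps eval_nat_numeral BitM.simps;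
        intro buc_on_diff buc_on_add buc_on_mult buc_on_power buc_on_const abc PQR)
  then show ?thesis by (simp add: UCb_iff_buc)
qed

lemma apply_chernoff:
  assumes "a \<in> UCb_n 2" "b \<in> UCb_n 2" "c \<in> UCb_n 2"
  shows "apply_ucb (chernoff a b c t f) = chernoff_expr a b c t (apply_ucb f)"
proof -
  let ?U = "UNIV \<times> {-1..1} :: (real \<times> real) set"
  have abc: "a \<in> UCb" "b \<in> UCb" "c \<in> UCb" using assms UCb_n_imp_UCb by auto
  note fsts = abc[THEN buc_on_fst[where S = ?U]]
  have "buc_on ?U (\<lambda>p. sqrt (6 * a (fst p) * t) * snd p + b (fst p) * t)"
    by (intro buc_on_add buc_on_mult buc_on_sqrt buc_on_const fsts buc_on_snd)
  then have "uniformly_continuous_on ?U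
      (\<lambda>p. fst p + (sqrt (6 * a (fst p) * t) * snd p + b (fst p) * t))"
    by (intro uniformly_continuous_on_add[OF uniformly_continuous_on_fst]) (simp add: buc_on_def)
  then have 1: "buc_on ?U
      (\<lambda>p. apply_ucb f (fst p + sqrt (6 * a (fst p) * t) * snd p + b (fst p) * t))"
    using buc_on_compose[OF apply_ucb_mem] by (simp add: add.assoc)
  have "buc_on ?U (\<lambda>p. snd p * t powr (1 / 4))"
    by (intro buc_on_mult buc_on_const buc_on_snd)
  then have 2: "buc_on ?U (\<lambda>p. apply_ucb f (fst p + snd p * t powr (1 / 4)))"
    by (intro buc_on_compose[OF apply_ucb_mem] uniformly_continuous_on_add[OF uniformly_continuous_on_fst])
       (simp add: buc_on_def)
  have 3: "buc_on ?U (\<lambda>p. \<Sum>j=0..6. beta a b c j t (fst p) * snd p ^ j)"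
    by (intro buc_on_sum buc_on_mult buc_on_power buc_on_snd buc_on_fst beta_UCb[OF assms]) auto
  have "chernoff_expr a b c t (apply_ucb f) \<in> UCb"
    unfolding chernoff_expr_def UCb_iff_buc
    by (intro buc_on_add UCb_integral[unfolded UCb_iff_buc] buc_on_mult buc_on_const fsts 1 2 3)
  then show ?thesis by (simp add: chernoff_def Abs_ucb_inverse)
qed

end

theory Submission
  imports Defs
begin

text \<open>The operator is \<open>L u = a u'' + b u' + c u\<close>. The proof rests on the fact that in one space dimension
  its closure can be named: it is \<open>L\<close> on the whole of \<open>UC\<^sub>b\<^sup>2\<close> (\<open>closure_H_graph\<close>). With
  \<open>\<gamma> = sup c\<close>, the maximum principle makes \<open>L - \<gamma>\<close> dissipative (\<open>max_principle_norm\<close>), and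
  \<open>1 - h (L - \<gamma>)\<close> maps \<open>UC\<^sub>b\<^sup>2\<close> onto \<open>UC\<^sub>b\<close> for every \<open>h > 0\<close> (\<open>elliptic_solvable\<close>): the equation
  \<open>u'' - \<mu> u = f\<close> is solved by factorisation, and the continuity method carries solvability over to
  variable coefficients, because the maximum principle together with \<open>a u'' = L u - b u' - c u\<close> bounds \<open>u\<close>
  in \<open>C\<^sup>2\<close> by the right-hand side uniformly along the homotopy. The resolvent takes continuously
  differentiable data to functions with three derivatives, which lie in the original domain
  \<open>HC\<^sub>b\<^sup>2\<close>; density of such data identifies the closure.

  An m-dissipative operator generates a contraction semigroup (\<open>generates_flow\<close>): the implicit
  Euler scheme with dyadic steps converges, its resolvents being contractions whose one-step errors are of second
  order on the domain of the square. Rescaling by \<open>exp (\<gamma> t)\<close> gives the first item; the second item holds for every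
  exponentially bounded semigroup (\<open>mild_solution_unique\<close>, \<open>classical_solution_unique\<close>).

  For the Chernoff function \<open>S\<close>, let \<open>r = t\<^bsup>1/4\<^esup>\<close>. The first integral moves the argument of \<open>f\<close> by
  \<open>O (r\<^sup>2)\<close>, the second one by \<open>O (r)\<close>, but with a weight of size \<open>O (t)\<close>. Taylor's formula
  turns both into moments on \<open>[-1, 1]\<close>, and the coefficients \<open>\<beta>\<^sub>j\<close> are such that the sum reproduces
  \<open>f + t L f + t\<^sup>2 L\<^sup>2 f / 2\<close> up to \<open>O (t\<^sup>3)\<close> if \<open>f\<close> has eight derivatives
  (\<open>chernoff_order_3\<close>), and \<open>f + t L f\<close> up to \<open>O (t\<^bsup>5/4\<^esup>)\<close> if it has three
  (\<open>chernoff_order_1\<close>). The former is the third item.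

  Convergence follows from stability, \<open>\<parallel>S t\<parallel> \<le> exp (K t)\<close> for \<open>t \<le> 1\<close>, and from the local error along the exact
  orbit, by telescoping (\<open>telescoping\<close>). The local error is controlled because the semigroup \<open>T\<close>
  preserves smoothness (\<open>T_regularity\<close>): \<open>T t\<close> commutes with \<open>L\<close>, and bounds on \<open>u, L u, \<dots>, L\<^sup>k u\<close>
  amount to bounds on \<open>2 k\<close> derivatives of \<open>u\<close> when the coefficients have \<open>2 k - 2\<close> derivatives. For
  \<open>k = 4\<close> this uses the six derivatives of the coefficients and the eight of \<open>f\<close> in the fourth item. For
  \<open>k = 2\<close> two derivatives of the coefficients suffice, and the fifth item follows for \<open>f\<close> with four
  derivatives, hence by density and stability for all \<open>f\<close>.\<close>

section \<open>Contraction semigroups generated by m-dissipative operators\<close>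

lemma tendsto_dense_contractions:
  fixes F :: "nat \<Rightarrow> 'a::banach \<Rightarrow> 'a"
  assumes lin: "\<And>k. linear (F k)" and nrm: "\<And>k x. norm (F k x) \<le> norm x"
    and conv: "\<And>x. x \<in> D \<Longrightarrow> convergent (\<lambda>k. F k x)" and D: "closure D = UNIV"
  shows "convergent (\<lambda>k. F k x)"
proof -
  have "Cauchy (\<lambda>k. F k x)"
  proof (rule metric_CauchyI)
    fix e :: real assume e: "e > 0"
    have "x \<in> closure D" using D by simp
    then obtain y where y: "y \<in> D" "dist y x < e / 3"
      using e unfolding closure_approachable by (metis divide_pos_pos zero_less_numeral)
    have "Cauchy (\<lambda>k. F k y)" using conv[OF y(1)] by (rule convergent_Cauchy)
    then obtain M where M: "\<And>m n. m \<ge> M \<Longrightarrow> n \<ge> M \<Longrightarrow> dist (F m y) (F n y) < e / 3"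
      using e unfolding Cauchy_def by (metis divide_pos_pos zero_less_numeral)
    have near: "dist (F k x) (F k y) < e / 3" for k
      using nrm[of k "x - y"] y(2) by (simp add: linear_diff[OF lin] dist_norm norm_minus_commute)
    have "dist (F m x) (F n x) < e" if "m \<ge> M" "n \<ge> M" for m n
    proof -
      have "dist (F m x) (F n x) \<le> dist (F m x) (F m y) + dist (F m y) (F n y) + dist (F n y) (F n x)"
        by (metis add_right_mono dist_triangle order_trans)
      then show ?thesis using near[of m] near[of n] M[OF that] by (simp add: dist_commute)
    qed
    then show "\<exists>M. \<forall>m\<ge>M. \<forall>n\<ge>M. dist (F m x) (F n x) < e" by blast
  qed
  then show ?thesis by (rule Cauchy_convergent)
qed

text \<open>The hypotheses of the Lumer--Phillips theorem for the operator with graph \<open>A\<close>. Dissipativity and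
  the range condition make \<open>(1 - h A)\<^bsup>-1\<^esup>\<close> an everywhere defined contraction.\<close>

locale m_dissipative =
  fixes A :: "('a::banach \<times> 'a) set"
  assumes subspace_A: "subspace A"
    and dissipative: "(x, y) \<in> A \<Longrightarrow> 0 < h \<Longrightarrow> norm x \<le> norm (x - h *\<^sub>R y)"
    and range_full: "0 < h \<Longrightarrow> \<exists>x y. (x, y) \<in> A \<and> x - h *\<^sub>R y = f"
    and dense: "closure (Domain A) = UNIV"
begin

lemma A_diff: "(x, y) \<in> A \<Longrightarrow> (x', y') \<in> A \<Longrightarrow> (x - x', y - y') \<in> A"
  using subspace_diff[OF subspace_A, of "(x, y)" "(x', y')"] by simp

lemma A_add: "(x, y) \<in> A \<Longrightarrow> (x', y') \<in> A \<Longrightarrow> (x + x', y + y') \<in> A"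
  using subspace_add[OF subspace_A, of "(x, y)" "(x', y')"] by simp

lemma A_scaleR: "(x, y) \<in> A \<Longrightarrow> (r *\<^sub>R x, r *\<^sub>R y) \<in> A"
  using subspace_scale[OF subspace_A, of "(x, y)" r] by simp

lemma resolvent_inj:
  assumes "(x, y) \<in> A" "(x', y') \<in> A" "0 < h" "x - h *\<^sub>R y = x' - h *\<^sub>R y'"
  shows "x = x'"
proof -
  have "norm (x - x') \<le> norm (x - x' - h *\<^sub>R (y - y'))"
    using dissipative[OF A_diff[OF assms(1,2)] assms(3)] .
  also have "x - x' - h *\<^sub>R (y - y') = 0" using assms(4) by (simp add: algebra_simps)
  finally show ?thesis by simp
qed

text \<open>The resolvent \<open>(1 - h A)\<^bsup>-1\<^esup>\<close>, that is, one step of the implicit Euler scheme.\<close>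

definition J :: "real \<Rightarrow> 'a \<Rightarrow> 'a" where
  "J h f = (THE x. \<exists>y. (x, y) \<in> A \<and> x - h *\<^sub>R y = f)"

lemma J_eq: "0 < h \<Longrightarrow> (x, y) \<in> A \<Longrightarrow> x - h *\<^sub>R y = f \<Longrightarrow> J h f = x"
  unfolding J_def by (rule the_equality) (use resolvent_inj in blast)+

lemma J_graph:
  assumes "0 < h"
  obtains y where "(J h f, y) \<in> A" "J h f - h *\<^sub>R y = f"
proof -
  obtain x y where xy: "(x, y) \<in> A" "x - h *\<^sub>R y = f" using range_full[OF assms] by blast
  with J_eq[OF assms xy] show ?thesis using that by blast
qed

lemma norm_J_le: "0 < h \<Longrightarrow> norm (J h f) \<le> norm f"
  by (rule J_graph[of h f]) (use dissipative[of "J h f" _ h] in force)+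

lemma linear_J:
  assumes h: "0 < h" shows "linear (J h)"
proof (rule linearI)
  fix f g r
  obtain y z where y: "(J h f, y) \<in> A" "J h f - h *\<^sub>R y = f"
    and z: "(J h g, z) \<in> A" "J h g - h *\<^sub>R z = g"
    using J_graph[OF h] by metis
  show "J h (f + g) = J h f + J h g"
    by (rule J_eq[OF h A_add[OF y(1) z(1)]])
       (use y(2) z(2) in \<open>metis add_diff_add scaleR_right_distrib\<close>)
  show "J h (r *\<^sub>R f) = r *\<^sub>R J h f"
    by (rule J_eq[OF h A_scaleR[OF y(1)]])
       (use y(2) in \<open>metis scaleR_left_commute scaleR_right_diff_distrib\<close>)
qed

lemma J_on_domain:
  assumes h: "0 < h" and fg: "(f, g) \<in> A"
  shows "J h f - f = h *\<^sub>R J h g" "(J h f, J h g) \<in> A"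
proof -
  have "J h (f - h *\<^sub>R g) = f" by (rule J_eq[OF h fg refl])
  then show 1: "J h f - f = h *\<^sub>R J h g"
    by (simp add: linear_diff[OF linear_J[OF h]] linear_scale[OF linear_J[OF h]] algebra_simps)
  obtain y where y: "(J h f, y) \<in> A" "J h f - h *\<^sub>R y = f" by (rule J_graph[OF h])
  then have "h *\<^sub>R y = h *\<^sub>R J h g" using 1 by (simp add: algebra_simps)
  with h y(1) show "(J h f, J h g) \<in> A" by simp
qed

lemma linear_J_pow: "0 < h \<Longrightarrow> linear (J h ^^ n)"
proof (induction n)
  case 0 then show ?case by (simp add: linear_id[unfolded id_def] id_def)
next
  case (Suc n)
  then show ?case using linear_compose[of "J h ^^ n" "J h"] linear_J by (simp add: o_def)
qed

lemma norm_J_pow_le: "0 < h \<Longrightarrow> norm ((J h ^^ n) f) \<le> norm f"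
  by (induction n) (auto intro: order_trans[OF norm_J_le])

lemma J_pow_graph: "0 < h \<Longrightarrow> (f, g) \<in> A \<Longrightarrow> ((J h ^^ n) f, (J h ^^ n) g) \<in> A"
  by (induction n) (auto intro: J_on_domain)

lemma J_pow_step:
  "0 < h \<Longrightarrow> (f, g) \<in> A \<Longrightarrow> (J h ^^ Suc n) f - (J h ^^ n) f = h *\<^sub>R (J h ^^ Suc n) g"
  using J_on_domain(1)[OF _ J_pow_graph] by simp

lemma J_pow_dist:
  assumes h: "0 < h" and fg: "(f, g) \<in> A"
  shows "norm ((J h ^^ (m + n)) f - (J h ^^ m) f) \<le> real n * h * norm g"
proof (induction n)
  case (Suc n)
  have "norm ((J h ^^ Suc (m + n)) f - (J h ^^ (m + n)) f) \<le> h * norm g"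
    unfolding J_pow_step[OF h fg] norm_scaleR
    using h norm_J_pow_le[OF h] by (simp del: funpow.simps)
  then have "norm ((J h ^^ Suc (m + n)) f - (J h ^^ m) f) \<le> h * norm g + real n * h * norm g"
    using Suc by (rule norm_diff_triangle_le)
  then show ?case by (simp add: algebra_simps)
qed simp

text \<open>The steps add up: \<open>J\<^sup>n f - f\<close> is the sum of the terms \<open>h J\<^bsup>i+1\<^esup> g\<close>, each of which is compared with \<open>h g\<close>.\<close>

lemma J_pow_taylor:
  assumes h: "0 < h" and fg: "(f, g) \<in> A"
    and B: "\<And>i. i \<le> n \<Longrightarrow> norm ((J h ^^ i) g - g) \<le> B"
  shows "norm ((J h ^^ n) f - f - (real n * h) *\<^sub>R g) \<le> real n * h * B"
  using B
proof (induction n)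
  case (Suc n)
  have "(J h ^^ Suc n) f - f - (real (Suc n) * h) *\<^sub>R g =
     ((J h ^^ n) f - f - (real n * h) *\<^sub>R g) + h *\<^sub>R ((J h ^^ Suc n) g - g)"
    using J_pow_step[OF h fg, of n] by (simp add: algebra_simps)
  also have "norm \<dots> \<le> real n * h * B + h * B"
    using Suc h by (intro norm_triangle_mono) (auto simp del: funpow.simps)
  finally show ?case by (simp add: algebra_simps)
qed simp

text \<open>One step of length \<open>h\<close> and \<open>m\<close> steps of length \<open>h / m\<close> both agree with \<open>f + h A f\<close> up to
  \<open>h\<^sup>2 \<parallel>A\<^sup>2 f\<parallel>\<close>.\<close>

lemma J_refine:
  assumes h: "0 < h" and fg: "(f, g) \<in> A" and gk: "(g, k) \<in> A" and m: "m > 0"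
  shows "norm (J h f - (J (h / real m) ^^ m) f) \<le> 2 * h\<^sup>2 * norm k"
proof -
  have *: "norm ((J (h / real n) ^^ n) f - f - h *\<^sub>R g) \<le> h\<^sup>2 * norm k" if n: "n > 0" for n
  proof -
    have h': "0 < h / real n" using h n by simp
    have "norm ((J (h / real n) ^^ i) g - g) \<le> h * norm k" if "i \<le> n" for i
    proof -
      have "norm ((J (h / real n) ^^ i) g - g) \<le> real i * (h / real n) * norm k"
        using J_pow_dist[OF h' gk, of 0 i] by simp
      also have "\<dots> \<le> h * norm k"
        using that h n by (intro mult_right_mono) (auto simp: field_simps)
      finally show ?thesis .
    qed
    then have "norm ((J (h / real n) ^^ n) f - f - (real n * (h / real n)) *\<^sub>R g)
        \<le> real n * (h / real n) * (h * norm k)"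
      by (rule J_pow_taylor[OF h' fg])
    then show ?thesis
      using n by (simp add: power2_eq_square)
  qed
  have "norm ((J h f - f - h *\<^sub>R g) - ((J (h / real m) ^^ m) f - f - h *\<^sub>R g))
      \<le> h\<^sup>2 * norm k + h\<^sup>2 * norm k"
    using *[of 1] *[OF m] by (intro order_trans[OF norm_triangle_ineq4 add_mono]) simp_all
  then show ?thesis by (simp add: algebra_simps)
qed

text \<open>The one-step errors of \<open>J_refine\<close> accumulate linearly, since \<open>J\<close> is a contraction and maps the
  domain of \<open>A\<^sup>2\<close> to itself without increasing \<open>\<parallel>A\<^sup>2 f\<parallel>\<close>.\<close>

lemma J_pow_refine:
  assumes h: "0 < h" and fg: "(f, g) \<in> A" and gk: "(g, k) \<in> A" and m: "m > 0"
  shows "norm ((J h ^^ n) f - (J (h / real m) ^^ (n * m)) f) \<le> real n * (2 * h\<^sup>2 * norm k)"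
proof (induction n)
  case (Suc n)
  let ?J' = "J (h / real m)"
  have h': "0 < h / real m" using h m by simp
  let ?f = "(?J' ^^ (n * m)) f"
  have "norm (J h ?f - (?J' ^^ m) ?f) \<le> 2 * h\<^sup>2 * norm ((?J' ^^ (n * m)) k)"
    by (rule J_refine[OF h J_pow_graph[OF h' fg] J_pow_graph[OF h' gk] m])
  also have "\<dots> \<le> 2 * h\<^sup>2 * norm k"
    using norm_J_pow_le[OF h'] by (intro mult_left_mono) auto
  finally have 1: "norm (J h ?f - (?J' ^^ m) ?f) \<le> 2 * h\<^sup>2 * norm k" .
  have 2: "norm (J h ((J h ^^ n) f) - J h ?f) \<le> real n * (2 * h\<^sup>2 * norm k)"
    using norm_J_le[OF h, of "(J h ^^ n) f - ?f"] Suc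
    by (simp add: linear_diff[OF linear_J[OF h]])
  have "norm (J h ((J h ^^ n) f) - (?J' ^^ m) ?f) \<le> real n * (2 * h\<^sup>2 * norm k) + 2 * h\<^sup>2 * norm k"
    by (rule norm_diff_triangle_le[OF 2 1])
  moreover have "(?J' ^^ m) ?f = (?J' ^^ (Suc n * m)) f"
    by (simp add: funpow_add)
  ultimately show ?case by (simp add: algebra_simps)
qed simp

text \<open>Dyadic steps are nested, so any two levels are comparable by refinement; the last, incomplete step is dropped.\<close>

definition approx :: "nat \<Rightarrow> real \<Rightarrow> 'a \<Rightarrow> 'a" where
  "approx k t = J (1 / 2 ^ k) ^^ nat \<lfloor>2 ^ k * t\<rfloor>"

lemma linear_approx: "linear (approx k t)"
  unfolding approx_def by (rule linear_J_pow) simp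

lemma norm_approx_le: "norm (approx k t f) \<le> norm f"
  unfolding approx_def by (rule norm_J_pow_le) simp

lemma approx_refine:
  assumes fg: "(f, g) \<in> A" and gk: "(g, k) \<in> A" and t: "0 \<le> t"
  shows "norm (approx i t f - approx (i + j) t f) \<le> (2 * t * norm k + norm g) / 2 ^ i"
proof -
  define h :: real where "h = 1 / 2 ^ i"
  define m :: nat where "m = 2 ^ j"
  define n where "n = nat \<lfloor>2 ^ i * t\<rfloor>"
  define N where "N = nat \<lfloor>2 ^ (i + j) * t\<rfloor>"
  have h: "h > 0" "h / real m > 0" and m: "m > 0" by (auto simp: h_def m_def)
  have hm: "h / real m = 1 / 2 ^ (i + j)" by (simp add: h_def m_def power_add)
  have n: "real n \<le> 2 ^ i * t" "2 ^ i * t < real n + 1"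
    using t by (auto simp: n_def intro: floor_le_iff[THEN iffD1])
  have N: "real N \<le> 2 ^ (i + j) * t" "2 ^ (i + j) * t < real N + 1"
    using t by (auto simp: N_def intro: floor_le_iff[THEN iffD1])
  have "real n * 2 ^ j \<le> 2 ^ i * t * 2 ^ j" using n(1) by (rule mult_right_mono) simp
  also have "\<dots> = 2 ^ (i + j) * t" by (simp add: power_add)
  finally have "real (n * m) < real (N + 1)" using N(2) by (simp add: m_def)
  then have le: "n * m \<le> N" by linarith
  have "2 ^ i * t * 2 ^ j < (real n + 1) * 2 ^ j" using n(2) by (rule mult_strict_right_mono) simp
  moreover have "2 ^ (i + j) * t = 2 ^ i * t * 2 ^ j" by (simp add: power_add)
  ultimately have "real N < (real n + 1) * 2 ^ j" using N(1) by linarith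
  also have "\<dots> = real (n * m + m)" by (simp add: m_def algebra_simps)
  finally have up: "N < n * m + m" by linarith
  have "norm ((J h ^^ n) f - (J (h / real m) ^^ (n * m)) f) \<le> real n * (2 * h\<^sup>2 * norm k)"
    by (rule J_pow_refine[OF h(1) fg gk m])
  also have "real n * (2 * h\<^sup>2 * norm k) = (real n * h) * (2 * h * norm k)"
    by (simp add: power2_eq_square)
  also have "\<dots> \<le> t * (2 * h * norm k)"
    using n(1) h(1) by (intro mult_right_mono) (auto simp: h_def field_simps)
  finally have 1: "norm ((J h ^^ n) f - (J (h / real m) ^^ (n * m)) f) \<le> t * (2 * h * norm k)" .
  have "norm ((J (h / real m) ^^ (n * m + (N - n * m))) f - (J (h / real m) ^^ (n * m)) f)
      \<le> real (N - n * m) * (h / real m) * norm g"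
    by (rule J_pow_dist[OF h(2) fg])
  also have "\<dots> \<le> h * norm g"
    using up h m by (intro mult_right_mono) (auto simp: field_simps simp flip: of_nat_mult)
  finally have 2: "norm ((J (h / real m) ^^ (n * m)) f - (J (h / real m) ^^ N) f) \<le> h * norm g"
    using le by (simp add: norm_minus_commute)
  have "norm ((J h ^^ n) f - (J (h / real m) ^^ N) f) \<le> t * (2 * h * norm k) + h * norm g"
    by (rule norm_diff_triangle_le[OF 1 2])
  then show ?thesis
    unfolding hm approx_def n_def N_def by (simp add: h_def field_simps)
qed

text \<open>On the domain, \<open>J h f\<close> tends to \<open>f\<close> as \<open>h\<close> tends to \<open>0\<close>, and it belongs to the domain of \<open>A\<^sup>2\<close>.\<close>

lemma dense_square: "closure {f. \<exists>g k. (f, g) \<in> A \<and> (g, k) \<in> A} = UNIV" (is "closure ?D2 = _")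
proof -
  have "f \<in> closure ?D2" if f: "f \<in> Domain A" for f
  proof -
    obtain g where fg: "(f, g) \<in> A" using f by (rule DomainE)
    show ?thesis unfolding closure_approachable
    proof (intro allI impI)
      fix e :: real assume e: "e > 0"
      define h where "h = e / (2 * (norm g + 1))"
      have h: "h > 0" using e norm_ge_zero[of g] by (simp add: h_def add_nonneg_pos)
      have "norm (J h f - f) = h * norm (J h g)"
        using J_on_domain(1)[OF h fg] h by simp
      also have "\<dots> \<le> h * norm g" using norm_J_le[OF h] h by simp
      also have "\<dots> < e"
      proof -
        have "h * norm g \<le> h * (norm g + 1)" using h by simp
        also have "\<dots> = e / 2" unfolding h_def
          using norm_ge_zero[of g] by (simp add: field_simps add_nonneg_eq_0_iff)
        finally show ?thesis using e by simp
      qed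
      finally have "dist (J h f) f < e" by (simp add: dist_norm)
      moreover have "J h f \<in> ?D2"
        using J_on_domain(2)[OF h fg] J_graph[OF h, of g] by blast
      ultimately show "\<exists>y\<in>?D2. dist y f < e" by blast
    qed
  qed
  then have "closure (Domain A) \<subseteq> closure ?D2"
    by (intro closure_minimal) auto
  then show ?thesis using dense by blast
qed

lemma convergent_approx:
  assumes t: "0 \<le> t" shows "convergent (\<lambda>k. approx k t f)"
proof (rule tendsto_dense_contractions[where F = "\<lambda>k. approx k t", OF linear_approx norm_approx_le _ dense_square])
  fix f assume "f \<in> {f. \<exists>g k. (f, g) \<in> A \<and> (g, k) \<in> A}"
  then obtain g k where fg: "(f, g) \<in> A" "(g, k) \<in> A" by blast
  define C where "C = 2 * t * norm k + norm g"
  have C: "C \<ge> 0" using t by (simp add: C_def)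
  have est: "norm (approx i t f - approx j t f) \<le> C / 2 ^ M" if "M \<le> i" "i \<le> j" for M i j
  proof -
    have "norm (approx i t f - approx j t f) \<le> C / 2 ^ i"
      using approx_refine[OF fg t, of i "j - i"] that by (simp add: C_def)
    also have "\<dots> \<le> C / 2 ^ M" using that C by (intro divide_left_mono power_increasing) auto
    finally show ?thesis .
  qed
  have "Cauchy (\<lambda>k. approx k t f)"
  proof (rule metric_CauchyI)
    fix e :: real assume e: "e > 0"
    have "(\<lambda>M. C / 2 ^ M) \<longlonglongrightarrow> 0"
      by (intro tendsto_divide_0[OF tendsto_const] filterlim_at_top_imp_at_infinity
          filterlim_realpow_sequentially_gt1) auto
    then obtain M where M: "C / 2 ^ M < e"
      using order_tendstoD(2)[OF _ e] eventually_happens[of _ sequentially] by force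
    have "dist (approx m t f) (approx n t f) < e" if "m \<ge> M" "n \<ge> M" for m n
      using est[of M m n] est[of M n m] that M linear[of m n]
      by (auto simp: dist_norm norm_minus_commute)
    then show "\<exists>M. \<forall>m\<ge>M. \<forall>n\<ge>M. dist (approx m t f) (approx n t f) < e" by blast
  qed
  then show "convergent (\<lambda>k. approx k t f)" by (rule Cauchy_convergent)
qed

definition flow :: "real \<Rightarrow> 'a \<Rightarrow>\<^sub>L 'a" where
  "flow t = Blinfun (\<lambda>f. lim (\<lambda>k. approx k t f))"

lemma flow:
  assumes t: "0 \<le> t"
  shows approx_tendsto: "(\<lambda>k. approx k t f) \<longlonglongrightarrow> flow t f"
    and norm_flow_le: "norm (flow t f) \<le> norm f"
proof -
  have lim: "(\<lambda>k. approx k t f) \<longlonglongrightarrow> lim (\<lambda>k. approx k t f)" for f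
    using convergent_approx[OF t] by (simp add: convergent_LIMSEQ_iff)
  have nrm: "norm (lim (\<lambda>k. approx k t f)) \<le> norm f" for f
    by (rule tendsto_upperbound[OF tendsto_norm[OF lim]]) (auto simp: norm_approx_le)
  have "bounded_linear (\<lambda>f. lim (\<lambda>k. approx k t f))"
  proof (rule bounded_linear_intro[where K = 1])
    show "lim (\<lambda>k. approx k t (f + g)) = lim (\<lambda>k. approx k t f) + lim (\<lambda>k. approx k t g)" for f g
      using tendsto_add[OF lim[of f] lim[of g]] linear_add[OF linear_approx]
      by (metis (no_types, lifting) ext limI)
    show "lim (\<lambda>k. approx k t (r *\<^sub>R f)) = r *\<^sub>R lim (\<lambda>k. approx k t f)" for r f
      using tendsto_scaleR[OF tendsto_const lim[of f], of r] linear_scale[OF linear_approx]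
      by (metis (no_types, lifting) ext limI)
  qed (use nrm in simp)
  then have "flow t f = lim (\<lambda>k. approx k t f)" for f
    by (simp add: flow_def bounded_linear_Blinfun_apply)
  then show "(\<lambda>k. approx k t f) \<longlonglongrightarrow> flow t f" "norm (flow t f) \<le> norm f"
    using lim nrm by simp_all
qed

lemma dyadic_floor:
  assumes "0 \<le> t"
  shows "(\<lambda>k. real (nat \<lfloor>2 ^ k * t\<rfloor>) / 2 ^ k) \<longlonglongrightarrow> t"
proof (rule real_tendsto_sandwich[OF always_eventually always_eventually])
  show "\<forall>k. t - 1 / 2 ^ k \<le> real (nat \<lfloor>2 ^ k * t\<rfloor>) / 2 ^ k"
  proof
    fix k :: nat
    have "2 ^ k * t - 1 \<le> real (nat \<lfloor>2 ^ k * t\<rfloor>)" using assms by (simp; linarith)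
    then have "(2 ^ k * t - 1) / 2 ^ k \<le> real (nat \<lfloor>2 ^ k * t\<rfloor>) / 2 ^ k"
      by (rule divide_right_mono) simp
    then show "t - 1 / 2 ^ k \<le> real (nat \<lfloor>2 ^ k * t\<rfloor>) / 2 ^ k" by (simp add: diff_divide_distrib)
  qed
  show "\<forall>k. real (nat \<lfloor>2 ^ k * t\<rfloor>) / 2 ^ k \<le> t"
    using assms by (simp add: field_simps)
  have "(\<lambda>k. 1 / 2 ^ k :: real) \<longlonglongrightarrow> 0"
    by (intro tendsto_divide_0[OF tendsto_const] filterlim_at_top_imp_at_infinity
          filterlim_realpow_sequentially_gt1) auto
  from tendsto_diff[OF tendsto_const this] show "(\<lambda>k. t - 1 / 2 ^ k) \<longlonglongrightarrow> t" by simp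
qed simp

lemma flow_lipschitz:
  assumes fg: "(f, g) \<in> A" and s: "0 \<le> s" "s \<le> t"
  shows "norm (flow t f - flow s f) \<le> (t - s) * norm g"
proof (rule tendsto_le[OF sequentially_bot])
  have t: "0 \<le> t" using s by simp
  show "(\<lambda>k. norm (approx k t f - approx k s f)) \<longlonglongrightarrow> norm (flow t f - flow s f)"
    by (intro tendsto_intros approx_tendsto s t)
  show "(\<lambda>k. (real (nat \<lfloor>2 ^ k * t\<rfloor>) / 2 ^ k - real (nat \<lfloor>2 ^ k * s\<rfloor>) / 2 ^ k) * norm g)
      \<longlonglongrightarrow> (t - s) * norm g"
    by (intro tendsto_intros dyadic_floor s t)
  show "\<forall>\<^sub>F k in sequentially. norm (approx k t f - approx k s f)
    \<le> (real (nat \<lfloor>2 ^ k * t\<rfloor>) / 2 ^ k - real (nat \<lfloor>2 ^ k * s\<rfloor>) / 2 ^ k) * norm g"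
  proof (rule always_eventually, rule)
    fix k :: nat
    have le: "nat \<lfloor>2 ^ k * s\<rfloor> \<le> nat \<lfloor>2 ^ k * t\<rfloor>"
      using s by (intro nat_mono floor_mono mult_left_mono) auto
    from J_pow_dist[OF _ fg, of "1 / 2 ^ k" "nat \<lfloor>2 ^ k * s\<rfloor>" "nat \<lfloor>2 ^ k * t\<rfloor> - nat \<lfloor>2 ^ k * s\<rfloor>"]
    show "norm (approx k t f - approx k s f)
      \<le> (real (nat \<lfloor>2 ^ k * t\<rfloor>) / 2 ^ k - real (nat \<lfloor>2 ^ k * s\<rfloor>) / 2 ^ k) * norm g"
      using le by (simp add: approx_def of_nat_diff diff_divide_distrib)
  qed
qed

text \<open>To be used with elements \<open>g'\<close> of the domain close to \<open>g = A f\<close>: the derivative at \<open>0\<close> is then obtained on the whole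
  domain of \<open>A\<close>, not only on that of \<open>A\<^sup>2\<close>.\<close>

lemma flow_taylor:
  assumes fg: "(f, g) \<in> A" and gk: "(g', k) \<in> A" and t: "0 \<le> t"
  shows "norm (flow t f - f - t *\<^sub>R g) \<le> t * (2 * norm (g - g') + t * norm k)"
proof (rule tendsto_le[OF sequentially_bot])
  show "(\<lambda>i. norm (approx i t f - f - (real (nat \<lfloor>2 ^ i * t\<rfloor>) / 2 ^ i) *\<^sub>R g))
      \<longlonglongrightarrow> norm (flow t f - f - t *\<^sub>R g)"
    by (intro tendsto_intros approx_tendsto dyadic_floor t)
  show "(\<lambda>i. real (nat \<lfloor>2 ^ i * t\<rfloor>) / 2 ^ i * (2 * norm (g - g') + real (nat \<lfloor>2 ^ i * t\<rfloor>) / 2 ^ i * norm k))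
    \<longlonglongrightarrow> t * (2 * norm (g - g') + t * norm k)"
    by (intro tendsto_intros dyadic_floor t)
  show "\<forall>\<^sub>F i in sequentially. norm (approx i t f - f - (real (nat \<lfloor>2 ^ i * t\<rfloor>) / 2 ^ i) *\<^sub>R g)
      \<le> real (nat \<lfloor>2 ^ i * t\<rfloor>) / 2 ^ i * (2 * norm (g - g') + real (nat \<lfloor>2 ^ i * t\<rfloor>) / 2 ^ i * norm k)"
  proof (rule always_eventually, rule)
    fix i :: nat
    define h :: real where "h = 1 / 2 ^ i"
    define n where "n = nat \<lfloor>2 ^ i * t\<rfloor>"
    have h: "h > 0" by (simp add: h_def)
    have "norm ((J h ^^ j) g - g) \<le> 2 * norm (g - g') + real n * h * norm k" if "j \<le> n" for j
    proof -
      have "norm ((J h ^^ j) g - (J h ^^ j) g') \<le> norm (g - g')"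
        using norm_J_pow_le[OF h, of j "g - g'"] by (simp add: linear_diff[OF linear_J_pow[OF h]])
      moreover have "norm ((J h ^^ j) g' - g') \<le> real n * h * norm k"
        using J_pow_dist[OF h gk, of 0 j] that h
        by (auto elim!: order_trans intro!: mult_right_mono)
      ultimately have "norm ((J h ^^ j) g - g') \<le> norm (g - g') + real n * h * norm k"
        by (rule norm_diff_triangle_le)
      then have "norm ((J h ^^ j) g - g) \<le> norm (g - g') + real n * h * norm k + norm (g' - g)"
        by (rule norm_diff_triangle_le) simp
      then show ?thesis by (simp add: norm_minus_commute)
    qed
    from J_pow_taylor[OF h fg this]
    show "norm (approx i t f - f - (real (nat \<lfloor>2 ^ i * t\<rfloor>) / 2 ^ i) *\<^sub>R g)
      \<le> real (nat \<lfloor>2 ^ i * t\<rfloor>) / 2 ^ i * (2 * norm (g - g') + real (nat \<lfloor>2 ^ i * t\<rfloor>) / 2 ^ i * norm k)"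
      by (simp add: approx_def h_def n_def)
  qed
qed

lemma flow_add:
  assumes s: "0 \<le> s" and t: "0 \<le> t"
  shows "flow (s + t) f = flow s (flow t f)"
proof -
  have st: "0 \<le> s + t" using s t by simp
  have eq: "flow (s + t) f - flow s (flow t f) = 0" if fg: "(f, g) \<in> A" for f g
  proof (rule LIMSEQ_unique)
    have *: "(\<lambda>k. approx k s (approx k t f) - approx k s (flow t f)) \<longlonglongrightarrow> 0"
    proof (rule Lim_null_comparison[OF always_eventually])
      show "\<forall>k. norm (approx k s (approx k t f) - approx k s (flow t f)) \<le> norm (approx k t f - flow t f)"
        using norm_approx_le[of _ s] by (simp add: linear_diff[OF linear_approx, symmetric])
      show "(\<lambda>k. norm (approx k t f - flow t f)) \<longlonglongrightarrow> 0"
        using approx_tendsto[OF t, of f] by (simp add: LIM_zero tendsto_norm_zero)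
    qed
    have "(\<lambda>k. approx k s (approx k t f)) \<longlonglongrightarrow> flow s (flow t f)"
      using tendsto_add[OF * approx_tendsto[OF s, of "flow t f"]] by simp
    from tendsto_diff[OF approx_tendsto[OF st] this]
    show "(\<lambda>k. approx k (s + t) f - approx k s (approx k t f)) \<longlonglongrightarrow> flow (s + t) f - flow s (flow t f)" .
    show "(\<lambda>k. approx k (s + t) f - approx k s (approx k t f)) \<longlonglongrightarrow> 0"
    proof (rule Lim_null_comparison[OF always_eventually])
      show "\<forall>k. norm (approx k (s + t) f - approx k s (approx k t f)) \<le> norm g * (1 / 2 ^ k)"
      proof
        fix k :: nat
        define n where "n = nat \<lfloor>2 ^ k * s\<rfloor>"
        define m where "m = nat \<lfloor>2 ^ k * t\<rfloor>"
        define p where "p = nat \<lfloor>2 ^ k * (s + t)\<rfloor>"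
        have n: "real n \<le> 2 ^ k * s" "2 ^ k * s < real n + 1"
          using s by (auto simp: n_def intro: floor_le_iff[THEN iffD1])
        have m: "real m \<le> 2 ^ k * t" "2 ^ k * t < real m + 1"
          using t by (auto simp: m_def intro: floor_le_iff[THEN iffD1])
        have p: "real p \<le> 2 ^ k * (s + t)" "2 ^ k * (s + t) < real p + 1"
          using st by (auto simp: p_def intro: floor_le_iff[THEN iffD1])
        have 2: "(2::real) ^ k * (s + t) = 2 ^ k * s + 2 ^ k * t" by (simp add: algebra_simps)
        have le: "n + m \<le> p" "p \<le> n + m + 1" using n m p unfolding 2 by linarith+
        have "norm ((J (1 / 2 ^ k) ^^ (n + m + (p - (n + m)))) f - (J (1 / 2 ^ k) ^^ (n + m)) f)
           \<le> real (p - (n + m)) * (1 / 2 ^ k) * norm g"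
          by (rule J_pow_dist[OF _ fg]) simp
        also have "\<dots> \<le> 1 * (1 / 2 ^ k) * norm g"
          using le by (intro mult_right_mono) auto
        finally show "norm (approx k (s + t) f - approx k s (approx k t f)) \<le> norm g * (1 / 2 ^ k)"
          using le by (simp add: approx_def n_def[symmetric] m_def[symmetric] p_def[symmetric] funpow_add)
      qed
      have "(\<lambda>k. 1 / 2 ^ k :: real) \<longlonglongrightarrow> 0"
        by (intro tendsto_divide_0[OF tendsto_const] filterlim_at_top_imp_at_infinity
          filterlim_realpow_sequentially_gt1) auto
      from tendsto_mult[OF tendsto_const this]
      show "(\<lambda>k. norm g * (1 / 2 ^ k)) \<longlonglongrightarrow> 0" by simp
    qed
  qed
  have "closed {f. flow (s + t) f = flow s (flow t f)}"
    by (intro closed_Collect_eq continuous_intros)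
  then have "closure (Domain A) \<subseteq> {f. flow (s + t) f = flow s (flow t f)}"
    by (intro closure_minimal) (use eq in auto)
  then show ?thesis using dense by blast
qed

lemma continuous_on_flow: "continuous_on {0..} (\<lambda>t. flow t f)"
  unfolding continuous_on_iff
proof (intro ballI allI impI)
  fix t e :: real assume t: "t \<in> {0..}" and e: "e > 0"
  have "f \<in> closure (Domain A)" using dense by simp
  then obtain f' where "f' \<in> Domain A" "dist f' f < e / 4"
    using e unfolding closure_approachable by (metis divide_pos_pos zero_less_numeral)
  then obtain g where fg: "(f', g) \<in> A" and f': "norm (f - f') < e / 4"
    by (auto simp: dist_norm norm_minus_commute)
  have lip: "norm (flow s f' - flow t f') \<le> \<bar>s - t\<bar> * norm g" if "s \<ge> 0" for s
    using flow_lipschitz[OF fg, of s t] flow_lipschitz[OF fg, of t s] that t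
    by (cases "s \<le> t") (auto simp: norm_minus_commute)
  define d where "d = e / 4 / (norm g + 1)"
  have g1: "norm g + 1 > 0" by (simp add: add_nonneg_pos)
  have d: "d > 0" using e g1 by (simp add: d_def)
  show "\<exists>d>0. \<forall>s\<in>{0..}. dist s t < d \<longrightarrow> dist (flow s f) (flow t f) < e"
  proof (intro exI[of _ d] conjI ballI impI d)
    fix s :: real assume s: "s \<in> {0..}" "dist s t < d"
    have "norm (flow s f' - flow t f') \<le> \<bar>s - t\<bar> * norm g" using lip s by simp
    also have "\<dots> \<le> d * (norm g + 1)"
      using s d by (intro mult_mono) (auto simp: dist_real_def)
    also have "\<dots> = e / 4" by (rule iffD1[OF nonzero_eq_divide_eq d_def]) (use g1 in simp)
    finally have 1: "norm (flow s f' - flow t f') \<le> e / 4" .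
    have 2: "norm (flow r f - flow r f') < e / 4" if "r \<ge> 0" for r
      using norm_flow_le[OF that, of "f - f'"] f' by (simp add: blinfun.diff_right)
    have "flow s f - flow t f = (flow s f - flow s f') + (flow s f' - flow t f') - (flow t f - flow t f')"
      by simp
    also have "norm \<dots> \<le> norm (flow s f - flow s f') + norm (flow s f' - flow t f') + norm (flow t f - flow t f')"
      by (meson norm_triangle_ineq norm_triangle_ineq4 add_right_mono order_trans)
    finally show "dist (flow s f) (flow t f) < e"
      using 1 2[of s] 2[of t] s t e by (simp add: dist_norm)
  qed
qed

lemma C0_semigroup_flow: "C0_semigroup flow"
proof -
  have "flow 0 f = f" for f
    using approx_tendsto[of 0 f] by (simp add: approx_def LIMSEQ_const_iff)
  then show ?thesis
    unfolding C0_semigroup_def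
    by (auto intro!: blinfun_eqI simp: flow_add continuous_on_flow)
qed

lemma A_subset_generator: "A \<subseteq> generator_graph flow"
proof (safe)
  fix f g assume fg: "(f, g) \<in> A"
  show "(f, g) \<in> generator_graph flow"
    unfolding generator_graph_def mem_Collect_eq case_prod_conv tendsto_iff
  proof (intro allI impI)
    fix e :: real assume e: "e > 0"
    have "g \<in> closure (Domain A)" using dense by simp
    then obtain g' where "g' \<in> Domain A" "dist g' g < e / 4"
      using e unfolding closure_approachable by (metis divide_pos_pos zero_less_numeral)
    then obtain k where gk: "(g', k) \<in> A" and g': "norm (g - g') < e / 4"
      by (auto simp: dist_norm norm_minus_commute)
    define d where "d = e / 4 / (norm k + 1)"
    have k1: "norm k + 1 > 0" by (simp add: add_nonneg_pos)
    have d: "d > 0" using e k1 by (simp add: d_def)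
    have "dist ((flow h f - f) /\<^sub>R h) g < e" if h: "0 < h" "h < d" for h
    proof -
      have "(flow h f - f) /\<^sub>R h - g = (flow h f - f - h *\<^sub>R g) /\<^sub>R h"
        using h by (simp add: algebra_simps)
      also have "norm \<dots> \<le> (h * (2 * norm (g - g') + h * norm k)) / h"
        using flow_taylor[OF fg gk, of h] h by (simp add: divide_inverse mult.commute mult_left_mono)
      also have "\<dots> = 2 * norm (g - g') + h * norm k" using h by simp
      also have "h * norm k \<le> d * (norm k + 1)" using h by (intro mult_mono) auto
      also have "d * (norm k + 1) = e / 4" by (rule iffD1[OF nonzero_eq_divide_eq d_def]) (use k1 in simp)
      finally show ?thesis using g' e by (simp add: dist_norm)
    qed
    then show "\<forall>\<^sub>F h in at_right 0. dist ((flow h f - f) /\<^sub>R h) g < e"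
      unfolding eventually_at_right_field using d by (intro exI[of _ d]) auto
  qed
qed

end

lemma subspace_generator_graph:
  fixes T :: "real \<Rightarrow> 'a::banach \<Rightarrow>\<^sub>L 'a"
  shows "subspace (generator_graph T)"
proof (rule subspaceI)
  show "0 \<in> generator_graph T" by (simp add: generator_graph_def zero_prod_def)
next
  fix p q :: "'a \<times> 'a" assume pq: "p \<in> generator_graph T" "q \<in> generator_graph T"
  have "((\<lambda>h. (T h (fst p) - fst p) /\<^sub>R h + (T h (fst q) - fst q) /\<^sub>R h) \<longlongrightarrow> snd p + snd q) (at_right 0)"
    using pq by (intro tendsto_add) (auto simp: generator_graph_def)
  also have "(\<lambda>h. (T h (fst p) - fst p) /\<^sub>R h + (T h (fst q) - fst q) /\<^sub>R h) =
      (\<lambda>h. (T h (fst p + fst q) - (fst p + fst q)) /\<^sub>R h)"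
    by (simp add: blinfun.add_right scaleR_right_distrib[symmetric] algebra_simps del: scaleR_right_distrib)
  finally show "p + q \<in> generator_graph T" by (simp add: generator_graph_def plus_prod_def)
next
  fix r and p :: "'a \<times> 'a" assume p: "p \<in> generator_graph T"
  have "((\<lambda>h. r *\<^sub>R ((T h (fst p) - fst p) /\<^sub>R h)) \<longlongrightarrow> r *\<^sub>R snd p) (at_right 0)"
    using p by (intro tendsto_scaleR tendsto_const) (auto simp: generator_graph_def)
  also have "(\<lambda>h. r *\<^sub>R ((T h (fst p) - fst p) /\<^sub>R h)) = (\<lambda>h. (T h (r *\<^sub>R fst p) - r *\<^sub>R fst p) /\<^sub>R h)"
    by (simp add: blinfun.scaleR_right scaleR_right_diff_distrib[symmetric] mult.commute)
  finally show "r *\<^sub>R p \<in> generator_graph T" by (simp add: generator_graph_def scaleR_prod_def)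
qed

text \<open>\<open>x - h y\<close> is the limit of \<open>(1 + h / s) x - (h / s) T s x\<close> as \<open>s\<close> tends to \<open>0\<close>.\<close>

lemma generator_dissipative:
  fixes T :: "real \<Rightarrow> 'a::banach \<Rightarrow>\<^sub>L 'a"
  assumes T: "\<And>t x. 0 \<le> t \<Longrightarrow> norm (T t x) \<le> norm x"
    and xy: "(x, y) \<in> generator_graph T" and h: "0 < h"
  shows "norm x \<le> norm (x - h *\<^sub>R y)"
proof -
  have lim: "((\<lambda>s. (T s x - x) /\<^sub>R s) \<longlongrightarrow> y) (at_right 0)"
    using xy by (simp add: generator_graph_def)
  have "((\<lambda>s. norm (x - h *\<^sub>R ((T s x - x) /\<^sub>R s))) \<longlongrightarrow> norm (x - h *\<^sub>R y)) (at_right 0)"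
    by (intro tendsto_intros lim)
  then show ?thesis
  proof (rule tendsto_lowerbound)
    show "\<forall>\<^sub>F s in at_right 0. norm x \<le> norm (x - h *\<^sub>R ((T s x - x) /\<^sub>R s))"
    proof (rule eventually_at_right_less[THEN eventually_mono])
      fix s :: real assume s: "0 < s"
      have eq: "(1 + h / s) *\<^sub>R x = (x - h *\<^sub>R ((T s x - x) /\<^sub>R s)) + (h / s) *\<^sub>R T s x"
        by (simp add: algebra_simps divide_inverse)
      have "(1 + h / s) * norm x = norm ((1 + h / s) *\<^sub>R x)" using h s by simp
      also have "\<dots> \<le> norm (x - h *\<^sub>R ((T s x - x) /\<^sub>R s)) + (h / s) * norm (T s x)"
        unfolding eq by (rule order_trans[OF norm_triangle_ineq]) (use h s in simp)
      also have "\<dots> \<le> norm (x - h *\<^sub>R ((T s x - x) /\<^sub>R s)) + (h / s) * norm x"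
        using T[of s x] h s by (intro add_left_mono mult_left_mono) auto
      finally show "norm x \<le> norm (x - h *\<^sub>R ((T s x - x) /\<^sub>R s))" by (simp add: algebra_simps)
    qed
  qed simp
qed

text \<open>The generator extends \<open>A\<close> and is dissipative, so \<open>1\<close> minus the generator is injective; as \<open>1 - A\<close> is
  already onto, the extension cannot be proper.\<close>

lemma (in m_dissipative) generates_flow: "generates A flow"
proof -
  have "(x, y) \<in> A" if xy: "(x, y) \<in> generator_graph flow" for x y
  proof -
    obtain x' y' where xy': "(x', y') \<in> A" "x' - 1 *\<^sub>R y' = x - y"
      using range_full[of 1 "x - y"] by auto
    have "(x - x', y - y') \<in> generator_graph flow"
      using subspace_diff[OF subspace_generator_graph xy] A_subset_generator xy'(1) by fastforce
    then have "norm (x - x') \<le> norm ((x - x') - 1 *\<^sub>R (y - y'))"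
      by (intro generator_dissipative[of flow, OF norm_flow_le]) auto
    also have "(x - x') - 1 *\<^sub>R (y - y') = 0" using xy'(2) by (simp add: algebra_simps)
    finally have "x = x'" by simp
    with xy' have "(x', y') = (x, y)" by (simp add: algebra_simps)
    with xy'(1) show ?thesis by simp
  qed
  then show ?thesis
    using A_subset_generator C0_semigroup_flow by (auto simp: generates_def)
qed

lemma (in m_dissipative) closed_A: "closed A"
  unfolding closed_sequential_limits
proof (intro allI impI)
  fix p :: "nat \<Rightarrow> 'a \<times> 'a" and l assume p: "(\<forall>n. p n \<in> A) \<and> p \<longlonglongrightarrow> l"
  define x where "x = fst l" define y where "y = snd l"
  have x: "(\<lambda>n. fst (p n)) \<longlonglongrightarrow> x" and y: "(\<lambda>n. snd (p n)) \<longlonglongrightarrow> y"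
    using p by (auto simp: x_def y_def intro: tendsto_fst tendsto_snd)
  have "J 1 (fst (p n) - snd (p n)) = fst (p n)" for n
    using p by (intro J_eq[of 1 _ "snd (p n)"]) auto
  moreover have "(\<lambda>n. J 1 (fst (p n) - snd (p n))) \<longlonglongrightarrow> J 1 (x - y)"
  proof (rule LIM_zero_cancel, rule Lim_null_comparison[OF always_eventually])
    show "\<forall>n. norm (J 1 (fst (p n) - snd (p n)) - J 1 (x - y)) \<le> norm ((fst (p n) - snd (p n)) - (x - y))"
      by (simp add: norm_J_le linear_diff[OF linear_J, symmetric])
    show "(\<lambda>n. norm ((fst (p n) - snd (p n)) - (x - y))) \<longlonglongrightarrow> 0"
      using tendsto_diff[OF x y] by (simp add: LIM_zero tendsto_norm_zero)
  qed
  ultimately have "(\<lambda>n. fst (p n)) \<longlonglongrightarrow> J 1 (x - y)" by simp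
  then have x1: "x = J 1 (x - y)" using x LIMSEQ_unique by blast
  obtain z where z: "(J 1 (x - y), z) \<in> A" "J 1 (x - y) - 1 *\<^sub>R z = x - y" by (rule J_graph[OF zero_less_one])
  with x1 have "z = y" by (metis diff_left_imp_eq scaleR_one)
  with z x1 show "l \<in> A" by (simp add: x_def y_def)
qed

text \<open>One inclusion is the product rule; the other is the same inclusion for \<open>-\<omega>\<close> applied to the rescaled semigroup.\<close>

lemma generates_rescale:
  fixes T :: "real \<Rightarrow> 'a::banach \<Rightarrow>\<^sub>L 'a"
  assumes "generates A T"
  shows "generates {(x, y + \<omega> *\<^sub>R x) | x y. (x, y) \<in> A} (\<lambda>t. exp (\<omega> * t) *\<^sub>R T t)"
proof -
  let ?S = "\<lambda>t. exp (\<omega> * t) *\<^sub>R T t"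
  have C0: "C0_semigroup T" and G: "generator_graph T = A"
    using assms by (auto simp: generates_def)
  have rescale: "(x, y + \<omega>' *\<^sub>R x) \<in> generator_graph (\<lambda>t. exp (\<omega>' * t) *\<^sub>R T' t)"
    if C: "continuous_on {0..} (\<lambda>t. T' t x)" "T' 0 x = x" and xy: "(x, y) \<in> generator_graph T'"
    for x y \<omega>' and T' :: "real \<Rightarrow> 'a \<Rightarrow>\<^sub>L 'a"
  proof -
    have lim: "((\<lambda>s. (T' s x - x) /\<^sub>R s) \<longlongrightarrow> y) (at_right 0)"
      using xy by (simp add: generator_graph_def)
    have "((\<lambda>s. exp (\<omega>' * s)) has_field_derivative \<omega>') (at 0)"
      by (auto intro!: derivative_eq_intros)
    then have "((\<lambda>s. (exp (\<omega>' * s) - 1) / s) \<longlongrightarrow> \<omega>') (at 0)"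
      by (simp add: has_field_derivative_iff)
    then have e: "((\<lambda>s. (exp (\<omega>' * s) - 1) / s) \<longlongrightarrow> \<omega>') (at_right 0)"
      by (rule filterlim_mono) (auto simp: at_within_le_at)
    have "((\<lambda>s. exp (\<omega>' * s)) \<longlongrightarrow> exp (\<omega>' * 0)) (at_right 0)"
      by (intro tendsto_intros)
    from tendsto_add[OF tendsto_scaleR[OF this lim] tendsto_scaleR[OF e tendsto_const, of x]]
    have *: "((\<lambda>s. exp (\<omega>' * s) *\<^sub>R ((T' s x - x) /\<^sub>R s) + ((exp (\<omega>' * s) - 1) / s) *\<^sub>R x)
        \<longlongrightarrow> y + \<omega>' *\<^sub>R x) (at_right 0)" by simp
    show ?thesis unfolding generator_graph_def mem_Collect_eq case_prod_conv
      by (rule Lim_transform_eventually[OF *])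
         (auto simp: blinfun.scaleR_left algebra_simps divide_inverse)
  qed
  have C0S: "C0_semigroup ?S"
    using C0 unfolding C0_semigroup_def
    by (auto intro!: blinfun_eqI continuous_on_scaleR continuous_on_exp continuous_on_mult
          continuous_on_const continuous_on_id
        simp: blinfun.scaleR_left blinfun.scaleR_right distrib_left exp_add mult_ac)
  have c: "continuous_on {0..} (\<lambda>t. R t x)" "R 0 x = x" if "C0_semigroup R"
    for x and R :: "real \<Rightarrow> 'a \<Rightarrow>\<^sub>L 'a"
    using that by (auto simp: C0_semigroup_def)
  have "generator_graph ?S \<subseteq> {(x, y + \<omega> *\<^sub>R x) | x y. (x, y) \<in> A}"
  proof (clarify)
    fix x y assume "(x, y) \<in> generator_graph ?S"
    from rescale[OF c[OF C0S] this, of "- \<omega>"]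
    have "(x, y - \<omega> *\<^sub>R x) \<in> A"
      by (simp add: G[symmetric] exp_minus_inverse mult_exp_exp)
    then show "\<exists>x' y'. (x, y) = (x', y' + \<omega> *\<^sub>R x') \<and> (x', y') \<in> A"
      by (intro exI[of _ x] exI[of _ "y - \<omega> *\<^sub>R x"]) simp
  qed
  moreover have "{(x, y + \<omega> *\<^sub>R x) | x y. (x, y) \<in> A} \<subseteq> generator_graph ?S"
    using rescale[OF c[OF C0]] by (auto simp: G)
  ultimately show ?thesis using C0S by (simp add: generates_def)
qed

section \<open>The abstract Cauchy problem\<close>

lemma has_vector_derivative_at_right_iff:
  fixes f :: "real \<Rightarrow> 'a::real_normed_vector"
  shows "(f has_vector_derivative D) (at_right s) \<longleftrightarrow> ((\<lambda>h. (f (s + h) - f s) /\<^sub>R h) \<longlongrightarrow> D) (at_right 0)"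
proof -
  have "(f has_vector_derivative D) (at_right s) \<longleftrightarrow>
      ((\<lambda>y. norm ((f y - f s) - (y - s) *\<^sub>R D) / norm (y - s)) \<longlongrightarrow> 0) (at_right s)"
    by (simp add: has_vector_derivative_def has_derivative_iff_norm bounded_linear_scaleR_left)
  also have "\<dots> \<longleftrightarrow> ((\<lambda>h. norm ((f (h + s) - f s) - h *\<^sub>R D) / norm h) \<longlongrightarrow> 0) (at_right 0)"
    unfolding filterlim_at_right_to_0[of _ _ s] by simp
  also have "\<dots> \<longleftrightarrow> ((\<lambda>h. norm ((f (s + h) - f s) /\<^sub>R h - D)) \<longlongrightarrow> 0) (at_right 0)"
  proof (rule filterlim_cong[OF refl refl], rule eventually_at_right_less[THEN eventually_mono])
    fix h :: real assume h: "0 < h"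
    have "(f (s + h) - f s) /\<^sub>R h - D = ((f (s + h) - f s) - h *\<^sub>R D) /\<^sub>R h"
      using h by (simp add: scaleR_right_diff_distrib)
    then show "norm ((f (h + s) - f s) - h *\<^sub>R D) / norm h = norm ((f (s + h) - f s) /\<^sub>R h - D)"
      using h by (simp add: add.commute divide_inverse mult.commute)
  qed
  also have "\<dots> \<longleftrightarrow> ((\<lambda>h. (f (s + h) - f s) /\<^sub>R h) \<longlongrightarrow> D) (at_right 0)"
    by (simp add: tendsto_norm_zero_iff LIM_zero_iff)
  finally show ?thesis .
qed

text \<open>Right derivatives suffice, by continuous induction: the set of \<open>s\<close> up to which \<open>\<phi>\<close> has grown
  by at most \<open>e (s - a)\<close> is closed, and the right derivative extends it beyond each of its points other than \<open>b\<close>.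
  The one-sided form is the one that the semigroup law gives directly for orbits.\<close>

lemma right_derivative_zero_constant:
  fixes \<phi> :: "real \<Rightarrow> 'a::real_normed_vector"
  assumes cont: "continuous_on {a..b} \<phi>" and ab: "a \<le> b"
    and D: "\<And>s. a \<le> s \<Longrightarrow> s < b \<Longrightarrow> (\<phi> has_vector_derivative 0) (at_right s)"
  shows "\<phi> b = \<phi> a"
proof -
  have *: "norm (\<phi> b - \<phi> a) \<le> e * (b - a)" if e: "e > 0" for e
  proof -
    define P where "P r \<longleftrightarrow> norm (\<phi> r - \<phi> a) \<le> e * (r - a)" for r
    define S where "S = {s \<in> {a..b}. \<forall>r\<in>{a..s}. P r}"
    have aS: "a \<in> S" using ab by (auto simp: S_def P_def)
    have bdd: "bdd_above S" by (rule bdd_aboveI[of _ b]) (simp add: S_def)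
    define c where "c = Sup S"
    have ac: "a \<le> c" unfolding c_def by (rule cSup_upper[OF aS bdd])
    have cb: "c \<le> b" unfolding c_def by (rule cSup_least) (use aS in \<open>auto simp: S_def\<close>)
    have below: "P r" if r: "a \<le> r" "r < c" for r
    proof -
      obtain s where "s \<in> S" "r < s" using r(2) less_cSup_iff[of S r] aS bdd unfolding c_def by blast
      then show ?thesis using r by (auto simp: S_def)
    qed
    have Pc: "P c"
    proof (cases "a = c")
      case False
      then have "a < c" using ac by simp
      have "closed {r \<in> {a..b}. P r}"
        unfolding P_def by (intro continuous_on_closed_Collect_le continuous_intros cont)
      moreover have "{a..<c} \<subseteq> {r \<in> {a..b}. P r}" using below cb by auto
      ultimately have "closure {a..<c} \<subseteq> {r \<in> {a..b}. P r}" by (rule closure_minimal[rotated])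
      moreover have "c \<in> closure {a..<c}" using \<open>a < c\<close> by simp
      ultimately show ?thesis by blast
    qed (simp add: P_def)
    have "c = b"
    proof (rule ccontr)
      assume "c \<noteq> b"
      with cb have "c < b" by simp
      from D[OF ac this, unfolded has_vector_derivative_at_right_iff tendsto_iff] e
      have "\<forall>\<^sub>F h in at_right 0. dist ((\<phi> (c + h) - \<phi> c) /\<^sub>R h) 0 < e" by blast
      then obtain d where d: "d > 0" "\<And>h. 0 < h \<Longrightarrow> h < d \<Longrightarrow> dist ((\<phi> (c + h) - \<phi> c) /\<^sub>R h) 0 < e"
        unfolding eventually_at_right_field by auto
      define c' where "c' = min b (c + d / 2)"
      have c': "c < c'" "c' \<le> b" using \<open>c < b\<close> d by (auto simp: c'_def)
      have "P r" if "a \<le> r" "r \<le> c'" for r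
      proof (cases "r \<le> c")
        case True then show ?thesis using below Pc that by (cases "r = c") auto
      next
        case False
        define h where "h = r - c"
        have h: "0 < h" "h < d" using False that d(1) by (auto simp: h_def c'_def)
        have "norm (\<phi> (c + h) - \<phi> c) < e * h"
          using d(2)[OF h] h(1) by (simp add: divide_inverse_commute[symmetric] pos_divide_less_eq mult.commute)
        then have "norm (\<phi> r - \<phi> c) \<le> e * (r - c)" by (simp add: h_def)
        from norm_diff_triangle_le[OF this Pc[unfolded P_def]]
        show ?thesis by (simp add: P_def algebra_simps)
      qed
      then have "c' \<in> S" using c' ac by (auto simp: S_def)
      then have "c' \<le> c" unfolding c_def by (rule cSup_upper[OF _ bdd])
      with c' show False by simp
    qed
    with Pc show ?thesis by (simp add: P_def)
  qed
  have "norm (\<phi> b - \<phi> a) \<le> 0"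
  proof (rule field_le_epsilon)
    fix e :: real assume "e > 0"
    then have "norm (\<phi> b - \<phi> a) \<le> e / (b - a + 1) * (b - a)" using ab by (intro *) auto
    also have "\<dots> \<le> e" using ab \<open>e > 0\<close> by (simp add: field_simps)
    finally show "norm (\<phi> b - \<phi> a) \<le> 0 + e" by simp
  qed
  then show ?thesis by simp
qed

locale exp_bounded_semigroup =
  fixes L :: "('a::banach \<times> 'a) set" and T :: "real \<Rightarrow> 'a \<Rightarrow>\<^sub>L 'a" and \<omega> :: real
  assumes generates: "generates L T"
    and norm_le: "0 \<le> t \<Longrightarrow> norm (T t x) \<le> exp (\<omega> * t) * norm x"
begin

lemma at_0 [simp]: "T 0 x = x"
  and add: "0 \<le> s \<Longrightarrow> 0 \<le> t \<Longrightarrow> T (s + t) x = T s (T t x)"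
  and continuous: "continuous_on {0..} (\<lambda>t. T t x)"
  using generates by (auto simp: generates_def C0_semigroup_def)

lemma graph_iff: "(x, y) \<in> L \<longleftrightarrow> ((\<lambda>h. (T h x - x) /\<^sub>R h) \<longlongrightarrow> y) (at_right 0)"
  using generates by (auto simp: generates_def generator_graph_def)

lemma subspace_L: "subspace L"
  using generates subspace_generator_graph by (auto simp: generates_def)

lemma L_diff: "(x, y) \<in> L \<Longrightarrow> (x', y') \<in> L \<Longrightarrow> (x - x', y - y') \<in> L"
  using subspace_diff[OF subspace_L, of "(x, y)" "(x', y')"] by simp

lemma L_unique: "(x, y) \<in> L \<Longrightarrow> (x, y') \<in> L \<Longrightarrow> y = y'"
  unfolding graph_iff by (rule tendsto_unique[rotated]) auto

lemma graph_invariant: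
  assumes xy: "(x, y) \<in> L" and t: "0 \<le> t" shows "(T t x, T t y) \<in> L"
proof -
  have "((\<lambda>h. T t ((T h x - x) /\<^sub>R h)) \<longlongrightarrow> T t y) (at_right 0)"
    using xy unfolding graph_iff by (intro tendsto_intros)
  moreover have "\<forall>\<^sub>F h in at_right 0. T t ((T h x - x) /\<^sub>R h) = (T h (T t x) - T t x) /\<^sub>R h"
  proof (rule eventually_at_right_less[THEN eventually_mono])
    fix h :: real assume "0 < h"
    then have "T t (T h x) = T h (T t x)"
      using add[OF t, of h x] add[of h t x] t by (simp add: add.commute)
    then show "T t ((T h x - x) /\<^sub>R h) = (T h (T t x) - T t x) /\<^sub>R h"
      by (simp add: blinfun.diff_right blinfun.scaleR_right)
  qed
  ultimately show ?thesis unfolding graph_iff by (rule Lim_transform_eventually)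
qed

lemma exp_le: "0 \<le> t \<Longrightarrow> t \<le> s \<Longrightarrow> exp (\<omega> * t) \<le> exp (\<bar>\<omega>\<bar> * s)"
  using mult_right_mono[OF abs_ge_self[of \<omega>], of t] mult_left_mono[of t s "\<bar>\<omega>\<bar>"] by simp

lemma continuous_on_apply:
  fixes g :: "real \<Rightarrow> real"
  assumes g: "continuous_on {a..b} g" "\<And>s. s \<in> {a..b} \<Longrightarrow> 0 \<le> g s \<and> g s \<le> M"
    and W: "continuous_on {a..b} W"
  shows "continuous_on {a..b} (\<lambda>s. T (g s) (W s))"
  unfolding continuous_on_def
proof
  fix s assume s: "s \<in> {a..b}"
  let ?F = "at s within {a..b}"
  have 1: "((\<lambda>r. T (g r) (W r - W s)) \<longlongrightarrow> 0) ?F"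
  proof (rule Lim_null_comparison)
    show "\<forall>\<^sub>F r in ?F. norm (T (g r) (W r - W s)) \<le> exp (\<bar>\<omega>\<bar> * M) * norm (W r - W s)"
      unfolding eventually_at_filter
    proof (intro always_eventually allI impI)
      fix r assume r: "r \<in> {a..b}"
      have "norm (T (g r) (W r - W s)) \<le> exp (\<omega> * g r) * norm (W r - W s)"
        using g(2)[OF r] by (intro norm_le) auto
      also have "\<dots> \<le> exp (\<bar>\<omega>\<bar> * M) * norm (W r - W s)"
        using g(2)[OF r] by (intro mult_right_mono exp_le) auto
      finally show "norm (T (g r) (W r - W s)) \<le> exp (\<bar>\<omega>\<bar> * M) * norm (W r - W s)" .
    qed
    have "(W \<longlongrightarrow> W s) ?F" using W s by (simp add: continuous_on_def)
    then have "((\<lambda>r. norm (W r - W s)) \<longlongrightarrow> 0) ?F" by (simp add: LIM_zero tendsto_norm_zero)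
    from tendsto_mult[OF tendsto_const this]
    show "((\<lambda>r. exp (\<bar>\<omega>\<bar> * M) * norm (W r - W s)) \<longlongrightarrow> 0) ?F" by simp
  qed
  have "continuous_on {a..b} (\<lambda>r. T (g r) (W s))"
    using g by (intro continuous_on_compose2[OF continuous g(1)]) auto
  then have "((\<lambda>r. T (g r) (W s)) \<longlongrightarrow> T (g s) (W s)) ?F"
    using s by (simp add: continuous_on_def)
  from tendsto_add[OF 1 this] show "((\<lambda>r. T (g r) (W r)) \<longlongrightarrow> T (g s) (W s)) ?F"
    by (simp add: blinfun.diff_right)
qed

text \<open>The function \<open>s \<mapsto> T (t - s) (W s)\<close> has right derivative zero: its increment over \<open>[s, s + h]\<close> is
  \<open>T (t - s - h)\<close> applied to \<open>(W (s + h) - W s) - (T h (W s) - W s)\<close>, which is \<open>o(h)\<close>.\<close>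

lemma right_solution_unique:
  assumes W: "continuous_on {0..} W"
    and D: "\<And>s. 0 \<le> s \<Longrightarrow> (W has_vector_derivative V s) (at_right s)"
    and L: "\<And>s. 0 \<le> s \<Longrightarrow> (W s, V s) \<in> L"
    and t: "0 \<le> t"
  shows "W t = T t (W 0)"
proof -
  let ?\<phi> = "\<lambda>s. T (t - s) (W s)"
  have "?\<phi> t = ?\<phi> 0"
  proof (rule right_derivative_zero_constant[OF _ t])
    show "continuous_on {0..t} ?\<phi>"
      using t by (intro continuous_on_apply[where M = t] continuous_on_subset[OF W] continuous_intros) auto
  next
    fix s assume s: "0 \<le> s" "s < t"
    have "((\<lambda>h. (W (s + h) - W s) /\<^sub>R h - (T h (W s) - W s) /\<^sub>R h) \<longlongrightarrow> V s - V s) (at_right 0)"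
      using D[OF s(1)] L[OF s(1)] unfolding has_vector_derivative_at_right_iff graph_iff
      by (intro tendsto_diff)
    then have "((\<lambda>h. norm ((W (s + h) - W s) /\<^sub>R h - (T h (W s) - W s) /\<^sub>R h)) \<longlongrightarrow> 0) (at_right 0)"
      by (simp add: tendsto_norm_zero)
    from tendsto_mult[OF tendsto_const[of "exp (\<bar>\<omega>\<bar> * t)"] this]
    have lim: "((\<lambda>h. exp (\<bar>\<omega>\<bar> * t) * norm ((W (s + h) - W s) /\<^sub>R h - (T h (W s) - W s) /\<^sub>R h)) \<longlongrightarrow> 0) (at_right 0)"
      by simp
    have ev: "\<forall>\<^sub>F h in at_right 0. norm ((?\<phi> (s + h) - ?\<phi> s) /\<^sub>R h)
        \<le> exp (\<bar>\<omega>\<bar> * t) * norm ((W (s + h) - W s) /\<^sub>R h - (T h (W s) - W s) /\<^sub>R h)"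
      unfolding eventually_at_right_field
    proof (intro exI[of _ "t - s"] conjI allI impI)
      fix h assume h: "0 < h" "h < t - s"
      have "T (t - s) (W s) = T (t - (s + h)) (T h (W s))"
        using add[of "t - (s + h)" h "W s"] h by simp
      then have "(?\<phi> (s + h) - ?\<phi> s) /\<^sub>R h
          = T (t - (s + h)) ((W (s + h) - W s) /\<^sub>R h - (T h (W s) - W s) /\<^sub>R h)"
        by (simp add: blinfun.diff_right blinfun.scaleR_right scaleR_right_diff_distrib)
      also have "norm \<dots> \<le> exp (\<omega> * (t - (s + h))) * norm ((W (s + h) - W s) /\<^sub>R h - (T h (W s) - W s) /\<^sub>R h)"
        using h by (intro norm_le) auto
      also have "\<dots> \<le> exp (\<bar>\<omega>\<bar> * t) * norm ((W (s + h) - W s) /\<^sub>R h - (T h (W s) - W s) /\<^sub>R h)"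
        using h s by (intro mult_right_mono exp_le) auto
      finally show "norm ((?\<phi> (s + h) - ?\<phi> s) /\<^sub>R h)
        \<le> exp (\<bar>\<omega>\<bar> * t) * norm ((W (s + h) - W s) /\<^sub>R h - (T h (W s) - W s) /\<^sub>R h)" .
    qed (use s in simp)
    show "(?\<phi> has_vector_derivative 0) (at_right s)"
      unfolding has_vector_derivative_at_right_iff by (rule Lim_null_comparison[OF ev lim])
  qed
  then show ?thesis by simp
qed

lemma orbit_right_derivative:
  fixes E :: "real \<Rightarrow> 'a \<Rightarrow>\<^sub>L 'a"
  assumes E: "generates L E" and xy: "(x, y) \<in> L" and s: "0 \<le> s"
  shows "((\<lambda>t. E t x) has_vector_derivative E s y) (at_right s)" "(E s x, E s y) \<in> L"
proof -
  have Eadd: "0 \<le> t \<Longrightarrow> E (s + t) z = E s (E t z)" "0 \<le> t \<Longrightarrow> E (t + s) z = E t (E s z)" for t z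
    using E s by (auto simp: generates_def C0_semigroup_def)
  have G: "(x', y') \<in> L \<longleftrightarrow> ((\<lambda>h. (E h x' - x') /\<^sub>R h) \<longlongrightarrow> y') (at_right 0)" for x' y'
    using E by (auto simp: generates_def generator_graph_def)
  have lim: "((\<lambda>h. E s ((E h x - x) /\<^sub>R h)) \<longlongrightarrow> E s y) (at_right 0)"
    using xy unfolding G by (intro tendsto_intros)
  have "\<forall>\<^sub>F h in at_right 0. E s ((E h x - x) /\<^sub>R h) = (E (s + h) x - E s x) /\<^sub>R h"
    by (rule eventually_at_right_less[THEN eventually_mono])
       (simp add: Eadd blinfun.diff_right blinfun.scaleR_right)
  from Lim_transform_eventually[OF lim this]
  show "((\<lambda>t. E t x) has_vector_derivative E s y) (at_right s)"
    unfolding has_vector_derivative_at_right_iff .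
  have "\<forall>\<^sub>F h in at_right 0. E s ((E h x - x) /\<^sub>R h) = (E h (E s x) - E s x) /\<^sub>R h"
    by (rule eventually_at_right_less[THEN eventually_mono])
       (simp add: Eadd(2)[symmetric] Eadd(1)[symmetric] add.commute blinfun.diff_right blinfun.scaleR_right)
  from Lim_transform_eventually[OF lim this] show "(E s x, E s y) \<in> L" unfolding G .
qed

text \<open>Orbits of \<open>E\<close> that start in the domain stay in it and have right derivatives given by the generator, so
  \<open>right_solution_unique\<close> identifies them with orbits of \<open>T\<close>; density does the rest.\<close>

lemma generated_unique:
  assumes E: "generates L E" and dense: "closure (Domain L) = UNIV" and t: "0 \<le> t"
  shows "E t = T t"
proof (rule blinfun_eqI)
  fix x
  have "E t x = T t x" if "x \<in> Domain L" for x
  proof -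
    from that obtain y where xy: "(x, y) \<in> L" by (rule DomainE)
    have "E t x = T t (E 0 x)"
    proof (rule right_solution_unique[OF _ orbit_right_derivative[OF E xy] t])
      show "continuous_on {0..} (\<lambda>t. E t x)"
        using E by (auto simp: generates_def C0_semigroup_def)
    qed
    moreover have "E 0 x = x" using E by (auto simp: generates_def C0_semigroup_def)
    ultimately show ?thesis by simp
  qed
  moreover have "closed {x. E t x = T t x}"
    by (intro closed_Collect_eq continuous_intros)
  ultimately have "closure (Domain L) \<subseteq> {x. E t x = T t x}"
    by (intro closure_minimal) auto
  then show "E t x = T t x" using dense by auto
qed

lemma integral_has_derivative:
  assumes "continuous_on {0..} U" "0 \<le> (t::real)"
  shows "((\<lambda>t. integral {0..t} U) has_vector_derivative (U t :: 'a)) (at t within {0..})"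
proof -
  have "((\<lambda>t. integral {0..t} U) has_vector_derivative U t) (at t within {0..t+1})"
    using assms by (intro integral_has_vector_derivative continuous_on_subset[OF assms(1)]) auto
  moreover have "at t within {0..t+1} = at t within {0..}"
    by (rule at_within_nhd[of _ "{t - 1<..<t + 1}"]) auto
  ultimately show ?thesis by simp
qed

lemma right_derivative_of_within:
  "(f has_vector_derivative D) (at t within {0..}) \<Longrightarrow> 0 \<le> (t::real) \<Longrightarrow>
    (f has_vector_derivative D) (at_right t)"
  by (rule has_vector_derivative_within_subset) auto

lemma continuous_on_of_derivative:
  assumes "\<And>t. 0 \<le> t \<Longrightarrow> (U has_vector_derivative U' t) (at t within {0..})"
  shows "continuous_on {0::real..} U"
  unfolding continuous_on_eq_continuous_within
  using has_vector_derivative_continuous[OF assms] by auto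

lemma orbit_integral:
  assumes xy: "(x, y) \<in> L" and t: "0 \<le> t"
  shows "T t x = x + integral {0..t} (\<lambda>s. T s y)"
proof -
  let ?\<phi> = "\<lambda>s. T s x - integral {0..s} (\<lambda>s. T s y)"
  have "?\<phi> t = ?\<phi> 0"
  proof (rule right_derivative_zero_constant[OF _ t])
    have "continuous_on {0..} (\<lambda>s. integral {0..s} (\<lambda>s. T s y))"
      by (rule continuous_on_of_derivative integral_has_derivative[OF continuous])+
    then show "continuous_on {0..t} ?\<phi>"
      by (intro continuous_on_diff continuous_on_subset[OF continuous]) (auto elim: continuous_on_subset)
  next
    fix s assume s: "0 \<le> s" "s < t"
    have "(?\<phi> has_vector_derivative T s y - T s y) (at_right s)"
      using orbit_right_derivative[OF generates xy s(1)]
        right_derivative_of_within[OF integral_has_derivative[OF continuous s(1)] s(1)]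
      by (intro has_vector_derivative_diff)
    then show "(?\<phi> has_vector_derivative 0) (at_right s)" by simp
  qed
  then show ?thesis by (simp add: algebra_simps)
qed

lemma orbit_derivative:
  assumes xy: "(x, y) \<in> L" and t: "0 \<le> t"
  shows "((\<lambda>t. T t x) has_vector_derivative T t y) (at t within {0..})"
proof (rule has_vector_derivative_transform)
  show "((\<lambda>t. x + integral {0..t} (\<lambda>s. T s y)) has_vector_derivative T t y) (at t within {0..})"
    using has_vector_derivative_add[OF has_vector_derivative_const integral_has_derivative[OF continuous t, of y], of x]
    by simp
  show "T s x = x + integral {0..s} (\<lambda>s. T s y)" if "s \<in> {0..}" for s
    using orbit_integral[OF xy] that by simp
qed (use t in simp)

lemma classical_solution_orbit:
  assumes "x \<in> Domain L" shows "classical_solution L x (\<lambda>t. T t x)"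
proof -
  from assms obtain y where xy: "(x, y) \<in> L" by (rule DomainE)
  then show ?thesis unfolding classical_solution_def
    using orbit_derivative[OF xy] graph_invariant[OF xy] continuous[of y]
    by (intro conjI exI[of _ "\<lambda>t. T t y"]) auto
qed

lemma classical_solution_unique:
  assumes "classical_solution L x U" "0 \<le> t" shows "U t = T t x"
proof -
  obtain U' where U: "U 0 = x" "\<And>t. 0 \<le> t \<Longrightarrow> (U has_vector_derivative U' t) (at t within {0..})"
    "\<And>t. 0 \<le> t \<Longrightarrow> (U t, U' t) \<in> L"
    using assms(1) unfolding classical_solution_def by blast
  have "U t = T t (U 0)"
    by (rule right_solution_unique[OF continuous_on_of_derivative right_derivative_of_within _ assms(2)])
       (use U in auto)
  then show ?thesis by (simp add: U)
qed

text \<open>With \<open>F t = \<integral>\<^sub>0\<^sup>t T s x ds\<close>, the semigroup law gives \<open>T h (F t) - F t = (F (t + h) - F t) - F h\<close>.\<close>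

lemma integral_orbit_graph:
  assumes t: "0 \<le> t" shows "(integral {0..t} (\<lambda>s. T s x), T t x - x) \<in> L"
proof -
  let ?F = "\<lambda>t. integral {0..t} (\<lambda>s. T s x)"
  have int: "(\<lambda>s. T s x) integrable_on {a..b}" if "0 \<le> a" for a b
    using that by (intro integrable_continuous_interval continuous_on_subset[OF continuous]) auto
  have shift: "T h (?F t) = ?F (t + h) - ?F h" if h: "0 \<le> h" for h
  proof -
    have "T h (?F t) = integral {0..t} (\<lambda>s. T h (T s x))"
      using integral_linear[OF int[OF order_refl] blinfun.bounded_linear_right[of "T h"], of t]
      by (simp add: o_def)
    also have "\<dots> = integral {0..t} (\<lambda>s. T (s + h) x)"
      using h by (intro integral_cong) (simp add: add[symmetric] add.commute)
    also have "\<dots> = integral {h..t + h} (\<lambda>s. T s x)"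
    proof -
      have "((\<lambda>s. T s x) \<circ> (\<lambda>s. s + h)) = (\<lambda>s. T (s + h) x)" by (simp add: o_def)
      then show ?thesis
        using integral_shift_Icc_real[of 0 t "\<lambda>s. T s x" h] by (simp add: o_def add.commute)
    qed
    also have "\<dots> = ?F (t + h) - ?F h"
      using Henstock_Kurzweil_Integration.integral_combine[where a = 0 and c = h and b = "t + h" and f = "\<lambda>s. T s x"] h t int by (simp add: algebra_simps)
    finally show ?thesis .
  qed
  have d: "(?F has_vector_derivative T s x) (at_right s)" if "0 \<le> s" for s
    using right_derivative_of_within[OF integral_has_derivative[OF continuous that] that] .
  have "((\<lambda>h. (?F (t + h) - ?F t) /\<^sub>R h - (?F (0 + h) - ?F 0) /\<^sub>R h) \<longlongrightarrow> T t x - T 0 x) (at_right 0)"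
    using d[OF t] d[of 0] unfolding has_vector_derivative_at_right_iff by (intro tendsto_diff) auto
  moreover have "\<forall>\<^sub>F h in at_right 0. (?F (t + h) - ?F t) /\<^sub>R h - (?F (0 + h) - ?F 0) /\<^sub>R h
      = (T h (?F t) - ?F t) /\<^sub>R h"
    by (rule eventually_at_right_less[THEN eventually_mono])
       (simp add: shift scaleR_right_diff_distrib)
  ultimately have "((\<lambda>h. (T h (?F t) - ?F t) /\<^sub>R h) \<longlongrightarrow> T t x - T 0 x) (at_right 0)"
    by (rule Lim_transform_eventually)
  then show ?thesis by (simp add: graph_iff)
qed

lemma mild_solution_orbit: "mild_solution L x (\<lambda>t. T t x)"
  unfolding mild_solution_def
proof (intro conjI allI impI continuous)
  fix t :: real assume "0 \<le> t"
  from integral_orbit_graph[OF this, of x]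
  show "\<exists>y. (integral {0..t} (\<lambda>t. T t x), y) \<in> L \<and> T t x = x + y"
    by (intro exI[of _ "T t x - x"]) simp
qed

text \<open>The primitive of the difference of two mild solutions solves the problem classically with initial value zero.\<close>

lemma mild_solution_unique:
  assumes U: "mild_solution L x U" and t: "0 \<le> t" shows "U t = T t x"
proof -
  have cU: "continuous_on {0..} U" using U by (simp add: mild_solution_def)
  let ?W = "\<lambda>t. integral {0..t} U - integral {0..t} (\<lambda>s. T s x)"
  have D: "(?W has_vector_derivative U s - T s x) (at s within {0..})" if "0 \<le> s" for s
    by (intro has_vector_derivative_diff integral_has_derivative cU continuous that)
  have L: "(?W s, U s - T s x) \<in> L" if s: "0 \<le> s" for s
  proof -
    obtain y where y: "(integral {0..s} U, y) \<in> L" "U s = x + y"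
      using U s unfolding mild_solution_def by blast
    have "(?W s, y - (T s x - x)) \<in> L" by (rule L_diff[OF y(1) integral_orbit_graph[OF s]])
    then show ?thesis using y(2) by (simp add: algebra_simps)
  qed
  have "?W t = T t (?W 0)"
    by (rule right_solution_unique[OF continuous_on_of_derivative[OF D] right_derivative_of_within[OF D] L t])
  then have "?W t = 0" by (simp add: blinfun.zero_right)
  then have "(0, U t - T t x) \<in> L" using L[OF t] by simp
  then show ?thesis
    using L_unique subspace_0[OF subspace_L] unfolding zero_prod_def by fastforce
qed

lemma norm_orbit_le:
  assumes "0 \<le> t" "t \<le> h" shows "norm (T t x) \<le> exp (\<bar>\<omega>\<bar> * h) * norm x"
  by (rule order_trans[OF norm_le mult_right_mono[OF exp_le]]) (use assms in auto)

lemma integrate_bound: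
  fixes u :: "real \<Rightarrow> 'a"
  assumes D: "\<And>s. s \<in> {0..t} \<Longrightarrow> (u has_vector_derivative u' s) (at s within {0..t})"
    and B: "\<And>s. s \<in> {0..t} \<Longrightarrow> norm (u' s) \<le> B" and t: "0 \<le> t"
  shows "norm (u t - u 0) \<le> t * B"
proof -
  have "norm (u t - u 0) \<le> B * norm (t - 0)"
  proof (rule differentiable_bound[of "{0..t}" u "\<lambda>s h. h *\<^sub>R u' s"])
    show "onorm (\<lambda>h. h *\<^sub>R u' s) \<le> B" if "s \<in> {0..t}" for s
      using B[OF that] onorm_scaleR_left[OF bounded_linear_ident, of "u' s"] by (simp add: onorm_id)
  qed (use D t in \<open>auto simp: has_vector_derivative_def\<close>)
  then show ?thesis using t by (simp add: mult.commute)
qed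

text \<open>Starting from the growth bound, this estimate and the two that follow arise from one another by integration over
  \<open>[0, t]\<close>; the factors \<open>1/2\<close> and \<open>1/6\<close> are given away.\<close>

lemma orbit_taylor_1:
  assumes xy: "(x, y) \<in> L" and h: "0 \<le> t" "t \<le> h"
  shows "norm (T t x - x) \<le> t * (exp (\<bar>\<omega>\<bar> * h) * norm y)"
proof -
  have "norm (T t x - T 0 x) \<le> t * (exp (\<bar>\<omega>\<bar> * h) * norm y)"
    by (rule integrate_bound[where u' = "\<lambda>s. T s y"])
       (use h norm_orbit_le[of _ h y] in \<open>auto intro: has_vector_derivative_within_subset[OF orbit_derivative[OF xy]]\<close>)
  then show ?thesis by simp
qed

lemma orbit_taylor_2:
  assumes xy: "(x, y) \<in> L" "(y, z) \<in> L" and h: "0 \<le> t" "t \<le> h"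
  shows "norm (T t x - x - t *\<^sub>R y) \<le> t\<^sup>2 * (exp (\<bar>\<omega>\<bar> * h) * norm z)"
proof -
  let ?C = "exp (\<bar>\<omega>\<bar> * h) * norm z"
  have "norm ((T t x - t *\<^sub>R y) - (T 0 x - 0 *\<^sub>R y)) \<le> t * (t * ?C)"
  proof (rule integrate_bound[where u' = "\<lambda>s. T s y - y"])
    fix s assume s: "s \<in> {0..t}"
    have "((\<lambda>t. T t x) has_vector_derivative T s y) (at s within {0..t})"
      by (rule has_vector_derivative_within_subset[OF orbit_derivative[OF xy(1)]]) (use s in auto)
    then show "((\<lambda>t. T t x - t *\<^sub>R y) has_vector_derivative T s y - y) (at s within {0..t})"
      by (auto intro!: derivative_eq_intros)
    have "norm (T s y - y) \<le> s * ?C" using s h by (intro orbit_taylor_1[OF xy(2)]) auto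
    also have "\<dots> \<le> t * ?C" using s by (intro mult_right_mono) auto
    finally show "norm (T s y - y) \<le> t * ?C" .
  qed (rule h)
  then show ?thesis by (simp add: power2_eq_square algebra_simps)
qed

lemma orbit_taylor_3:
  assumes xy: "(x, y) \<in> L" "(y, z) \<in> L" "(z, w) \<in> L" and h: "0 \<le> t" "t \<le> h"
  shows "norm (T t x - x - t *\<^sub>R y - (t\<^sup>2 / 2) *\<^sub>R z) \<le> t ^ 3 * (exp (\<bar>\<omega>\<bar> * h) * norm w)"
proof -
  let ?C = "exp (\<bar>\<omega>\<bar> * h) * norm w"
  have "norm ((T t x - t *\<^sub>R y - (t\<^sup>2 / 2) *\<^sub>R z) - (T 0 x - 0 *\<^sub>R y - (0\<^sup>2 / 2) *\<^sub>R z)) \<le> t * (t\<^sup>2 * ?C)"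
  proof (rule integrate_bound[where u' = "\<lambda>s. T s y - y - s *\<^sub>R z"])
    fix s assume s: "s \<in> {0..t}"
    have "((\<lambda>t. T t x) has_vector_derivative T s y) (at s within {0..t})"
      by (rule has_vector_derivative_within_subset[OF orbit_derivative[OF xy(1)]]) (use s in auto)
    then show "((\<lambda>t. T t x - t *\<^sub>R y - (t\<^sup>2 / 2) *\<^sub>R z) has_vector_derivative T s y - y - s *\<^sub>R z) (at s within {0..t})"
      by (auto intro!: derivative_eq_intros)
    have "norm (T s y - y - s *\<^sub>R z) \<le> s\<^sup>2 * ?C" using s h by (intro orbit_taylor_2[OF xy(2,3)]) auto
    also have "\<dots> \<le> t\<^sup>2 * ?C" using s by (intro mult_right_mono power_mono) auto
    finally show "norm (T s y - y - s *\<^sub>R z) \<le> t\<^sup>2 * ?C" .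
  qed (rule h)
  then show ?thesis by (simp add: power2_eq_square power3_eq_cube algebra_simps)
qed

end

section \<open>Norms and density in spaces of differentiable functions\<close>

text \<open>Both norms are meaningful only where the functions concerned belong to \<open>UCb\<close>.\<close>

definition sup_norm :: "(real \<Rightarrow> real) \<Rightarrow> real" where
  "sup_norm f = norm (Abs_ucb f)"

definition Ck_norm :: "nat \<Rightarrow> (real \<Rightarrow> real) \<Rightarrow> real" where
  "Ck_norm m f = (\<Sum>j\<le>m. sup_norm ((deriv ^^ j) f))"

lemma sup_norm_nonneg [simp]: "0 \<le> sup_norm f"
  by (simp add: sup_norm_def)

lemma abs_le_sup_norm: "f \<in> UCb \<Longrightarrow> \<bar>f x\<bar> \<le> sup_norm f"
  unfolding sup_norm_def using abs_apply_ucb_le[of "Abs_ucb f" x] by (simp add: Abs_ucb_inverse)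

lemma sup_norm_leI: "f \<in> UCb \<Longrightarrow> (\<And>x. \<bar>f x\<bar> \<le> B) \<Longrightarrow> sup_norm f \<le> B"
  unfolding sup_norm_def by (intro norm_ucb_leI) (simp add: Abs_ucb_inverse)

lemma sup_norm_apply_ucb [simp]: "sup_norm (apply_ucb f) = norm f"
  by (simp add: sup_norm_def apply_ucb_inverse)

lemma Ck_norm_nonneg [simp]: "0 \<le> Ck_norm m f"
  unfolding Ck_norm_def by (intro sum_nonneg) simp

lemma Ck_norm_0 [simp]: "Ck_norm 0 f = sup_norm f"
  by (simp add: Ck_norm_def)

lemma Ck_norm_Suc: "Ck_norm (Suc m) f = sup_norm f + Ck_norm m (deriv f)"
  unfolding Ck_norm_def sum.atMost_Suc_shift funpow_Suc_right by simp

lemma Ck_norm_mono: "m \<le> n \<Longrightarrow> Ck_norm m f \<le> Ck_norm n f"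
  unfolding Ck_norm_def by (intro sum_mono2) auto

lemma sup_norm_deriv_le_Ck_norm: "j \<le> m \<Longrightarrow> sup_norm ((deriv ^^ j) f) \<le> Ck_norm m f"
  unfolding Ck_norm_def by (rule member_le_sum) auto

lemma sup_norm_le_Ck_norm: "sup_norm f \<le> Ck_norm m f"
  using sup_norm_deriv_le_Ck_norm[of 0 m f] by simp

lemma Ck_norm_deriv_le: "Ck_norm m (deriv f) \<le> Ck_norm (Suc m) f"
  by (simp add: Ck_norm_Suc)

lemma UCb_n_DERIV:
  "f \<in> UCb_n n \<Longrightarrow> k < n \<Longrightarrow> ((deriv ^^ k) f has_real_derivative (deriv ^^ Suc k) f x) (at x)"
  by (simp add: UCb_n_def field_differentiable_derivI)

lemma UCb_n_derivs_UCb: "f \<in> UCb_n n \<Longrightarrow> k \<le> n \<Longrightarrow> (deriv ^^ k) f \<in> UCb"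
  by (cases "k = 0") (auto simp: UCb_n_def)

lemma abs_deriv_le_Ck_norm:
  "f \<in> UCb_n m \<Longrightarrow> j \<le> m \<Longrightarrow> \<bar>(deriv ^^ j) f x\<bar> \<le> Ck_norm m f"
  using abs_le_sup_norm[OF UCb_n_derivs_UCb] sup_norm_deriv_le_Ck_norm order_trans by blast

lemma UCb_n_SucI:
  assumes "f \<in> UCb" "\<And>x. (f has_real_derivative g x) (at x)" "g \<in> UCb_n n"
  shows "f \<in> UCb_n (Suc n)"
proof -
  have "deriv f = g" using assms(2) by (auto simp: DERIV_imp_deriv)
  then show ?thesis using assms by (auto simp: UCb_n_Suc field_differentiable_def)
qed

lemma lipschitz_of_bounded_derivative:
  fixes f :: "real \<Rightarrow> real"
  assumes "\<And>x. (f has_real_derivative g x) (at x)" "\<And>x. \<bar>g x\<bar> \<le> M"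
  shows "\<bar>f x - f y\<bar> \<le> M * \<bar>x - y\<bar>"
  using field_differentiable_bound[of UNIV f g M x y] assms by auto

lemma UCb_of_lipschitz:
  fixes f :: "real \<Rightarrow> real"
  assumes b: "\<And>x. \<bar>f x\<bar> \<le> B" and l: "\<And>x y. \<bar>f x - f y\<bar> \<le> M * \<bar>x - y\<bar>"
  shows "f \<in> UCb"
proof -
  have M: "M \<ge> 0" using l[of 0 1] by simp
  have "uniformly_continuous_on UNIV f" unfolding uniformly_continuous_on_def
  proof (intro allI impI)
    fix e :: real assume e: "e > 0"
    show "\<exists>d>0. \<forall>x\<in>UNIV. \<forall>y\<in>UNIV. dist y x < d \<longrightarrow> dist (f y) (f x) < e"
    proof (intro exI[of _ "e / (M + 1)"] conjI ballI impI)
      fix x y :: real assume "dist y x < e / (M + 1)"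
      then have d: "(M + 1) * \<bar>y - x\<bar> < e" using M by (simp add: dist_real_def field_simps)
      have "\<bar>f y - f x\<bar> \<le> M * \<bar>y - x\<bar>" by (rule l)
      also have "\<dots> \<le> (M + 1) * \<bar>y - x\<bar>" by (simp add: mult_right_mono)
      finally show "dist (f y) (f x) < e" using d by (simp add: dist_real_def)
    qed (use e M in simp)
  qed
  with b show ?thesis by (auto simp: UCb_def bounded_iff)
qed

lemma hoelder_of_lipschitz:
  assumes l: "\<And>x y. \<bar>f x - f y\<bar> \<le> M * \<bar>x - y\<bar>"
  shows "hoelder f"
proof -
  have "\<bar>f x - f y\<bar> \<le> max M 0 * \<bar>x - y\<bar> powr 1" for x y
    using order_trans[OF l mult_right_mono[of M "max M 0" "\<bar>x - y\<bar>"]] by simp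
  then show ?thesis unfolding hoelder_def
    by (intro exI[of _ "max M 0"] conjI exI[of _ 1]) auto
qed

lemma UCb_n_hoelder:
  assumes "f \<in> UCb_n n" "k < n" shows "hoelder ((deriv ^^ k) f)"
proof -
  have "\<bar>(deriv ^^ k) f x - (deriv ^^ k) f y\<bar> \<le> sup_norm ((deriv ^^ Suc k) f) * \<bar>x - y\<bar>" for x y
    by (rule lipschitz_of_bounded_derivative[OF UCb_n_DERIV[OF assms]
          abs_le_sup_norm[OF UCb_n_derivs_UCb[OF assms(1)]]]) (use assms in simp)
  from hoelder_of_lipschitz[OF this] show ?thesis .
qed

lemma HCb_of_UCb_n_Suc:
  assumes "f \<in> UCb_n (Suc n)" shows "f \<in> HCb n"
  unfolding HCb_def
proof (intro CollectI conjI allI impI)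
  fix j assume "j \<le> n"
  then have "(deriv ^^ j) f \<in> UCb" using assms by (intro UCb_n_derivs_UCb[OF assms]) auto
  then show "bounded (range ((deriv ^^ j) f))" by (simp add: UCb_def)
  show "hoelder ((deriv ^^ j) f)" using \<open>j \<le> n\<close> by (intro UCb_n_hoelder[OF assms]) simp
qed (use assms in \<open>auto simp: UCb_n_def\<close>)

lemma UCb_add: "f \<in> UCb \<Longrightarrow> g \<in> UCb \<Longrightarrow> (\<lambda>x. f x + g x) \<in> UCb"
  and UCb_diff: "f \<in> UCb \<Longrightarrow> g \<in> UCb \<Longrightarrow> (\<lambda>x. f x - g x) \<in> UCb"
  and UCb_mult: "f \<in> UCb \<Longrightarrow> g \<in> UCb \<Longrightarrow> (\<lambda>x. f x * g x) \<in> UCb"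
  and UCb_minus: "f \<in> UCb \<Longrightarrow> (\<lambda>x. - f x) \<in> UCb"
  and UCb_const: "(\<lambda>x. k) \<in> UCb"
  by (auto simp: UCb_iff_buc)

lemma UCb_n_const: "(\<lambda>_. k) \<in> UCb_n n"
proof (induction n arbitrary: k)
  case 0 then show ?case by (simp add: UCb_n_0 UCb_const)
next
  case (Suc n) show ?case by (rule UCb_n_SucI[OF UCb_const _ Suc[of 0]]) simp
qed

lemma UCb_n_cmult: "f \<in> UCb_n n \<Longrightarrow> (\<lambda>x. k * f x) \<in> UCb_n n"
  by (rule UCb_n_mult[OF UCb_n_const])

lemma UCb_n_minus: "f \<in> UCb_n n \<Longrightarrow> (\<lambda>x. - f x) \<in> UCb_n n"
  using UCb_n_cmult[of f n "-1"] by simp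

lemma UCb_n_diff: "f \<in> UCb_n n \<Longrightarrow> g \<in> UCb_n n \<Longrightarrow> (\<lambda>x. f x - g x) \<in> UCb_n n"
  using UCb_n_add[OF _ UCb_n_minus, of f n g] by simp

lemma UCb_n_shift: "f \<in> UCb_n n \<Longrightarrow> (\<lambda>x. f (x + h)) \<in> UCb_n n"
proof (induction n arbitrary: f)
  case 0
  then have "buc_on UNIV (\<lambda>x. f (x + h))"
    by (intro buc_on_compose) (auto simp: UCb_n_0 intro!: uniformly_continuous_on_add uniformly_continuous_on_id uniformly_continuous_on_const)
  then show ?case by (simp add: UCb_n_0 UCb_iff_buc)
next
  case (Suc n)
  have d: "((\<lambda>x. f (x + h)) has_real_derivative deriv f (x + h)) (at x)" for x
    using UCb_n_DERIV[OF Suc.prems, of 0 "x + h"] by (simp add: DERIV_shift)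
  have f0: "f \<in> UCb" using Suc.prems by (rule UCb_n_imp_UCb)
  have "buc_on UNIV (\<lambda>x. f (x + h))"
    by (intro buc_on_compose f0 uniformly_continuous_on_add uniformly_continuous_on_id uniformly_continuous_on_const)
  then show ?case
    using Suc by (intro UCb_n_SucI[OF _ d]) (auto simp: UCb_n_Suc UCb_iff_buc)
qed

lemma sup_norm_add_le:
  "f \<in> UCb \<Longrightarrow> g \<in> UCb \<Longrightarrow> sup_norm (\<lambda>x. f x + g x) \<le> sup_norm f + sup_norm g"
  by (intro sup_norm_leI UCb_add order_trans[OF abs_triangle_ineq] add_mono abs_le_sup_norm)

lemma sup_norm_mult_le:
  "f \<in> UCb \<Longrightarrow> g \<in> UCb \<Longrightarrow> sup_norm (\<lambda>x. f x * g x) \<le> sup_norm f * sup_norm g"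
  by (intro sup_norm_leI UCb_mult) (auto simp: abs_mult intro: mult_mono abs_le_sup_norm)

lemma Ck_norm_add_le:
  "f \<in> UCb_n m \<Longrightarrow> g \<in> UCb_n m \<Longrightarrow> Ck_norm m (\<lambda>x. f x + g x) \<le> Ck_norm m f + Ck_norm m g"
proof (induction m arbitrary: f g)
  case 0 then show ?case by (simp add: sup_norm_add_le UCb_n_0)
next
  case (Suc m)
  then have fd: "\<And>x. f field_differentiable at x" "\<And>x. g field_differentiable at x"
    and m: "deriv f \<in> UCb_n m" "deriv g \<in> UCb_n m" "f \<in> UCb" "g \<in> UCb"
    by (auto simp: UCb_n_Suc)
  have "deriv (\<lambda>x. f x + g x) = (\<lambda>x. deriv f x + deriv g x)"
    using fd by auto
  then show ?case
    using Suc.IH[OF m(1,2)] sup_norm_add_le[OF m(3,4)] by (simp add: Ck_norm_Suc)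
qed

lemma Ck_norm_mult_le:
  "f \<in> UCb_n m \<Longrightarrow> g \<in> UCb_n m \<Longrightarrow> Ck_norm m (\<lambda>x. f x * g x) \<le> 3 ^ m * (Ck_norm m f * Ck_norm m g)"
proof (induction m arbitrary: f g)
  case 0 then show ?case by (simp add: sup_norm_mult_le UCb_n_0)
next
  case (Suc m)
  then have fd: "\<And>x. f field_differentiable at x" "\<And>x. g field_differentiable at x"
    and m: "deriv f \<in> UCb_n m" "deriv g \<in> UCb_n m" "f \<in> UCb" "g \<in> UCb"
    by (auto simp: UCb_n_Suc)
  have m': "f \<in> UCb_n m" "g \<in> UCb_n m"
    using Suc.prems UCb_n_mono[of m "Suc m"] by auto
  let ?F = "Ck_norm (Suc m) f" and ?G = "Ck_norm (Suc m) g"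
  have "deriv (\<lambda>x. f x * g x) = (\<lambda>x. f x * deriv g x + deriv f x * g x)"
    using fd by auto
  then have "Ck_norm m (deriv (\<lambda>x. f x * g x))
      \<le> Ck_norm m (\<lambda>x. f x * deriv g x) + Ck_norm m (\<lambda>x. deriv f x * g x)"
    by (simp add: Ck_norm_add_le UCb_n_mult m m')
  also have "\<dots> \<le> 3 ^ m * (Ck_norm m f * Ck_norm m (deriv g)) + 3 ^ m * (Ck_norm m (deriv f) * Ck_norm m g)"
    by (intro add_mono Suc.IH m m')
  also have "\<dots> \<le> 3 ^ m * (?F * ?G) + 3 ^ m * (?F * ?G)"
    by (intro add_mono mult_left_mono mult_mono Ck_norm_deriv_le Ck_norm_mono) auto
  finally have 1: "Ck_norm m (deriv (\<lambda>x. f x * g x)) \<le> 2 * (3 ^ m * (?F * ?G))"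
    by (simp only: mult_2)
  have "sup_norm (\<lambda>x. f x * g x) \<le> sup_norm f * sup_norm g"
    by (rule sup_norm_mult_le[OF m(3,4)])
  also have "\<dots> \<le> ?F * ?G" by (intro mult_mono sup_norm_le_Ck_norm) auto
  also have "\<dots> \<le> 3 ^ m * (?F * ?G)"
    using mult_right_mono[of 1 "3 ^ m :: real" "?F * ?G"] by simp
  finally show ?case using 1 by (simp add: Ck_norm_Suc[of m "\<lambda>x. f x * g x"])
qed

lemma UCb_of_dominated:
  assumes f: "f \<in> UCb" and b: "\<And>x. \<bar>g x\<bar> \<le> B" and l: "\<And>x y. \<bar>g x - g y\<bar> \<le> M * \<bar>f x - f y\<bar>"
  shows "g \<in> UCb"
proof -
  have "uniformly_continuous_on UNIV g" unfolding uniformly_continuous_on_def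
  proof (intro allI impI)
    fix e :: real assume e: "e > 0"
    then have "e / (\<bar>M\<bar> + 1) > 0" by (simp add: add_nonneg_pos)
    then obtain d where d: "d > 0" "\<And>x y. dist y x < d \<Longrightarrow> dist (f y) (f x) < e / (\<bar>M\<bar> + 1)"
      using f unfolding UCb_def uniformly_continuous_on_def by blast
    show "\<exists>d>0. \<forall>x\<in>UNIV. \<forall>y\<in>UNIV. dist y x < d \<longrightarrow> dist (g y) (g x) < e"
    proof (intro exI[of _ d] conjI ballI impI)
      fix x y :: real assume "dist y x < d"
      from d(2)[OF this] have 1: "(\<bar>M\<bar> + 1) * \<bar>f y - f x\<bar> < e"
        by (simp add: dist_real_def pos_less_divide_eq add_nonneg_pos mult.commute)
      have "\<bar>g y - g x\<bar> \<le> M * \<bar>f y - f x\<bar>" by (rule l)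
      also have "\<dots> \<le> (\<bar>M\<bar> + 1) * \<bar>f y - f x\<bar>" by (intro mult_right_mono) auto
      finally show "dist (g y) (g x) < e" using 1 by (simp add: dist_real_def)
    qed (rule d)
  qed
  with b show ?thesis by (auto simp: UCb_def bounded_iff)
qed

lemma UCb_n_inverse:
  assumes "a \<in> UCb_n n" and pos: "\<And>x. \<alpha> \<le> a x" "\<alpha> > 0"
  shows "(\<lambda>x. inverse (a x)) \<in> UCb_n n"
  using assms(1)
proof (induction n)
  case 0
  then have a: "a \<in> UCb" by (simp add: UCb_n_0)
  have p: "0 < a x" for x using pos by (meson less_le_trans)
  show ?case unfolding UCb_n_0
  proof (rule UCb_of_dominated[OF a, where B = "inverse \<alpha>" and M = "inverse \<alpha> * inverse \<alpha>"])
    have le: "inverse (a x) \<le> inverse \<alpha>" for x using pos by (intro le_imp_inverse_le)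
    then show "\<bar>inverse (a x)\<bar> \<le> inverse \<alpha>" for x using p[of x] by (simp add: abs_of_pos)
    show "\<bar>inverse (a x) - inverse (a y)\<bar> \<le> inverse \<alpha> * inverse \<alpha> * \<bar>a x - a y\<bar>" for x y
    proof -
      have "inverse (a x) - inverse (a y) = (a y - a x) * (inverse (a x) * inverse (a y))"
        using p[of x] p[of y] by (simp add: field_simps)
      also have "\<bar>\<dots>\<bar> = (inverse (a x) * inverse (a y)) * \<bar>a x - a y\<bar>"
        using p[of x] p[of y] by (simp add: abs_mult abs_of_pos abs_minus_commute)
      also have "\<dots> \<le> inverse \<alpha> * inverse \<alpha> * \<bar>a x - a y\<bar>"
        using le[of x] le[of y] p[of x] p[of y] pos(2) by (intro mult_right_mono mult_mono) auto
      finally show ?thesis .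
    qed
  qed
next
  case (Suc n)
  have an: "a \<in> UCb_n n" using Suc.prems UCb_n_mono[of n "Suc n"] by auto
  have p: "a x \<noteq> 0" for x using pos by (metis less_le_trans less_irrefl)
  have inv: "(\<lambda>x. inverse (a x)) \<in> UCb_n n" by (rule Suc.IH[OF an])
  show ?case
  proof (rule UCb_n_SucI)
    show "(\<lambda>x. inverse (a x)) \<in> UCb" using inv by (rule UCb_n_imp_UCb)
    show "((\<lambda>x. inverse (a x)) has_real_derivative - (inverse (a x) * deriv a x * inverse (a x))) (at x)" for x
      using UCb_n_DERIV[OF Suc.prems, of 0] p[of x] by (intro DERIV_inverse') auto
    show "(\<lambda>x. - (inverse (a x) * deriv a x * inverse (a x))) \<in> UCb_n n"
      using Suc.prems by (intro UCb_n_minus UCb_n_mult inv) (simp add: UCb_n_Suc)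
  qed
qed

lemma UCb_continuous_on: "f \<in> UCb \<Longrightarrow> continuous_on S f"
  by (auto simp: UCb_def intro: continuous_on_subset uniformly_continuous_imp_continuous)

lemma antiderivative_exists:
  fixes f :: "real \<Rightarrow> real"
  assumes "continuous_on UNIV f"
  obtains F where "\<And>x. (F has_real_derivative f x) (at x)"
proof
  fix x :: real
  define a where "a = min 0 x - 1"
  define b where "b = max 0 x + 1"
  have "((\<lambda>u. LBINT y=ereal 0..u. f y) has_vector_derivative f x) (at x within {a..b})"
    by (rule interval_integral_FTC2) (auto simp: a_def b_def intro: continuous_on_subset[OF assms])
  moreover have "at x within {a..b} = at x"
    by (rule at_within_interior) (auto simp: a_def b_def)
  ultimately show "((\<lambda>u. LBINT y=ereal 0..u. f y) has_real_derivative f x) (at x)"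
    by (simp add: has_real_derivative_iff_has_vector_derivative)
qed

text \<open>Steklov averages gain one derivative and converge uniformly.\<close>

lemma UCb_approx_Suc:
  assumes f: "f \<in> UCb_n n" and e: "e > 0"
  obtains g where "g \<in> UCb_n (Suc n)" "\<And>x. \<bar>g x - f x\<bar> \<le> e"
proof -
  have f0: "f \<in> UCb" using f by (rule UCb_n_imp_UCb)
  obtain d where d: "d > 0" "\<And>x y. dist y x < d \<Longrightarrow> dist (f y) (f x) < e"
    using f0 e unfolding UCb_def uniformly_continuous_on_def by blast
  define h where "h = d / 2"
  have h: "h > 0" "h < d" using d by (auto simp: h_def)
  obtain F where F: "\<And>x. (F has_real_derivative f x) (at x)"
    using antiderivative_exists[OF UCb_continuous_on[OF f0]] by blast
  define g where "g x = 1 / h * (F (x + h) - F x)" for x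
  have close: "\<bar>g x - f x\<bar> \<le> e" for x
  proof -
    obtain z where z: "x < z" "z < x + h" "F (x + h) - F x = (x + h - x) * f z"
      using MVT2[of x "x + h" F f] F h by auto
    then have "g x = f z" using h by (simp add: g_def)
    moreover have "dist (f z) (f x) < e" using z h by (intro d(2)) (simp add: dist_real_def)
    ultimately show ?thesis by (simp add: dist_real_def)
  qed
  have b: "\<bar>g x\<bar> \<le> e + sup_norm f" for x
    using close[of x] abs_le_sup_norm[OF f0, of x] by linarith
  have D: "(g has_real_derivative 1 / h * (f (x + h) - f x)) (at x)" for x
    unfolding g_def using F[of "x + h"] F[of x]
    by (intro DERIV_cmult DERIV_diff) (simp_all add: DERIV_shift)
  have g': "(\<lambda>x. 1 / h * (f (x + h) - f x)) \<in> UCb_n n"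
    by (intro UCb_n_cmult UCb_n_diff UCb_n_shift f)
  have "g \<in> UCb"
    by (rule UCb_of_lipschitz[OF b lipschitz_of_bounded_derivative[OF D]])
       (rule abs_le_sup_norm[OF UCb_n_imp_UCb[OF g']])
  then have "g \<in> UCb_n (Suc n)" by (rule UCb_n_SucI[OF _ D g'])
  with close show ?thesis using that by blast
qed

lemma UCb_n_dense:
  assumes f: "f \<in> UCb" and e: "e > 0"
  obtains g where "g \<in> UCb_n n" "\<And>x. \<bar>g x - f x\<bar> \<le> e"
proof -
  have "\<exists>g\<in>UCb_n n. \<forall>x. \<bar>g x - f x\<bar> \<le> e" using e
  proof (induction n arbitrary: e)
    case 0
    then show ?case using f by (auto simp: UCb_n_0 intro!: bexI[of _ f])
  next
    case (Suc n)
    obtain g where g: "g \<in> UCb_n n" "\<And>x. \<bar>g x - f x\<bar> \<le> e / 2"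
      using Suc.IH[of "e / 2"] Suc.prems by auto
    obtain k where k: "k \<in> UCb_n (Suc n)" "\<And>x. \<bar>k x - g x\<bar> \<le> e / 2"
      using UCb_approx_Suc[OF g(1), of "e / 2"] Suc.prems by auto
    have "\<bar>k x - f x\<bar> \<le> e" for x using g(2)[of x] k(2)[of x] by linarith
    with k(1) show ?case by blast
  qed
  then show ?thesis using that by blast
qed

lemma deriv_2_eq: "(deriv ^^ 2) f = deriv (deriv f)"
  by (simp add: numeral_2_eq_2)

lemma diff_expr_lin:
  assumes "u \<in> UCb_n 2" "v \<in> UCb_n 2"
  shows "diff_expr a b c (\<lambda>x. u x - v x) x = diff_expr a b c u x - diff_expr a b c v x"
    and "diff_expr a b c (\<lambda>x. u x + v x) x = diff_expr a b c u x + diff_expr a b c v x"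
    and "diff_expr a b c (\<lambda>x. r * u x) x = r * diff_expr a b c u x"
proof -
  have D1: "(u has_real_derivative deriv u x) (at x)" "(v has_real_derivative deriv v x) (at x)" for x
    using UCb_n_DERIV[OF assms(1), of 0] UCb_n_DERIV[OF assms(2), of 0] by auto
  have D2: "(deriv u has_real_derivative (deriv ^^ 2) u x) (at x)" "(deriv v has_real_derivative (deriv ^^ 2) v x) (at x)" for x
    using UCb_n_DERIV[OF assms(1), of 1] UCb_n_DERIV[OF assms(2), of 1] by (auto simp: deriv_2_eq)
  have d1: "deriv (\<lambda>x. u x - v x) = (\<lambda>x. deriv u x - deriv v x)"
    "deriv (\<lambda>x. u x + v x) = (\<lambda>x. deriv u x + deriv v x)"
    "deriv (\<lambda>x. r * u x) = (\<lambda>x. r * deriv u x)"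
    by (auto intro!: DERIV_imp_deriv DERIV_diff DERIV_add DERIV_cmult D1)
  have d2: "deriv (\<lambda>x. deriv u x - deriv v x) = (\<lambda>x. (deriv ^^ 2) u x - (deriv ^^ 2) v x)"
    "deriv (\<lambda>x. deriv u x + deriv v x) = (\<lambda>x. (deriv ^^ 2) u x + (deriv ^^ 2) v x)"
    "deriv (\<lambda>x. r * deriv u x) = (\<lambda>x. r * (deriv ^^ 2) u x)"
    by (auto intro!: DERIV_imp_deriv DERIV_diff DERIV_add DERIV_cmult D2)
  note d2' = d2[unfolded deriv_2_eq]
  show "diff_expr a b c (\<lambda>x. u x - v x) x = diff_expr a b c u x - diff_expr a b c v x"
    "diff_expr a b c (\<lambda>x. u x + v x) x = diff_expr a b c u x + diff_expr a b c v x"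
    "diff_expr a b c (\<lambda>x. r * u x) x = r * diff_expr a b c u x"
    by (simp_all add: diff_expr_def deriv_2_eq d1 d2' algebra_simps)
qed

section \<open>Maximum principle, a priori estimates and the resolvent equation\<close>

text \<open>At an interior maximum \<open>u' = 0\<close> and \<open>u'' \<le> 0\<close>, so the equation bounds \<open>- c u\<close> there.\<close>

lemma max_principle:
  assumes u: "u \<in> UCb_n 2" and a: "\<And>x. 0 \<le> a x" "\<And>x. a x \<le> \<alpha>"
    and b: "\<And>x. \<bar>b x\<bar> \<le> \<beta>" and c: "\<And>x. c x \<le> - \<mu>" and \<mu>: "\<mu> > 0" and B: "B \<ge> 0"
    and L: "\<And>x. - B \<le> diff_expr a b c u x"
  shows "u x \<le> B / \<mu>"
proof (rule ccontr)
  assume "\<not> u x \<le> B / \<mu>"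
  then have ux: "B / \<mu> < u x" by simp
  have u0: "u \<in> UCb" using u by (rule UCb_n_imp_UCb)
  have bdd: "bdd_above (range u)"
    using abs_le_sup_norm[OF u0] by (intro bdd_aboveI[of _ "sup_norm u"]) (auto intro: abs_le_D1)
  define M where "M = (SUP x. u x)"
  have le_M: "u y \<le> M" for y unfolding M_def by (rule cSUP_upper[OF _ bdd]) simp
  have "B < \<mu> * u x" using ux \<mu> by (simp add: pos_divide_less_eq mult.commute)
  also have "\<dots> \<le> \<mu> * M" using le_M \<mu> by simp
  finally have MB: "B < \<mu> * M" .
  have nn: "\<alpha> \<ge> 0" "\<beta> \<ge> 0" using a[of 0] b[of 0] by linarith+
  define \<kappa> where "\<kappa> = 2 * \<alpha> + 2 * \<beta> + \<mu>"
  \<comment> \<open>All errors caused by the parabola add up to \<open>\<delta> \<kappa>\<close>, half of the gap \<open>\<mu> M - B\<close>.\<close>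
  define \<delta> where "\<delta> = (\<mu> * M - B) / (2 * \<kappa>)"
  have K: "\<kappa> > 0" using nn \<mu> by (simp add: \<kappa>_def)
  have \<delta>: "\<delta> > 0" using MB K by (simp add: \<delta>_def)
  have "\<delta> * \<kappa> = (\<mu> * M - B) / 2" using K by (simp add: \<delta>_def)
  also have "\<dots> < \<mu> * M - B" using MB by (simp add: mult.commute)
  finally have "\<delta> * \<kappa> < \<mu> * M - B" .
  then have \<delta>K: "\<delta> * (2 * \<alpha> + 2 * \<beta> + \<mu>) < \<mu> * M - B" by (simp add: \<kappa>_def)
  have \<delta>M: "\<mu> * (M - \<delta>) > B + 2 * \<delta> * (\<alpha> + \<beta>)" using \<delta>K by (simp add: algebra_simps)
  have "B + 2 * \<delta> * (\<alpha> + \<beta>) \<ge> 0" using B \<delta> nn by simp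
  then have "\<mu> * (M - \<delta>) > 0" using \<delta>M by (rule le_less_trans)
  then have M\<delta>: "M - \<delta> > 0" using \<mu> by (simp add: zero_less_mult_iff)
  have "M - \<delta> < M" using \<delta> by simp
  then obtain x0 where x0: "M - \<delta> < u x0"
    unfolding M_def using less_cSUP_iff[OF _ bdd] by auto
  have D1: "(u has_real_derivative deriv u y) (at y)" for y
    using UCb_n_DERIV[OF u, of 0] by simp
  have D2: "(deriv u has_real_derivative (deriv ^^ 2) u y) (at y)" for y
    using UCb_n_DERIV[OF u, of 1] by (simp add: deriv_2_eq)
  \<comment> \<open>The supremum need not be attained; a small parabola moves it to a point near \<open>x0\<close>.\<close>
  define w where "w y = u y - \<delta> * (y - x0)\<^sup>2" for y
  define w' where "w' y = deriv u y - 2 * \<delta> * (y - x0)" for y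
  have Dw: "(w has_real_derivative w' y) (at y)" for y
    unfolding w_def w'_def by (auto intro!: derivative_eq_intros D1)
  have "\<exists>z\<in>{x0 - 1..x0 + 1}. \<forall>y\<in>{x0 - 1..x0 + 1}. w y \<le> w z"
    by (rule continuous_attains_sup) (use DERIV_isCont[OF Dw] in \<open>auto intro: continuous_at_imp_continuous_on\<close>)
  then obtain z where z: "z \<in> {x0 - 1..x0 + 1}" "\<And>y. y \<in> {x0 - 1..x0 + 1} \<Longrightarrow> w y \<le> w z"
    by blast
  have wz: "w z > M - \<delta>" using z(2)[of x0] x0 by (simp add: w_def)
  have "z \<noteq> x0 - 1" "z \<noteq> x0 + 1"
    using wz le_M[of z] by (auto simp: w_def)
  then have zi: "x0 - 1 < z" "z < x0 + 1" using z(1) by auto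
  define d where "d = min (z - (x0 - 1)) (x0 + 1 - z)"
  have d: "d > 0" using zi by (simp add: d_def)
  have max: "w y \<le> w z" if "\<bar>z - y\<bar> < d" for y
    using that by (intro z(2)) (auto simp: d_def abs_if split: if_splits)
  have w'0: "w' z = 0"
    by (rule DERIV_local_max[OF Dw d]) (use max in blast)
  have u2: "(deriv ^^ 2) u z \<le> 2 * \<delta>"
  proof (rule ccontr)
    assume "\<not> ?thesis"
    then have pos: "(deriv ^^ 2) u z - 2 * \<delta> > 0" by simp
    have "(w' has_real_derivative (deriv ^^ 2) u z - 2 * \<delta>) (at z)"
      unfolding w'_def by (auto intro!: derivative_eq_intros D2)
    from DERIV_pos_inc_right[OF this pos]
    obtain d' where d': "d' > 0" "\<And>h. h > 0 \<Longrightarrow> h < d' \<Longrightarrow> w' (z + h) > 0" using w'0 by auto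
    define h where "h = min d d' / 2"
    have h: "h > 0" "h < d" "h < d'" using d d' by (auto simp: h_def)
    obtain y where y: "z < y" "y < z + h" "w (z + h) - w z = (z + h - z) * w' y"
      using MVT2[of z "z + h" w w'] Dw h by auto
    have "w' y > 0" using d'(2)[of "y - z"] y h by simp
    then have "h * w' y > 0" using h by simp
    then have "w (z + h) > w z" using y(3) by simp
    with max[of "z + h"] h show False by simp
  qed
  have u1: "\<bar>deriv u z\<bar> \<le> 2 * \<delta>"
  proof -
    have "deriv u z = 2 * \<delta> * (z - x0)" using w'0 by (simp add: w'_def)
    then have "\<bar>deriv u z\<bar> = 2 * \<delta> * \<bar>z - x0\<bar>" using \<delta> by (simp add: abs_mult)
    also have "\<dots> \<le> 2 * \<delta> * 1" using \<delta> zi by (intro mult_left_mono) auto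
    finally show ?thesis by simp
  qed
  have uz: "u z > M - \<delta>"
  proof -
    have "\<delta> * (z - x0)\<^sup>2 \<ge> 0" using \<delta> by simp
    then show ?thesis using wz unfolding w_def by linarith
  qed
  have "a z * (deriv ^^ 2) u z \<le> a z * (2 * \<delta>)" using u2 a by (intro mult_left_mono) auto
  also have "\<dots> \<le> \<alpha> * (2 * \<delta>)" using a \<delta> by (intro mult_right_mono) auto
  finally have 1: "a z * (deriv ^^ 2) u z \<le> 2 * \<delta> * \<alpha>" by (simp add: mult_ac)
  have "b z * deriv u z \<le> \<bar>b z\<bar> * \<bar>deriv u z\<bar>" by (metis abs_ge_self abs_mult)
  also have "\<dots> \<le> \<beta> * (2 * \<delta>)" using b u1 nn by (intro mult_mono) auto
  finally have 2: "b z * deriv u z \<le> 2 * \<delta> * \<beta>" by (simp add: mult_ac)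
  have "c z * u z \<le> (- \<mu>) * u z" using c uz M\<delta> by (intro mult_right_mono) auto
  also have "\<dots> \<le> - (\<mu> * (M - \<delta>))" using uz \<mu> by simp
  finally have 3: "c z * u z \<le> - (\<mu> * (M - \<delta>))" .
  have "diff_expr a b c u z < - B"
    using 1 2 3 \<delta>M unfolding diff_expr_def by (simp add: algebra_simps)
  with L[of z] show False by simp
qed

lemma max_principle_norm:
  assumes u: "u \<in> UCb_n 2" and abc: "a \<in> UCb" "b \<in> UCb" and a: "\<And>x. 0 \<le> a x"
    and c: "\<And>x. c x \<le> - \<mu>" and \<mu>: "\<mu> > 0" and g: "diff_expr a b c u \<in> UCb"
  shows "\<mu> * sup_norm u \<le> sup_norm (diff_expr a b c u)"
proof -
  let ?B = "sup_norm (diff_expr a b c u)"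
  have ab: "a x \<le> sup_norm a" "\<bar>b x\<bar> \<le> sup_norm b" for x
    using abs_le_sup_norm[OF abc(1), of x] abs_le_sup_norm[OF abc(2), of x] by auto
  have G: "\<bar>diff_expr a b c u x\<bar> \<le> ?B" for x by (rule abs_le_sup_norm[OF g])
  have 1: "u x \<le> ?B / \<mu>" for x
    by (rule max_principle[where a = a and b = b and c = c, OF u a ab c \<mu>]) (use abs_le_D2[OF G] in \<open>simp_all add: minus_le_iff\<close>)
  have u': "(\<lambda>x. (-1) * u x) \<in> UCb_n 2" by (rule UCb_n_cmult[OF u])
  have "- ?B \<le> diff_expr a b c (\<lambda>x. (-1) * u x) x" for x
    using G[of x] diff_expr_lin(3)[OF u u, of a b c "-1" x] by (simp add: abs_le_iff)
  then have 2: "(-1) * u x \<le> ?B / \<mu>" for x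
    by (rule max_principle[where a = a and b = b and c = c, OF u' a ab c \<mu> sup_norm_nonneg])
  have "sup_norm u \<le> ?B / \<mu>"
    using 1 2 by (intro sup_norm_leI UCb_n_imp_UCb[OF u]) (auto simp: abs_le_iff)
  then show ?thesis using \<mu> by (simp add: field_simps)
qed

text \<open>Some difference quotient over a distance \<open>h\<close> is a value of \<open>u'\<close> within distance \<open>h\<close> of any given point.\<close>

lemma deriv_interpolation:
  assumes u: "u \<in> UCb_n 2" and h: "h > 0"
  shows "sup_norm (deriv u) \<le> 2 * sup_norm u / h + h * sup_norm ((deriv ^^ 2) u)"
proof (rule sup_norm_leI)
  show u1: "deriv u \<in> UCb" using UCb_n_derivs_UCb[OF u, of 1] by simp
  fix x
  have u0: "u \<in> UCb" and u2: "(deriv ^^ 2) u \<in> UCb"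
    using UCb_n_derivs_UCb[OF u, of 0] UCb_n_derivs_UCb[OF u, of 2] by simp_all
  have D1: "(u has_real_derivative deriv u y) (at y)" for y
    using UCb_n_DERIV[OF u, of 0] by simp
  have D2: "(deriv u has_real_derivative (deriv ^^ 2) u y) (at y)" for y
    using UCb_n_DERIV[OF u, of 1] by (simp add: deriv_2_eq)
  obtain z where z: "x < z" "z < x + h" "u (x + h) - u x = (x + h - x) * deriv u z"
    using MVT2[of x "x + h" u "deriv u"] D1 h by auto
  have "\<bar>deriv u z\<bar> * h = \<bar>u (x + h) - u x\<bar>" using z h by (simp add: abs_mult)
  also have "\<dots> \<le> 2 * sup_norm u"
    using abs_le_sup_norm[OF u0, of x] abs_le_sup_norm[OF u0, of "x + h"] by linarith
  finally have 1: "\<bar>deriv u z\<bar> \<le> 2 * sup_norm u / h" using h by (simp add: field_simps)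
  have "\<bar>deriv u x - deriv u z\<bar> \<le> sup_norm ((deriv ^^ 2) u) * \<bar>x - z\<bar>"
    by (rule lipschitz_of_bounded_derivative[OF D2 abs_le_sup_norm[OF u2]])
  also have "\<dots> \<le> sup_norm ((deriv ^^ 2) u) * h"
    using z by (intro mult_left_mono) auto
  also have "\<dots> = h * sup_norm ((deriv ^^ 2) u)" by (rule mult.commute)
  finally show "\<bar>deriv u x\<bar> \<le> 2 * sup_norm u / h + h * sup_norm ((deriv ^^ 2) u)"
    using 1 by linarith
qed

lemma Ck_norm_2: "Ck_norm 2 u = sup_norm u + sup_norm (deriv u) + sup_norm ((deriv ^^ 2) u)"
  by (simp add: numeral_2_eq_2 Ck_norm_Suc)

text \<open>\<open>a u'' = L u - b u' - c u\<close>, where interpolation with a small step absorbs \<open>u'\<close> into \<open>u''\<close>. The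
  constant depends on the bounds \<open>\<alpha>, \<beta>, \<gamma>\<close> only, as the continuity method requires.\<close>

lemma elliptic_estimate:
  assumes "\<alpha> > 0" "\<beta> \<ge> 0" "\<gamma> \<ge> 0"
  obtains K where "K \<ge> 0"
    "\<And>a b c u. \<lbrakk>a \<in> UCb; b \<in> UCb; c \<in> UCb; u \<in> UCb_n 2; \<And>x. \<alpha> \<le> a x;
        \<And>x. \<bar>b x\<bar> \<le> \<beta>; \<And>x. \<bar>c x\<bar> \<le> \<gamma>\<rbrakk> \<Longrightarrow>
      Ck_norm 2 u \<le> K * (sup_norm (diff_expr a b c u) + sup_norm u)"
proof -
  define \<beta>' where "\<beta>' = \<beta> + 1"
  \<comment> \<open>With this step the term \<open>b u'\<close> costs at most half of \<open>\<alpha>\<close> times the norm of \<open>u''\<close>.\<close>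
  define h where "h = \<alpha> / (2 * \<beta>')"
  have \<beta>': "\<beta>' > 0" "\<beta> \<le> \<beta>'" using assms by (auto simp: \<beta>'_def)
  have h: "h > 0" using assms \<beta>' by (simp add: h_def)
  have \<beta>h: "\<beta> * h \<le> \<alpha> / 2"
  proof -
    have "\<beta> * h \<le> \<beta>' * h" using h \<beta>' by simp
    also have "\<dots> = \<alpha> / 2" using \<beta>' by (simp add: h_def)
    finally show ?thesis .
  qed
  define K2 where "K2 = 2 / \<alpha> * (1 + 2 * \<beta> / h + \<gamma>)"
  define K where "K = 1 + (2 / h + h * K2) + K2"
  have K2: "K2 \<ge> 0" using assms h by (simp add: K2_def)
  have K: "K \<ge> 0" using K2 h by (simp add: K_def)
  show ?thesis
  proof (rule that[OF K])
    fix a b c u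
    assume abc: "a \<in> UCb" "b \<in> UCb" "c \<in> UCb" and u: "u \<in> UCb_n 2"
      and bd: "\<And>x. \<alpha> \<le> a x" "\<And>x. \<bar>b x\<bar> \<le> \<beta>" "\<And>x. \<bar>c x\<bar> \<le> \<gamma>"
    let ?g = "diff_expr a b c u"
    let ?U0 = "sup_norm u" and ?U1 = "sup_norm (deriv u)" and ?U2 = "sup_norm ((deriv ^^ 2) u)" and ?G = "sup_norm ?g"
    have u': "u \<in> UCb" "deriv u \<in> UCb" "(deriv ^^ 2) u \<in> UCb"
      using UCb_n_derivs_UCb[OF u, of 0] UCb_n_derivs_UCb[OF u, of 1] UCb_n_derivs_UCb[OF u, of 2] by simp_all
    have g: "?g \<in> UCb"
      unfolding diff_expr_def by (intro UCb_add UCb_mult abc u')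
    have I: "?U1 \<le> 2 * ?U0 / h + h * ?U2" by (rule deriv_interpolation[OF u h])
    have pt: "\<alpha> * \<bar>(deriv ^^ 2) u x\<bar> \<le> ?G + \<beta> * ?U1 + \<gamma> * ?U0" for x
    proof -
      have "\<alpha> * \<bar>(deriv ^^ 2) u x\<bar> \<le> \<bar>a x\<bar> * \<bar>(deriv ^^ 2) u x\<bar>"
        using bd(1)[of x] by (intro mult_right_mono) auto
      also have "\<dots> = \<bar>?g x - b x * deriv u x - c x * u x\<bar>"
        by (simp add: diff_expr_def abs_mult)
      also have "\<dots> \<le> \<bar>?g x\<bar> + \<bar>b x * deriv u x\<bar> + \<bar>c x * u x\<bar>" by linarith
      also have "\<dots> \<le> ?G + \<beta> * ?U1 + \<gamma> * ?U0"
        unfolding abs_mult using bd assms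
        by (intro add_mono mult_mono abs_le_sup_norm g u') auto
      finally show ?thesis .
    qed
    have "?U2 \<le> (?G + \<beta> * ?U1 + \<gamma> * ?U0) / \<alpha>"
      using pt assms by (intro sup_norm_leI u') (simp add: field_simps)
    then have "\<alpha> * ?U2 \<le> ?G + \<beta> * ?U1 + \<gamma> * ?U0" using assms by (simp add: field_simps)
    also have "\<dots> \<le> ?G + \<beta> * (2 * ?U0 / h + h * ?U2) + \<gamma> * ?U0"
      using I assms by (intro add_mono mult_left_mono) auto
    also have "\<dots> = ?G + (2 * \<beta> / h + \<gamma>) * ?U0 + (\<beta> * h) * ?U2"
      by (simp add: algebra_simps)
    also have "\<dots> \<le> ?G + (2 * \<beta> / h + \<gamma>) * ?U0 + \<alpha> / 2 * ?U2"
      using \<beta>h by (intro add_mono mult_right_mono) auto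
    finally have "\<alpha> / 2 * ?U2 \<le> ?G + (2 * \<beta> / h + \<gamma>) * ?U0" by simp
    also have "\<dots> \<le> (1 + 2 * \<beta> / h + \<gamma>) * ?G + (1 + 2 * \<beta> / h + \<gamma>) * ?U0"
      using assms h mult_right_mono[of 1 "1 + 2 * \<beta> / h + \<gamma>" ?G]
      by (intro add_mono mult_right_mono) auto
    also have "\<dots> = \<alpha> / 2 * (K2 * (?G + ?U0))"
    proof -
      have "\<alpha> / 2 * K2 = 1 + 2 * \<beta> / h + \<gamma>" using assms by (simp add: K2_def)
      then show ?thesis by (metis distrib_left mult.assoc)
    qed
    finally have U2: "?U2 \<le> K2 * (?G + ?U0)" using assms by simp
    have "h * ?U2 \<le> h * (K2 * (?G + ?U0))" using U2 h by simp
    moreover have "2 * ?U0 / h \<le> 2 / h * (?G + ?U0)" using h by (simp add: field_simps)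
    ultimately have U1: "?U1 \<le> (2 / h + h * K2) * (?G + ?U0)" using I by (simp add: algebra_simps)
    show "Ck_norm 2 u \<le> K * (?G + ?U0)"
      using U1 U2 sup_norm_nonneg[of ?g] unfolding Ck_norm_2 K_def distrib_right[of _ _ "?G + ?U0"] mult_1 by linarith
  qed
qed

text \<open>The bounded solution is \<open>\<integral>\<^bsub>-\<infinity>\<^esub>\<^bsup>x\<^esup> exp (k (s - x)) f s ds\<close>, obtained here from an antiderivative
  normalised at \<open>-\<infinity>\<close>.\<close>

lemma first_order_solution:
  assumes f: "f \<in> UCb" and k: "k > 0"
  obtains v where "v \<in> UCb_n 1" "\<And>x. (v has_real_derivative f x - k * v x) (at x)"
proof -
  let ?M = "sup_norm f"
  have "continuous_on UNIV (\<lambda>s. exp (k * s) * f s)"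
    by (intro continuous_intros UCb_continuous_on f)
  then obtain G where G: "\<And>x. (G has_real_derivative exp (k * x) * f x) (at x)"
    using antiderivative_exists by blast
  define m where "m x = ?M / k * exp (k * x)" for x
  have Dm: "(m has_real_derivative ?M * exp (k * x)) (at x)" for x
    unfolding m_def using k by (auto intro!: derivative_eq_intros)
  have mono: "\<bar>G y - G x\<bar> \<le> m y - m x" if "x \<le> y" for x y
  proof -
    have fM: "\<bar>exp (k * z) * f z\<bar> \<le> ?M * exp (k * z)" for z
      using abs_le_sup_norm[OF f, of z] by (simp add: abs_mult mult.commute)
    have "m x - G x \<le> m y - G y"
    proof (rule DERIV_nonneg_imp_nondecreasing[OF that])
      fix z
      have "0 \<le> ?M * exp (k * z) - exp (k * z) * f z"
        using abs_le_D1[OF fM[of z]] by simp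
      then show "\<exists>D. ((\<lambda>x. m x - G x) has_real_derivative D) (at z) \<and> 0 \<le> D"
        using DERIV_diff[OF Dm G] by blast
    qed
    moreover have "m x + G x \<le> m y + G y"
    proof (rule DERIV_nonneg_imp_nondecreasing[OF that])
      fix z
      have "0 \<le> ?M * exp (k * z) + exp (k * z) * f z"
        using abs_le_D2[OF fM[of z]] by linarith
      then show "\<exists>D. ((\<lambda>x. m x + G x) has_real_derivative D) (at z) \<and> 0 \<le> D"
        using DERIV_add[OF Dm G] by blast
    qed
    ultimately show ?thesis by (simp add: abs_le_iff)
  qed
  have m_pos: "0 \<le> m x" for x using k by (simp add: m_def)
  \<comment> \<open>Monotonicity of \<open>m - G\<close> provides the limit of \<open>G\<close> at \<open>-\<infinity>\<close>.\<close>
  define A where "A n = m (- real n) - G (- real n)" for n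
  have dec: "decseq A"
  proof (rule decseq_SucI)
    fix n
    have "- real (Suc n) \<le> - real n" by simp
    from mono[OF this] show "A (Suc n) \<le> A n" unfolding A_def by linarith
  qed
  have bnd: "\<bar>G 0 - G (- real n)\<bar> \<le> m 0" for n
    using mono[of "- real n" 0] m_pos[of "- real n"] by simp
  have "A n \<ge> - G 0 - m 0" for n
    using bnd[of n] m_pos[of "- real n"] unfolding A_def by linarith
  then obtain C' where C': "A \<longlonglongrightarrow> C'" using decseq_convergent[OF dec] by blast
  have "filterlim (\<lambda>n. k * real n) at_top sequentially"
    using k by (intro filterlim_tendsto_pos_mult_at_top[OF tendsto_const] filterlim_real_sequentially)
  then have "(\<lambda>n. exp (- (k * real n))) \<longlonglongrightarrow> 0"
    by (intro filterlim_compose[OF exp_at_bot] filterlim_compose[OF filterlim_uminus_at_bot_at_top])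
  from tendsto_mult[OF tendsto_const this, of "?M / k"] have "(\<lambda>n. m (- real n)) \<longlonglongrightarrow> 0"
    by (simp add: m_def)
  from tendsto_diff[OF this C'] have lim: "(\<lambda>n. G (- real n)) \<longlonglongrightarrow> - C'"
    by (simp add: A_def)
  have GC: "\<bar>G x + C'\<bar> \<le> m x" for x
  proof (rule tendsto_upperbound)
    show "(\<lambda>n. \<bar>G x - G (- real n)\<bar>) \<longlonglongrightarrow> \<bar>G x + C'\<bar>"
      using tendsto_rabs[OF tendsto_diff[OF tendsto_const lim], of "G x"] by simp
    show "\<forall>\<^sub>F n in sequentially. \<bar>G x - G (- real n)\<bar> \<le> m x"
    proof (rule eventually_sequentiallyI)
      fix n assume "nat \<lceil>\<bar>x\<bar>\<rceil> \<le> n"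
      then have "- real n \<le> x" by linarith
      from mono[OF this] m_pos[of "- real n"] show "\<bar>G x - G (- real n)\<bar> \<le> m x" by linarith
    qed
  qed simp
  define v where "v x = exp (- (k * x)) * (G x + C')" for x
  have v_le: "\<bar>v x\<bar> \<le> ?M / k" for x
  proof -
    have "\<bar>v x\<bar> \<le> exp (- (k * x)) * m x" using GC[of x] by (simp add: v_def abs_mult)
    also have "\<dots> = ?M / k" by (simp add: m_def exp_minus)
    finally show ?thesis .
  qed
  have Dv: "(v has_real_derivative f x - k * v x) (at x)" for x
    unfolding v_def by (auto intro!: derivative_eq_intros G simp: exp_minus field_simps)
  have "\<bar>f x - k * v x\<bar> \<le> ?M + ?M" for x
  proof -
    have "\<bar>k * v x\<bar> \<le> ?M" using v_le[of x] k by (simp add: abs_mult pos_le_divide_eq mult.commute)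
    then show ?thesis using abs_le_sup_norm[OF f, of x] by linarith
  qed
  then have v: "v \<in> UCb"
    by (intro UCb_of_lipschitz[OF v_le] lipschitz_of_bounded_derivative[OF Dv])
  have "v \<in> UCb_n (Suc 0)"
    by (rule UCb_n_SucI[OF v Dv]) (auto simp: UCb_n_0 intro!: UCb_diff UCb_mult UCb_const f v)
  with Dv show ?thesis using that by simp
qed

lemma UCb_reflect: "f \<in> UCb \<Longrightarrow> (\<lambda>x. f (- x)) \<in> UCb"
  unfolding UCb_iff_buc[of "\<lambda>x. f (- x)"]
  by (intro buc_on_compose uniformly_continuous_on_minus uniformly_continuous_on_id)

text \<open>With \<open>k\<^sup>2 = \<mu>\<close>, \<open>\<partial>\<^sup>2 - \<mu> = (\<partial> + k) (\<partial> - k)\<close>; the factor \<open>\<partial> - k\<close> is \<open>- (\<partial> + k)\<close> after the reflection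
  \<open>x \<mapsto> - x\<close>.\<close>

lemma constant_coefficient_solution:
  assumes f: "f \<in> UCb" and \<mu>: "\<mu> > 0"
  obtains u where "u \<in> UCb_n 2" "\<And>x. (deriv ^^ 2) u x - \<mu> * u x = f x"
proof -
  define k where "k = sqrt \<mu>"
  have k: "k > 0" "k * k = \<mu>" using \<mu> by (auto simp: k_def)
  obtain v where v: "v \<in> UCb_n 1" "\<And>x. (v has_real_derivative - f x - k * v x) (at x)"
    by (rule first_order_solution[OF UCb_minus[OF f] k(1)]) blast
  have "(\<lambda>x. v (- x)) \<in> UCb" by (rule UCb_reflect[OF UCb_n_imp_UCb[OF v(1)]])
  then obtain w where w: "w \<in> UCb_n 1" "\<And>x. (w has_real_derivative v (- x) - k * w x) (at x)"
    by (rule first_order_solution[OF _ k(1)]) blast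
  define u where "u x = w (- x)" for x
  have u0: "u \<in> UCb" unfolding u_def by (rule UCb_reflect[OF UCb_n_imp_UCb[OF w(1)]])
  have Du: "(u has_real_derivative k * u x - v x) (at x)" for x
    unfolding u_def using DERIV_chain2[OF w(2)[of "- x"] DERIV_minus[OF DERIV_ident, of x UNIV]] by simp
  have "u \<in> UCb_n (Suc 0)"
    by (rule UCb_n_SucI[OF u0 Du])
       (auto simp: UCb_n_0 intro!: UCb_diff UCb_mult UCb_const u0 UCb_n_imp_UCb[OF v(1)])
  then have "(\<lambda>x. k * u x - v x) \<in> UCb_n (Suc 0)"
    using v(1) by (intro UCb_n_diff UCb_n_cmult) auto
  then have u2: "u \<in> UCb_n 2"
    using UCb_n_SucI[OF u0 Du] by (simp add: numeral_2_eq_2)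
  have "deriv u = (\<lambda>x. k * u x - v x)" using Du by (auto simp: DERIV_imp_deriv)
  moreover have "((\<lambda>x. k * u x - v x) has_real_derivative k * (k * u x - v x) - (- f x - k * v x)) (at x)" for x
    by (intro DERIV_diff DERIV_cmult Du v)
  ultimately have "(deriv ^^ 2) u x = k * (k * u x - v x) - (- f x - k * v x)" for x
    by (simp add: deriv_2_eq DERIV_imp_deriv)
  also have "k * (k * u x - v x) - (- f x - k * v x) = \<mu> * u x + f x" for x
    by (simp add: algebra_simps flip: k(2))
  finally show ?thesis using u2 that by auto
qed

text \<open>The continuity method. The operators \<open>(\<partial>\<^sup>2 - \<mu>) + s D\<close> join the constant coefficient operator to the given one,
  and their inverses are bounded into \<open>C\<^sup>2\<close> uniformly in \<open>s\<close>. So solvability at \<open>s\<close> implies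
  solvability at all \<open>s'\<close> within a fixed distance, by a contraction argument for the right-hand side in \<open>UCb\<close>;
  finitely many steps lead from \<open>0\<close> to \<open>1\<close>.\<close>

lemma elliptic_solvable:
  assumes abc: "a \<in> UCb" "b \<in> UCb" "c \<in> UCb" and a: "\<And>x. \<alpha> \<le> a x" "\<alpha> > 0"
    and c: "\<And>x. c x \<le> - \<mu>" and \<mu>: "\<mu> > 0" and f: "f \<in> UCb"
  obtains u where "u \<in> UCb_n 2" "diff_expr a b c u = f"
proof -
  define A where "A s x = 1 + s * (a x - 1)" for s x
  define B where "B s x = s * b x" for s x
  define C where "C s x = - \<mu> + s * (c x + \<mu>)" for s x
  define D where "D = diff_expr (\<lambda>x. a x - 1) b (\<lambda>x. c x + \<mu>)"
  have ABC: "A s \<in> UCb" "B s \<in> UCb" "C s \<in> UCb" for s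
    unfolding A_def[abs_def] B_def[abs_def] C_def[abs_def] by (intro UCb_add UCb_diff UCb_mult UCb_const abc)+
  have split: "diff_expr (A s) (B s) (C s) u x = (deriv ^^ 2) u x - \<mu> * u x + s * D u x" for s u x
    by (simp add: diff_expr_def D_def A_def B_def C_def algebra_simps)
  have u012: "u \<in> UCb" "deriv u \<in> UCb" "(deriv ^^ 2) u \<in> UCb" if "u \<in> UCb_n 2" for u
    using UCb_n_derivs_UCb[OF that, of 0] UCb_n_derivs_UCb[OF that, of 1] UCb_n_derivs_UCb[OF that, of 2] by simp_all
  have LU: "diff_expr (A s) (B s) (C s) u \<in> UCb" if "u \<in> UCb_n 2" for s u
    unfolding diff_expr_def by (intro UCb_add UCb_mult ABC u012 that)
  have DU: "D u \<in> UCb" if "u \<in> UCb_n 2" for u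
    unfolding D_def diff_expr_def by (intro UCb_add UCb_diff UCb_mult UCb_const abc u012 that)
  define \<alpha>' where "\<alpha>' = min \<alpha> 1"
  have \<alpha>': "\<alpha>' > 0" using a by (simp add: \<alpha>'_def)
  define \<gamma> where "\<gamma> = \<mu> + (sup_norm c + \<mu>)"
  have bd: "\<alpha>' \<le> A s x" "\<bar>B s x\<bar> \<le> sup_norm b" "C s x \<le> - \<mu>" "\<bar>C s x\<bar> \<le> \<gamma>" if s: "s \<in> {0..1}" for s x
  proof -
    have "(1 - s) * \<alpha>' + s * \<alpha>' \<le> (1 - s) * 1 + s * a x"
      using s a(1)[of x] by (intro add_mono mult_left_mono) (auto simp: \<alpha>'_def min_def)
    then show "\<alpha>' \<le> A s x" by (simp add: A_def algebra_simps)
    show "\<bar>B s x\<bar> \<le> sup_norm b"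
      using s abs_le_sup_norm[OF abc(2), of x] mult_mono[of s 1 "\<bar>b x\<bar>" "sup_norm b"] by (simp add: B_def abs_mult)
    show "C s x \<le> - \<mu>" using s c[of x] by (simp add: C_def mult_nonneg_nonpos)
    have "\<bar>s * (c x + \<mu>)\<bar> \<le> 1 * (sup_norm c + \<mu>)"
      using s abs_le_sup_norm[OF abc(3), of x] \<mu> unfolding abs_mult by (intro mult_mono) auto
    then show "\<bar>C s x\<bar> \<le> \<gamma>" using \<mu> abs_triangle_ineq[of "- \<mu>" "s * (c x + \<mu>)"] by (simp add: C_def \<gamma>_def)
  qed
  have \<gamma>0: "\<gamma> \<ge> 0" using \<mu> by (simp add: \<gamma>_def add_nonneg_nonneg)
  obtain K where K: "K \<ge> 0"
    "\<And>s u. s \<in> {0..1} \<Longrightarrow> u \<in> UCb_n 2 \<Longrightarrow>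
      Ck_norm 2 u \<le> K * (sup_norm (diff_expr (A s) (B s) (C s) u) + sup_norm u)"
    by (rule elliptic_estimate[OF \<alpha>' sup_norm_nonneg[of b] \<gamma>0]) (use ABC bd in metis)
  define K' where "K' = K * (1 + 1 / \<mu>)"
  have K': "K' \<ge> 0" using K(1) \<mu> by (simp add: K'_def)
  have est: "Ck_norm 2 u \<le> K' * sup_norm (diff_expr (A s) (B s) (C s) u)" if s: "s \<in> {0..1}" and u: "u \<in> UCb_n 2" for s u
  proof -
    have "\<mu> * sup_norm u \<le> sup_norm (diff_expr (A s) (B s) (C s) u)"
      using bd(1,3)[OF s] \<alpha>' by (intro max_principle_norm[OF u ABC(1,2) _ _ \<mu> LU[OF u]]) (auto intro: order_trans less_imp_le)
    then have "sup_norm u \<le> 1 / \<mu> * sup_norm (diff_expr (A s) (B s) (C s) u)"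
      using \<mu> by (simp add: field_simps)
    then have "sup_norm (diff_expr (A s) (B s) (C s) u) + sup_norm u
        \<le> (1 + 1 / \<mu>) * sup_norm (diff_expr (A s) (B s) (C s) u)"
      by (simp add: algebra_simps)
    then show ?thesis
      using K(2)[OF s u] K(1) unfolding K'_def mult.assoc by (meson mult_left_mono order_trans)
  qed
  define K1 where "K1 = sup_norm (\<lambda>x. a x - 1) + sup_norm b + sup_norm (\<lambda>x. c x + \<mu>)"
  have K1: "K1 \<ge> 0" by (simp add: K1_def)
  have D_le: "\<bar>D u x\<bar> \<le> K1 * Ck_norm 2 u" if u: "u \<in> UCb_n 2" for u x
  proof -
    have m: "(\<lambda>x. a x - 1) \<in> UCb" "(\<lambda>x. c x + \<mu>) \<in> UCb"
      by (intro UCb_add UCb_diff UCb_const abc)+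
    note d = abs_deriv_le_Ck_norm[OF u]
    have "\<bar>D u x\<bar> \<le> \<bar>(a x - 1) * (deriv ^^ 2) u x\<bar> + \<bar>b x * deriv u x\<bar> + \<bar>(c x + \<mu>) * u x\<bar>"
      unfolding D_def diff_expr_def by linarith
    also have "\<dots> \<le> sup_norm (\<lambda>x. a x - 1) * Ck_norm 2 u + sup_norm b * Ck_norm 2 u
        + sup_norm (\<lambda>x. c x + \<mu>) * Ck_norm 2 u"
      unfolding abs_mult
      using d[of 2 x] d[of 1 x] d[of 0 x] abs_le_sup_norm[OF m(1), of x] abs_le_sup_norm[OF abc(2), of x]
        abs_le_sup_norm[OF m(2), of x]
      by (intro add_mono mult_mono) auto
    finally show ?thesis by (simp add: K1_def algebra_simps)
  qed
  define \<kappa> where "\<kappa> = K1 * K'"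
  have \<kappa>: "\<kappa> \<ge> 0" using K1 K' by (simp add: \<kappa>_def)
  define solvable where
    "solvable s \<longleftrightarrow> (\<forall>f\<in>UCb. \<exists>u\<in>UCb_n 2. diff_expr (A s) (B s) (C s) u = f)" for s
  have step: "solvable s'" if sv: "solvable s" and s: "s \<in> {0..1}" and close: "\<bar>s' - s\<bar> * \<kappa> \<le> 1 / 2" for s s'
    unfolding solvable_def
  proof
    fix f assume f: "f \<in> UCb"
    have "\<forall>g. \<exists>u\<in>UCb_n 2. diff_expr (A s) (B s) (C s) u = apply_ucb g"
      using sv by (simp add: solvable_def)
    then obtain R where R: "\<And>g. R g \<in> UCb_n 2" "\<And>g. diff_expr (A s) (B s) (C s) (R g) = apply_ucb g"
      by metis
    define \<Phi> where "\<Phi> g = Abs_ucb (\<lambda>x. f x - (s' - s) * D (R g) x)" for g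
    have \<Phi>: "apply_ucb (\<Phi> g) x = f x - (s' - s) * D (R g) x" for g x
      unfolding \<Phi>_def by (subst Abs_ucb_inverse) (auto intro!: UCb_diff UCb_mult UCb_const f DU R)
    have "dist (\<Phi> g) (\<Phi> h) \<le> 1 / 2 * dist g h" for g h
    proof -
      have RR: "(\<lambda>x. R g x - R h x) \<in> UCb_n 2" by (intro UCb_n_diff R)
      have "diff_expr (A s) (B s) (C s) (\<lambda>x. R g x - R h x) = apply_ucb (g - h)"
        by (rule ext) (simp add: diff_expr_lin[OF R(1) R(1)] R)
      then have "Ck_norm 2 (\<lambda>x. R g x - R h x) \<le> K' * norm (g - h)"
        using est[OF s RR] by simp
      then have *: "K1 * Ck_norm 2 (\<lambda>x. R g x - R h x) \<le> \<kappa> * norm (g - h)"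
        unfolding \<kappa>_def mult.assoc using K1 by (rule mult_left_mono)
      have "\<bar>apply_ucb (\<Phi> g - \<Phi> h) x\<bar> \<le> 1 / 2 * norm (g - h)" for x
      proof -
        have "apply_ucb (\<Phi> g - \<Phi> h) x = - ((s' - s) * D (\<lambda>x. R g x - R h x) x)"
          by (simp add: \<Phi> D_def diff_expr_lin[OF R(1) R(1)] algebra_simps)
        then have "\<bar>apply_ucb (\<Phi> g - \<Phi> h) x\<bar> = \<bar>s' - s\<bar> * \<bar>D (\<lambda>x. R g x - R h x) x\<bar>"
          by (simp add: abs_mult)
        also have "\<dots> \<le> \<bar>s' - s\<bar> * (\<kappa> * norm (g - h))"
          using D_le[OF RR, of x] * by (intro mult_left_mono) auto
        also have "\<dots> \<le> 1 / 2 * norm (g - h)"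
          using mult_right_mono[OF close norm_ge_zero[of "g - h"]] by (simp add: mult.assoc)
        finally show ?thesis .
      qed
      then show ?thesis unfolding dist_norm by (rule norm_ucb_leI)
    qed
    then obtain g where g: "\<Phi> g = g"
      using banach_fix_type[of "1 / 2" \<Phi>] by auto
    have "diff_expr (A s') (B s') (C s') (R g) x = f x" for x
    proof -
      have "diff_expr (A s') (B s') (C s') (R g) x = diff_expr (A s) (B s) (C s) (R g) x + (s' - s) * D (R g) x"
        by (simp add: split algebra_simps)
      also have "\<dots> = apply_ucb (\<Phi> g) x + (s' - s) * D (R g) x" by (simp add: R g)
      also have "\<dots> = f x" by (simp add: \<Phi>)
      finally show ?thesis .
    qed
    then show "\<exists>u\<in>UCb_n 2. diff_expr (A s') (B s') (C s') u = f" using R(1)[of g] by blast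
  qed
  \<comment> \<open>Steps of length \<open>1 / N \<le> 1 / (2 \<kappa>)\<close> make the fixed point map a contraction with factor \<open>1 / 2\<close>.\<close>
  define N where "N = nat \<lceil>2 * \<kappa>\<rceil> + 1"
  have N: "N > 0" "2 * \<kappa> \<le> real N" by (auto simp: N_def) linarith
  have "solvable (real n / real N)" if "n \<le> N" for n
    using that
  proof (induction n)
    case 0
    show ?case unfolding solvable_def
    proof
      fix f assume "f \<in> UCb"
      then obtain u where u: "u \<in> UCb_n 2" "\<And>x. (deriv ^^ 2) u x - \<mu> * u x = f x"
        using constant_coefficient_solution[OF _ \<mu>] by blast
      then have "diff_expr (A (real 0 / real N)) (B (real 0 / real N)) (C (real 0 / real N)) u = f"
        by (intro ext) (simp add: split)
      then show "\<exists>u\<in>UCb_n 2. diff_expr (A (real 0 / real N)) (B (real 0 / real N)) (C (real 0 / real N)) u = f"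
        using u(1) by blast
    qed
  next
    case (Suc n)
    have "real (Suc n) / real N - real n / real N = 1 / real N"
      by (simp add: diff_divide_distrib[symmetric])
    then have "\<bar>real (Suc n) / real N - real n / real N\<bar> * \<kappa> \<le> 1 / 2"
      using N by (simp add: field_simps)
    moreover have "real n / real N \<in> {0..1}" using Suc.prems N(1) by simp
    ultimately show ?case using step Suc by simp
  qed
  from this[of N] have "solvable 1" using N(1) by simp
  then obtain u where u: "u \<in> UCb_n 2" "diff_expr (A 1) (B 1) (C 1) u = f"
    using f unfolding solvable_def by blast
  have "A 1 = a" "B 1 = b" "C 1 = c" by (auto simp: A_def B_def C_def)
  with u show ?thesis using that by simp
qed

section \<open>Elliptic regularity and the closure of the operator\<close>

lemma UCb_n_add_2I:
  assumes "u \<in> UCb_n 2" "(deriv ^^ 2) u \<in> UCb_n m" shows "u \<in> UCb_n (m + 2)"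
  using assms by (simp add: numeral_2_eq_2 UCb_n_Suc)

lemma Ck_norm_add_2: "Ck_norm (m + 2) u = sup_norm u + sup_norm (deriv u) + Ck_norm m ((deriv ^^ 2) u)"
  by (simp add: numeral_2_eq_2 Ck_norm_Suc)

lemma diff_expr_bounded:
  assumes "a \<in> UCb_n m" "b \<in> UCb_n m" "c \<in> UCb_n m"
  obtains K where "K \<ge> 0" "\<And>u. u \<in> UCb_n (m + 2) \<Longrightarrow> Ck_norm m (diff_expr a b c u) \<le> K * Ck_norm (m + 2) u"
proof
  define K where "K = 3 ^ m * (Ck_norm m a + Ck_norm m b + Ck_norm m c)"
  show "K \<ge> 0" by (simp add: K_def add_nonneg_nonneg)
  fix u assume u: "u \<in> UCb_n (m + 2)"
  have u2: "(deriv ^^ 2) u \<in> UCb_n m" and u1: "deriv u \<in> UCb_n m" and u0: "u \<in> UCb_n m"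
    using UCb_n_deriv[of u m 2] UCb_n_deriv[of u "m + 1" 1] UCb_n_mono[of m "m + 1"] UCb_n_mono[of m "m + 2"] u by auto
  have n: "Ck_norm m ((deriv ^^ 2) u) \<le> Ck_norm (m + 2) u"
    unfolding Ck_norm_add_2 by simp
  have n': "Ck_norm m (deriv u) \<le> Ck_norm (m + 2) u" "Ck_norm m u \<le> Ck_norm (m + 2) u"
    using Ck_norm_deriv_le[of m u] Ck_norm_mono[of "Suc m" "m + 2" u] Ck_norm_mono[of m "m + 2" u]
    by auto
  have "Ck_norm m (diff_expr a b c u) \<le>
      Ck_norm m (\<lambda>x. a x * (deriv ^^ 2) u x + b x * deriv u x) + Ck_norm m (\<lambda>x. c x * u x)"
    unfolding diff_expr_def by (intro Ck_norm_add_le UCb_n_add UCb_n_mult assms u0 u1 u2)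
  also have "\<dots> \<le> Ck_norm m (\<lambda>x. a x * (deriv ^^ 2) u x) + Ck_norm m (\<lambda>x. b x * deriv u x) + Ck_norm m (\<lambda>x. c x * u x)"
    by (intro add_mono order_refl Ck_norm_add_le UCb_n_mult assms u0 u1 u2)
  also have "\<dots> \<le> 3 ^ m * (Ck_norm m a * Ck_norm (m + 2) u) + 3 ^ m * (Ck_norm m b * Ck_norm (m + 2) u)
      + 3 ^ m * (Ck_norm m c * Ck_norm (m + 2) u)"
    by (intro add_mono order_trans[OF Ck_norm_mult_le] mult_left_mono n n' assms u0 u1 u2) auto
  finally show "Ck_norm m (diff_expr a b c u) \<le> K * Ck_norm (m + 2) u"
    by (simp add: K_def algebra_simps)
qed

text \<open>In one dimension \<open>u'' = (g - b u' - c u) / a\<close> expresses the top derivative by lower ones,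
  so regularity is gained one derivative at a time.\<close>

lemma elliptic_regularity:
  assumes abc: "a \<in> UCb_n m" "b \<in> UCb_n m" "c \<in> UCb_n m" and a: "\<And>x. \<alpha> \<le> a x" "\<alpha> > 0"
  obtains K where "K \<ge> 0" "\<And>u. u \<in> UCb_n 2 \<Longrightarrow> diff_expr a b c u \<in> UCb_n m \<Longrightarrow>
    u \<in> UCb_n (m + 2) \<and> Ck_norm (m + 2) u \<le> K * (Ck_norm m (diff_expr a b c u) + sup_norm u)"
proof -
  have "\<exists>K\<ge>0. \<forall>u. u \<in> UCb_n 2 \<longrightarrow> diff_expr a b c u \<in> UCb_n m \<longrightarrow>
    u \<in> UCb_n (m + 2) \<and> Ck_norm (m + 2) u \<le> K * (Ck_norm m (diff_expr a b c u) + sup_norm u)"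
    using abc
  proof (induction m)
    case 0
    then have abc0: "a \<in> UCb" "b \<in> UCb" "c \<in> UCb" by (simp_all add: UCb_n_0)
    obtain K where K: "K \<ge> 0"
    "\<And>u. u \<in> UCb_n 2 \<Longrightarrow> Ck_norm 2 u \<le> K * (sup_norm (diff_expr a b c u) + sup_norm u)"
      by (rule elliptic_estimate[OF a(2) sup_norm_nonneg[of b] sup_norm_nonneg[of c]])
         (use abc0 a abs_le_sup_norm in metis)
    then show ?case unfolding add_0_left Ck_norm_0 by blast
  next
    case (Suc m)
    have m: "a \<in> UCb_n m" "b \<in> UCb_n m" "c \<in> UCb_n m"
      using Suc.prems UCb_n_mono[of m "Suc m"] by auto
    obtain K where K: "K \<ge> 0" "\<And>u. u \<in> UCb_n 2 \<Longrightarrow> diff_expr a b c u \<in> UCb_n m \<Longrightarrow>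
    u \<in> UCb_n (m + 2) \<and> Ck_norm (m + 2) u \<le> K * (Ck_norm m (diff_expr a b c u) + sup_norm u)"
      using Suc.IH[OF m] by blast
    define i where "i x = inverse (a x)" for x
    have i: "i \<in> UCb_n (Suc m)" unfolding i_def by (rule UCb_n_inverse[OF Suc.prems(1) a])
    define k where "k = (3::real) ^ Suc m"
    have k: "k \<ge> 1" unfolding k_def by (rule one_le_power) simp
    let ?N = "Ck_norm (Suc m)"
    define K' where "K' = K + k * ?N i * (1 + k * (?N b + ?N c) * K)"
    have K': "K' \<ge> 0" using K(1) k by (simp add: K'_def add_nonneg_nonneg)
    show ?case
    proof (intro exI[of _ K'] conjI allI impI K')
      fix u assume u: "u \<in> UCb_n 2" and g: "diff_expr a b c u \<in> UCb_n (Suc m)"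
      let ?g = "diff_expr a b c u"
      have gm: "?g \<in> UCb_n m" using g UCb_n_mono[of m "Suc m"] by auto
      have u2: "u \<in> UCb_n (m + 2)" and n2: "Ck_norm (m + 2) u \<le> K * (Ck_norm m ?g + sup_norm u)"
        using K(2)[OF u gm] by auto
      have u': "deriv u \<in> UCb_n (Suc m)" "u \<in> UCb_n (Suc m)"
        using u2 UCb_n_mono[of "Suc m" "m + 2"] UCb_n_deriv[of u "Suc m" 1] by auto
      have n': "?N (deriv u) \<le> Ck_norm (m + 2) u" "?N u \<le> Ck_norm (m + 2) u"
        using Ck_norm_deriv_le[of "Suc m" u] Ck_norm_mono[of "Suc m" "m + 2" u] by (simp_all add: numeral_2_eq_2)
      define r where "r x = b x * deriv u x + c x * u x" for x
      have r: "r \<in> UCb_n (Suc m)" unfolding r_def by (intro UCb_n_add UCb_n_mult Suc.prems u')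
      have nr: "?N r \<le> k * (?N b + ?N c) * Ck_norm (m + 2) u"
      proof -
        have "?N r \<le> ?N (\<lambda>x. b x * deriv u x) + ?N (\<lambda>x. c x * u x)"
          unfolding r_def by (intro Ck_norm_add_le UCb_n_mult Suc.prems u')
        also have "\<dots> \<le> k * (?N b * ?N (deriv u)) + k * (?N c * ?N u)"
          unfolding k_def by (intro add_mono Ck_norm_mult_le Suc.prems u')
        also have "\<dots> \<le> k * (?N b * Ck_norm (m + 2) u) + k * (?N c * Ck_norm (m + 2) u)"
          using k by (intro add_mono mult_left_mono n') auto
        finally show ?thesis by (simp add: algebra_simps)
      qed
      have nz: "a x \<noteq> 0" for x using a by (metis less_le_trans less_irrefl)
      have eq: "(deriv ^^ 2) u = (\<lambda>x. i x * (?g x + (-1) * r x))"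
        using nz by (auto simp: i_def r_def diff_expr_def)
      have sum: "(\<lambda>x. ?g x + (-1) * r x) \<in> UCb_n (Suc m)" by (intro UCb_n_add g UCb_n_cmult r)
      have u'': "(deriv ^^ 2) u \<in> UCb_n (Suc m)" unfolding eq by (rule UCb_n_mult[OF i sum])
      then show uS: "u \<in> UCb_n (Suc m + 2)" by (rule UCb_n_add_2I[OF u])
      have neg: "?N (\<lambda>x. (-1) * r x) \<le> ?N r"
      proof -
        have "(deriv ^^ j) (\<lambda>x. - r x) = (\<lambda>x. - (deriv ^^ j) r x)" if "j \<le> Suc m" for j
          using that
        proof (induction j)
          case (Suc j)
          then have "(deriv ^^ Suc j) (\<lambda>x. - r x) = deriv (\<lambda>x. - (deriv ^^ j) r x)" by simp
          also have "\<dots> = (\<lambda>x. - (deriv ^^ Suc j) r x)"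
            using UCb_n_DERIV[OF r, of j] Suc.prems by (auto intro!: DERIV_imp_deriv DERIV_minus)
          finally show ?case .
        qed simp
        then show ?thesis unfolding Ck_norm_def
          using UCb_n_derivs_UCb[OF r] abs_le_sup_norm UCb_minus by (intro sum_mono sup_norm_leI) auto
      qed
      have "?N ((deriv ^^ 2) u) \<le> k * (?N i * ?N (\<lambda>x. ?g x + (-1) * r x))"
        unfolding eq k_def by (rule Ck_norm_mult_le[OF i sum])
      also have "\<dots> \<le> k * (?N i * (?N ?g + ?N r))"
        using k Ck_norm_add_le[OF g UCb_n_cmult[OF r, of "-1"]] neg by (intro mult_left_mono) auto
      finally have A: "?N ((deriv ^^ 2) u) \<le> k * ?N i * (?N ?g + ?N r)" by (simp add: mult.assoc)
      define G where "G = ?N ?g + sup_norm u"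
      have G: "?N ?g \<le> G" "Ck_norm m ?g + sup_norm u \<le> G" "G \<ge> 0"
        using Ck_norm_mono[of m "Suc m" ?g] by (auto simp: G_def add_nonneg_nonneg)
      have n2': "Ck_norm (m + 2) u \<le> K * G" using n2 mult_left_mono[OF G(2) K(1)] by linarith
      have "?N r \<le> k * (?N b + ?N c) * (K * G)"
        using nr k by (intro order_trans[OF nr mult_left_mono[OF n2']]) (auto simp: add_nonneg_nonneg)
      then have "?N ?g + ?N r \<le> (1 + k * (?N b + ?N c) * K) * G" using G(1) by (simp add: algebra_simps)
      then have "k * ?N i * (?N ?g + ?N r) \<le> k * ?N i * ((1 + k * (?N b + ?N c) * K) * G)"
        using k by (intro mult_left_mono) auto
      then have B: "?N ((deriv ^^ 2) u) \<le> k * ?N i * (1 + k * (?N b + ?N c) * K) * G" using A by (simp add: mult.assoc)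
      have "Ck_norm (Suc m + 2) u \<le> Ck_norm (m + 2) u + ?N ((deriv ^^ 2) u)"
        unfolding Ck_norm_add_2 by simp
      also have "\<dots> \<le> K' * G" using n2' B by (simp add: K'_def algebra_simps)
      finally show "Ck_norm (Suc m + 2) u \<le> K' * (?N ?g + sup_norm u)" by (simp add: G_def)
    qed
  qed
  then show ?thesis using that by blast
qed

locale elliptic_operator =
  fixes a b c :: "real \<Rightarrow> real" and \<alpha> :: real
  assumes abc2: "a \<in> UCb_n 2" "b \<in> UCb_n 2" "c \<in> UCb_n 2"
    and a_ge: "\<And>x. \<alpha> \<le> a x" and \<alpha>_pos: "\<alpha> > 0"
begin

lemma abc: "a \<in> UCb" "b \<in> UCb" "c \<in> UCb"
  using abc2 by (auto intro: UCb_n_imp_UCb)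

definition \<gamma> :: real where "\<gamma> = (SUP x. c x)"

lemma c_le: "c x \<le> \<gamma>"
proof -
  have "bdd_above (range c)"
    using abs_le_sup_norm[OF abc(3)] by (intro bdd_aboveI[of _ "sup_norm c"]) (auto intro: abs_le_D1)
  then show ?thesis unfolding \<gamma>_def by (intro cSUP_upper) auto
qed

text \<open>The operator on its maximal regular domain, which turns out to be that of the closure.\<close>

definition L_graph :: "(ucb \<times> ucb) set" where
  "L_graph = {(u, g). apply_ucb u \<in> UCb_n 2 \<and> apply_ucb g = diff_expr a b c (apply_ucb u)}"

lemma diff_op_in_L_graph: "apply_ucb u \<in> UCb_n 2 \<Longrightarrow> (u, diff_op a b c u) \<in> L_graph"
  by (simp add: L_graph_def apply_diff_op[OF abc])

lemma L_graph_diff_op: "(u, g) \<in> L_graph \<Longrightarrow> g = diff_op a b c u"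
  by (auto simp: L_graph_def apply_diff_op[OF abc] intro: ucb_eqI)

text \<open>After the shift the coefficient of order zero is nonpositive, so that the maximum principle yields dissipativity.\<close>

definition A :: "(ucb \<times> ucb) set" where
  "A = {(u, g - \<gamma> *\<^sub>R u) | u g. (u, g) \<in> L_graph}"

lemma A_iff: "(u, y) \<in> A \<longleftrightarrow> apply_ucb u \<in> UCb_n 2 \<and> apply_ucb y = diff_expr a b (\<lambda>x. c x - \<gamma>) (apply_ucb u)"
proof -
  have "(u, y) \<in> A \<longleftrightarrow> (u, y + \<gamma> *\<^sub>R u) \<in> L_graph"
    by (auto simp: A_def) (metis diff_add_cancel add_diff_cancel)
  also have "\<dots> \<longleftrightarrow> apply_ucb u \<in> UCb_n 2 \<and> apply_ucb y = diff_expr a b (\<lambda>x. c x - \<gamma>) (apply_ucb u)"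
    by (auto simp: L_graph_def diff_expr_def fun_eq_iff algebra_simps)
  finally show ?thesis .
qed

lemma apply_ucb_fun: "apply_ucb (u + v) = (\<lambda>x. apply_ucb u x + apply_ucb v x)"
  "apply_ucb (r *\<^sub>R u) = (\<lambda>x. r * apply_ucb u x)" "apply_ucb 0 = (\<lambda>x. 0)"
  by auto

sublocale m_dissipative A
proof
  show "subspace A"
  proof (rule subspaceI)
    show "0 \<in> A"
      by (simp add: zero_prod_def A_iff apply_ucb_fun UCb_n_const diff_expr_def deriv_2_eq fun_eq_iff)
  next
    fix p q assume "p \<in> A" "q \<in> A"
    then show "p + q \<in> A"
      by (cases p; cases q) (auto simp: A_iff apply_ucb_fun UCb_n_add diff_expr_lin fun_eq_iff)
  next
    fix r p assume "p \<in> A"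
    then show "r *\<^sub>R p \<in> A"
      by (cases p) (auto simp: A_iff apply_ucb_fun UCb_n_cmult diff_expr_lin fun_eq_iff)
  qed
next
  fix u y h assume uy: "(u, y) \<in> A" and h: "0 < (h::real)"
  have u: "apply_ucb u \<in> UCb_n 2" and y: "apply_ucb y = diff_expr a b (\<lambda>x. c x - \<gamma>) (apply_ucb u)"
    using uy by (auto simp: A_iff)
  let ?c = "\<lambda>x. c x - \<gamma> - 1 / h"
  have eq: "diff_expr a b ?c (apply_ucb u) = apply_ucb (y - (1 / h) *\<^sub>R u)"
    by (auto simp: y diff_expr_def algebra_simps)
  have "1 / h * sup_norm (apply_ucb u) \<le> sup_norm (diff_expr a b ?c (apply_ucb u))"
  proof (rule max_principle_norm[OF u abc(1,2)])
    show "0 \<le> a x" for x using a_ge[of x] \<alpha>_pos by simp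
    show "c x - \<gamma> - 1 / h \<le> - (1 / h)" for x using c_le[of x] by simp
    show "diff_expr a b ?c (apply_ucb u) \<in> UCb" unfolding eq by simp
  qed (use h in simp)
  then have "norm u \<le> h * norm (y - (1 / h) *\<^sub>R u)" unfolding eq using h by (simp add: field_simps)
  also have "\<dots> = norm (h *\<^sub>R (y - (1 / h) *\<^sub>R u))" using h by simp
  also have "h *\<^sub>R (y - (1 / h) *\<^sub>R u) = - (u - h *\<^sub>R y)" using h by (simp add: scaleR_right_diff_distrib)
  finally show "norm u \<le> norm (u - h *\<^sub>R y)" by (simp only: norm_minus_cancel)
next
  fix h :: real and f :: ucb assume h: "0 < h"
  let ?c = "\<lambda>x. c x - \<gamma> - 1 / h"
  have "?c \<in> UCb" "(\<lambda>x. - 1 / h * apply_ucb f x) \<in> UCb"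
    by (intro UCb_diff UCb_mult UCb_const abc apply_ucb_mem)+
  moreover have "?c x \<le> - (1 / h)" for x using c_le[of x] by simp
  ultimately obtain u where u: "u \<in> UCb_n 2" "diff_expr a b ?c u = (\<lambda>x. - 1 / h * apply_ucb f x)"
    using elliptic_solvable[OF abc(1,2) _ a_ge \<alpha>_pos, of ?c "1 / h"] h by auto
  let ?u = "Abs_ucb u"
  have au: "apply_ucb ?u = u" using u(1) by (simp add: Abs_ucb_inverse UCb_n_imp_UCb)
  define y where "y = (1 / h) *\<^sub>R (?u - f)"
  have "apply_ucb y x = diff_expr a b (\<lambda>x. c x - \<gamma>) (apply_ucb ?u) x" for x
    using fun_cong[OF u(2), of x] by (simp add: y_def au diff_expr_def algebra_simps)
  then have "(?u, y) \<in> A" using u(1) by (auto simp: A_iff au)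
  moreover have "?u - h *\<^sub>R y = f" using h by (simp add: y_def)
  ultimately show "\<exists>x y. (x, y) \<in> A \<and> x - h *\<^sub>R y = f" by blast
next
  show "closure (Domain A) = UNIV"
  proof (intro set_eqI iffI UNIV_I)
    fix f :: ucb
    show "f \<in> closure (Domain A)" unfolding closure_approachable
    proof (intro allI impI)
      fix e :: real assume e: "e > 0"
      obtain g where g: "g \<in> UCb_n 2" "\<And>x. \<bar>g x - apply_ucb f x\<bar> \<le> e / 2"
        using UCb_n_dense[OF apply_ucb_mem[of f], of "e / 2"] e by auto
      let ?g = "Abs_ucb g"
      have ag: "apply_ucb ?g = g" using g(1) by (simp add: Abs_ucb_inverse UCb_n_imp_UCb)
      have "norm (?g - f) \<le> e / 2" using g(2) by (intro norm_ucb_leI) (simp add: ag)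
      moreover have "?g \<in> Domain A"
        using diff_op_in_L_graph[of ?g] g(1) by (auto simp: A_def ag intro!: DomainI)
      ultimately show "\<exists>y\<in>Domain A. dist y f < e" using e by (intro bexI[of _ ?g]) (auto simp: dist_norm)
    qed
  qed
qed

definition T :: "real \<Rightarrow> ucb \<Rightarrow>\<^sub>L ucb" where "T t = exp (\<gamma> * t) *\<^sub>R flow t"

sublocale exp_bounded_semigroup L_graph T \<gamma>
proof
  have "{(x, y + \<gamma> *\<^sub>R x) | x y. (x, y) \<in> A} = L_graph" by (force simp: A_def)
  then show "generates L_graph T"
    using generates_rescale[OF generates_flow, of \<gamma>] unfolding T_def by simp
  show "norm (T t x) \<le> exp (\<gamma> * t) * norm x" if "0 \<le> t" for t x
    using norm_flow_le[OF that, of x] by (simp add: T_def blinfun.scaleR_left mult_left_mono)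
qed

lemma closed_L_graph: "closed L_graph"
  unfolding closed_sequential_limits
proof (intro allI impI)
  fix p :: "nat \<Rightarrow> ucb \<times> ucb" and l assume p: "(\<forall>n. p n \<in> L_graph) \<and> p \<longlonglongrightarrow> l"
  then have "\<forall>n. (fst (p n), snd (p n) - \<gamma> *\<^sub>R fst (p n)) \<in> A"
    by (auto simp: A_def)
  moreover have "(\<lambda>n. (fst (p n), snd (p n) - \<gamma> *\<^sub>R fst (p n))) \<longlonglongrightarrow> (fst l, snd l - \<gamma> *\<^sub>R fst l)"
    using p by (intro tendsto_intros) auto
  ultimately have "(fst l, snd l - \<gamma> *\<^sub>R fst l) \<in> A"
    using closed_sequentially[OF closed_A, of "\<lambda>n. (fst (p n), snd (p n) - \<gamma> *\<^sub>R fst (p n))"] by blast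
  then have "(fst l, snd l) \<in> L_graph" by (auto simp: A_def)
  then show "l \<in> L_graph" by simp
qed

lemma H_graph_subset: "H_graph a b c \<subseteq> L_graph"
  using HCb_subset_UCb_n[of 2] diff_op_in_L_graph by (auto simp: H_graph_def)

text \<open>For \<open>(u, L u)\<close> in the graph, let \<open>f = u - (L - \<gamma>) u\<close> and approximate \<open>f\<close> by functions \<open>f'\<close> with one derivative. By
  regularity the resolvent takes \<open>f'\<close> to functions with three derivatives, and by its continuity these converge
  to \<open>u\<close> in the graph norm.\<close>

lemma closure_H_graph: "closure (H_graph a b c) = L_graph"
proof
  show "closure (H_graph a b c) \<subseteq> L_graph"
    by (rule closure_minimal[OF H_graph_subset closed_L_graph])
  show "L_graph \<subseteq> closure (H_graph a b c)"
  proof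
    fix p assume "p \<in> L_graph"
    obtain u g where p: "p = (u, g)" by (cases p)
    with \<open>p \<in> L_graph\<close> have ug: "(u, g) \<in> L_graph" by simp
    define y where "y = g - \<gamma> *\<^sub>R u"
    have uy: "(u, y) \<in> A" using ug by (auto simp: A_def y_def)
    define f where "f = u - y"
    show "p \<in> closure (H_graph a b c)" unfolding closure_approachable
    proof (intro allI impI)
      fix e :: real assume e: "e > 0"
      \<comment> \<open>An \<open>\<epsilon>\<close>-change of \<open>f\<close> moves the solution by at most \<open>\<epsilon>\<close> and its image under \<open>L\<close> by at most \<open>(2 + \<bar>\<gamma>\<bar>) \<epsilon>\<close>.\<close>
      define \<epsilon> where "\<epsilon> = e / (4 + \<bar>\<gamma>\<bar>)"
      have k: "4 + \<bar>\<gamma>\<bar> > 0" by simp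
      have \<epsilon>: "\<epsilon> > 0" using e k by (simp add: \<epsilon>_def)
      obtain f' where f': "f' \<in> UCb_n 1" "\<And>x. \<bar>f' x - apply_ucb f x\<bar> \<le> \<epsilon>"
        using UCb_n_dense[OF apply_ucb_mem[of f] \<epsilon>] by blast
      define F where "F = Abs_ucb f'"
      have aF: "apply_ucb F = f'" using f'(1) by (simp add: F_def Abs_ucb_inverse UCb_n_imp_UCb)
      have Ff: "norm (F - f) \<le> \<epsilon>" using f'(2) by (intro norm_ucb_leI) (simp add: aF)
      obtain z where z: "(J 1 F, z) \<in> A" "J 1 F - 1 *\<^sub>R z = F" by (rule J_graph[OF zero_less_one])
      define v where "v = J 1 F"
      have zv: "z = v - F" using z(2) by (simp add: v_def algebra_simps)
      have uv: "norm (v - u) \<le> \<epsilon>"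
      proof -
        have "norm (v - u) \<le> norm (v - u - 1 *\<^sub>R (z - y))"
          using z(1) uy by (intro dissipative A_diff) (auto simp: v_def)
        also have "v - u - 1 *\<^sub>R (z - y) = F - f" by (simp add: zv f_def)
        finally show ?thesis using Ff by simp
      qed
      have vL: "(v, z + \<gamma> *\<^sub>R v) \<in> L_graph" using z(1) by (auto simp: A_def v_def)
      have v2: "apply_ucb v \<in> UCb_n 2" using vL by (simp add: L_graph_def)
      have v1: "apply_ucb v \<in> UCb_n 1" using v2 UCb_n_mono[of 1 2] by auto
      have "diff_expr a b c (apply_ucb v) = (\<lambda>x. (apply_ucb v x - f' x) + \<gamma> * apply_ucb v x)"
        using vL by (auto simp: L_graph_def zv aF fun_eq_iff)
      also have "\<dots> \<in> UCb_n 1" by (intro UCb_n_add UCb_n_diff UCb_n_cmult v1 f'(1))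
      finally have "diff_expr a b c (apply_ucb v) \<in> UCb_n 1" .
      moreover have "a \<in> UCb_n 1" "b \<in> UCb_n 1" "c \<in> UCb_n 1"
        using abc2 UCb_n_mono[of 1 2] by auto
      then obtain K where "\<And>u. u \<in> UCb_n 2 \<Longrightarrow> diff_expr a b c u \<in> UCb_n 1 \<Longrightarrow> u \<in> UCb_n (1 + 2)"
        by (rule elliptic_regularity[OF _ _ _ a_ge \<alpha>_pos]) blast
      ultimately have "apply_ucb v \<in> UCb_n (1 + 2)" using v2 by blast
      then have "apply_ucb v \<in> HCb 2"
        by (intro HCb_of_UCb_n_Suc) (simp add: eval_nat_numeral)
      then have H: "(v, z + \<gamma> *\<^sub>R v) \<in> H_graph a b c"
        using L_graph_diff_op[OF vL] by (auto simp: H_graph_def)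
      have "(z + \<gamma> *\<^sub>R v) - g = (1 + \<gamma>) *\<^sub>R (v - u) - (F - f)"
        by (simp add: zv f_def y_def algebra_simps)
      also have "norm \<dots> \<le> norm ((1 + \<gamma>) *\<^sub>R (v - u)) + norm (F - f)" by (rule norm_triangle_ineq4)
      also have "\<dots> \<le> (1 + \<bar>\<gamma>\<bar>) * \<epsilon> + \<epsilon>"
        using uv Ff \<epsilon> unfolding norm_scaleR by (intro add_mono mult_mono) auto
      finally have n2: "norm ((z + \<gamma> *\<^sub>R v) - g) \<le> (2 + \<bar>\<gamma>\<bar>) * \<epsilon>" by (simp add: algebra_simps)
      have "dist (v, z + \<gamma> *\<^sub>R v) (u, g) \<le> norm (v - u) + norm ((z + \<gamma> *\<^sub>R v) - g)"
        unfolding dist_Pair_Pair unfolding dist_norm by (rule sqrt_sum_squares_le_sum) auto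
      also have "\<dots> \<le> \<epsilon> + (2 + \<bar>\<gamma>\<bar>) * \<epsilon>" using uv n2 by (rule add_mono)
      also have "\<dots> < (4 + \<bar>\<gamma>\<bar>) * \<epsilon>" using \<epsilon> by (simp add: algebra_simps)
      also have "\<dots> = e" using k by (simp add: \<epsilon>_def)
      finally show "\<exists>q\<in>H_graph a b c. dist q p < e" using H p by blast
    qed
  qed
qed

lemma dense_L_graph: "closure (Domain L_graph) = UNIV"
proof -
  have "Domain L_graph = Domain A" by (auto simp: A_def)
  then show ?thesis using dense by simp
qed

text \<open>\<open>L (T t f) = T t (L f)\<close>, where \<open>L f\<close> has two derivatives fewer than \<open>f\<close>. By induction \<open>T t (L f)\<close> is bounded
  with these derivatives, and elliptic regularity returns the two missing ones for \<open>T t f\<close>.\<close>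

lemma T_regularity:
  assumes "a \<in> UCb_n n" "b \<in> UCb_n n" "c \<in> UCb_n n" "2 * k \<le> n + 2"
  shows "\<exists>K\<ge>0. \<forall>f t. 0 \<le> t \<longrightarrow> apply_ucb f \<in> UCb_n (2 * k) \<longrightarrow>
    apply_ucb (T t f) \<in> UCb_n (2 * k) \<and>
    Ck_norm (2 * k) (apply_ucb (T t f)) \<le> K * exp (\<gamma> * t) * Ck_norm (2 * k) (apply_ucb f)"
  using assms(4)
proof (induction k)
  case 0
  show ?case using norm_le by (intro exI[of _ 1]) (auto simp: UCb_n_0)
next
  case (Suc k)
  let ?m = "2 * k"
  have abcm: "a \<in> UCb_n ?m" "b \<in> UCb_n ?m" "c \<in> UCb_n ?m"
    using assms(1-3) UCb_n_mono[of ?m n] Suc.prems by auto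
  obtain K where K: "K \<ge> 0" "\<And>f t. 0 \<le> t \<Longrightarrow> apply_ucb f \<in> UCb_n ?m \<Longrightarrow>
    apply_ucb (T t f) \<in> UCb_n ?m \<and>
    Ck_norm ?m (apply_ucb (T t f)) \<le> K * exp (\<gamma> * t) * Ck_norm ?m (apply_ucb f)"
    using Suc.IH Suc.prems by auto
  obtain K1 where K1: "K1 \<ge> 0" "\<And>u. u \<in> UCb_n (?m + 2) \<Longrightarrow> Ck_norm ?m (diff_expr a b c u) \<le> K1 * Ck_norm (?m + 2) u"
    using diff_expr_bounded[OF abcm] by blast
  obtain K2 where K2: "K2 \<ge> 0" "\<And>u. u \<in> UCb_n 2 \<Longrightarrow> diff_expr a b c u \<in> UCb_n ?m \<Longrightarrow>
    u \<in> UCb_n (?m + 2) \<and> Ck_norm (?m + 2) u \<le> K2 * (Ck_norm ?m (diff_expr a b c u) + sup_norm u)"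
    using elliptic_regularity[OF abcm a_ge \<alpha>_pos] by blast
  have S: "2 * Suc k = ?m + 2" by simp
  show ?case unfolding S
  proof (intro exI[of _ "K2 * (K * K1 + 1)"] conjI allI impI)
    show "K2 * (K * K1 + 1) \<ge> 0" using K(1) K1(1) K2(1) by simp
    fix f and t :: real assume t: "0 \<le> t" and f: "apply_ucb f \<in> UCb_n (?m + 2)"
    define g where "g = diff_op a b c f"
    have f2: "apply_ucb f \<in> UCb_n 2" using f UCb_n_mono[of 2 "?m + 2"] by auto
    have g: "apply_ucb g = diff_expr a b c (apply_ucb f)"
      by (simp add: g_def apply_diff_op[OF abc f2])
    have gm: "apply_ucb g \<in> UCb_n ?m" unfolding g by (rule diff_expr_UCb_n[OF abcm f])
    have "(f, g) \<in> L_graph" using diff_op_in_L_graph[OF f2] by (simp add: g_def)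
    from graph_invariant[OF this t]
    have Tf: "apply_ucb (T t f) \<in> UCb_n 2" "diff_expr a b c (apply_ucb (T t f)) = apply_ucb (T t g)"
      by (auto simp: L_graph_def)
    note Tg = K(2)[OF t gm]
    have 2: "apply_ucb (T t f) \<in> UCb_n (?m + 2)"
      "Ck_norm (?m + 2) (apply_ucb (T t f)) \<le> K2 * (Ck_norm ?m (apply_ucb (T t g)) + norm (T t f))"
      using K2(2)[OF Tf(1)] Tg Tf(2) by auto
    show "apply_ucb (T t f) \<in> UCb_n (?m + 2)" by (rule 2)
    let ?N = "Ck_norm (?m + 2) (apply_ucb f)"
    have "Ck_norm ?m (apply_ucb (T t g)) \<le> K * exp (\<gamma> * t) * (K1 * ?N)"
      using Tg K1(2)[OF f] K(1) unfolding g by (meson mult_left_mono order_trans mult_nonneg_nonneg exp_ge_zero)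
    moreover have "norm (T t f) \<le> exp (\<gamma> * t) * ?N"
      using norm_le[OF t, of f] sup_norm_le_Ck_norm[of "apply_ucb f" "?m + 2"]
      by (simp add: order_trans)
    ultimately have "Ck_norm ?m (apply_ucb (T t g)) + norm (T t f) \<le> (K * K1 + 1) * exp (\<gamma> * t) * ?N"
      by (simp add: algebra_simps)
    from mult_left_mono[OF this K2(1)]
    show "Ck_norm (?m + 2) (apply_ucb (T t f)) \<le> K2 * (K * K1 + 1) * exp (\<gamma> * t) * ?N"
      using 2(2) by (simp add: mult.assoc)
  qed
qed

end

section \<open>Taylor expansion of the Chernoff function\<close>

lemma taylor_UCb:
  assumes f: "f \<in> UCb_n n" and n: "n > 0"
  shows "\<bar>f (x + z) - (\<Sum>k<n. (deriv ^^ k) f x / fact k * z ^ k)\<bar> \<le> sup_norm ((deriv ^^ n) f) * \<bar>z\<bar> ^ n"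
proof (cases "z = 0")
  case True
  have "(\<Sum>k<n. (deriv ^^ k) f x / fact k * 0 ^ k) = f x"
    using n by (subst sum.remove[of _ 0]) (auto simp: power_0_left)
  with True n show ?thesis by simp
next
  case False
  have "\<exists>s. (if x + z < x then x + z < s \<and> s < x else x < s \<and> s < x + z) \<and>
      f (x + z) = (\<Sum>m<n. ((deriv ^^ m) f x / fact m) * (x + z - x) ^ m) + ((deriv ^^ n) f s / fact n) * (x + z - x) ^ n"
    by (rule Taylor[where diff = "\<lambda>m. (deriv ^^ m) f" and a = "min x (x + z)" and b = "max x (x + z)"])
       (use n False UCb_n_DERIV[OF f] in auto)
  then obtain s where "f (x + z) = (\<Sum>m<n. ((deriv ^^ m) f x / fact m) * (x + z - x) ^ m) + ((deriv ^^ n) f s / fact n) * (x + z - x) ^ n"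
    by blast
  then have s: "f (x + z) - (\<Sum>k<n. (deriv ^^ k) f x / fact k * z ^ k) = ((deriv ^^ n) f s / fact n) * z ^ n"
    by simp
  have "\<bar>(deriv ^^ n) f s / fact n\<bar> \<le> \<bar>(deriv ^^ n) f s\<bar> / 1"
    unfolding abs_divide by (intro divide_left_mono) (auto simp: fact_ge_1)
  also have "\<dots> \<le> sup_norm ((deriv ^^ n) f)"
    using abs_le_sup_norm[OF UCb_n_derivs_UCb[OF f order_refl]] by simp
  finally show ?thesis unfolding s abs_mult power_abs by (rule mult_right_mono) simp
qed

text \<open>Both integrals in the Chernoff function have this form, with displacement \<open>g\<close> and weight \<open>w\<close>.\<close>

lemma taylor_integral:
  fixes w g :: "real \<Rightarrow> real"
  assumes f: "f \<in> UCb_n n" and n: "n > 0"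
    and w: "continuous_on {-1..1} w" "\<And>y. y \<in> {-1..1} \<Longrightarrow> \<bar>w y\<bar> \<le> W"
    and g: "continuous_on {-1..1} g" "\<And>y. y \<in> {-1..1} \<Longrightarrow> \<bar>g y\<bar> \<le> Z"
  shows "\<bar>integral {-1..1} (\<lambda>y. w y * f (x + g y)) -
      (\<Sum>k<n. (deriv ^^ k) f x / fact k * integral {-1..1} (\<lambda>y. w y * g y ^ k))\<bar>
    \<le> 2 * W * (sup_norm ((deriv ^^ n) f) * Z ^ n)"
proof -
  have f0: "continuous_on S f" for S by (rule UCb_continuous_on[OF UCb_n_imp_UCb[OF f]])
  have cf: "continuous_on {-1..1} (\<lambda>y. f (x + g y))"
    by (rule continuous_on_compose2[OF f0[of UNIV]]) (auto intro: continuous_intros g)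
  let ?P = "\<lambda>y. \<Sum>k<n. (deriv ^^ k) f x / fact k * (w y * g y ^ k)"
  have i1: "(\<lambda>y. w y * f (x + g y)) integrable_on {-1..1}"
    by (intro integrable_continuous_interval continuous_on_mult w cf)
  have ik: "(\<lambda>y. w y * g y ^ k) integrable_on {-1..1}" for k
    by (intro integrable_continuous_interval continuous_on_mult continuous_on_power w g)
  have i2: "?P integrable_on {-1..1}"
    by (intro integrable_sum) (auto intro: integrable_on_mult_right ik)
  have IP: "integral {-1..1} ?P = (\<Sum>k<n. (deriv ^^ k) f x / fact k * integral {-1..1} (\<lambda>y. w y * g y ^ k))"
    by (subst integral_sum) (auto intro: integrable_on_mult_right ik simp: integral_mult_right)
  have W: "W \<ge> 0" using w(2)[of 0] by simp
  have "\<bar>integral {-1..1} (\<lambda>y. w y * f (x + g y) - ?P y)\<bar> \<le> (W * (sup_norm ((deriv ^^ n) f) * Z ^ n)) * (1 - (-1))"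
    unfolding real_norm_def[symmetric]
  proof (rule integral_bound)
    show "continuous_on {-1..1} (\<lambda>y. w y * f (x + g y) - ?P y)"
      by (intro continuous_intros w g cf)
    fix y :: real assume y: "y \<in> {-1..1}"
    have "w y * f (x + g y) - ?P y = w y * (f (x + g y) - (\<Sum>k<n. (deriv ^^ k) f x / fact k * g y ^ k))"
      by (simp add: right_diff_distrib sum_distrib_left mult_ac)
    also have "\<bar>\<dots>\<bar> \<le> W * (sup_norm ((deriv ^^ n) f) * \<bar>g y\<bar> ^ n)"
      unfolding abs_mult using w(2)[OF y] taylor_UCb[OF f n, of x "g y"] W by (intro mult_mono) auto
    also have "\<dots> \<le> W * (sup_norm ((deriv ^^ n) f) * Z ^ n)"
      using g(2)[OF y] W by (intro mult_left_mono power_mono) auto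
    finally show "norm (w y * f (x + g y) - ?P y) \<le> W * (sup_norm ((deriv ^^ n) f) * Z ^ n)" by simp
  qed simp
  then show ?thesis unfolding integral_diff[OF i1 i2] IP by (simp add: mult_ac)
qed

definition moment :: "nat \<Rightarrow> real" where
  "moment k = (if even k then 2 / real (Suc k) else 0)"

lemma has_integral_moment: "((\<lambda>y::real. y ^ k) has_integral moment k) {-1..1}"
proof -
  have "((\<lambda>y::real. y ^ k) has_integral (1 ^ Suc k / real (Suc k) - (-1) ^ Suc k / real (Suc k))) {-1..1}"
    by (rule fundamental_theorem_of_calculus)
       (auto intro!: derivative_eq_intros simp: has_real_derivative_iff_has_vector_derivative[symmetric] simp del: power_Suc)
  also have "1 ^ Suc k / real (Suc k) - (-1) ^ Suc k / real (Suc k) = moment k"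
    by (auto simp: moment_def)
  finally show ?thesis .
qed

lemma integral_polynomial: "integral {-1..1} (\<lambda>y. \<Sum>i\<in>I. p i * y ^ e i) = (\<Sum>i\<in>I. p i * moment (e i))"
  if "finite I" for p :: "'i \<Rightarrow> real"
  by (intro integral_unique has_integral_sum that has_integral_mult_right has_integral_moment)

lemma integral_binomial_power:
  "integral {-1..1} (\<lambda>y. (s * y + d) ^ k) = (\<Sum>j\<le>k. real (k choose j) * s ^ j * d ^ (k - j) * moment j)"
proof -
  have "(\<lambda>y. (s * y + d) ^ k) = (\<lambda>y. \<Sum>j\<le>k. (real (k choose j) * s ^ j * d ^ (k - j)) * y ^ j)"
    by (rule ext) (simp add: binomial_ring power_mult_distrib mult_ac)
  then show ?thesis by (simp only: integral_polynomial[OF finite_atMost])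
qed

lemma integral_affine_powers:
  fixes s d :: real
  shows "integral {-1..1} (\<lambda>y. (s * y + d) ^ 0) = 2"
    "integral {-1..1} (\<lambda>y. (s * y + d) ^ 1) = 2 * d"
    "integral {-1..1} (\<lambda>y. (s * y + d) ^ 2) = 2 * (s\<^sup>2 / 3 + d\<^sup>2)"
    "integral {-1..1} (\<lambda>y. (s * y + d) ^ 3) = 2 * (s\<^sup>2 * d + d ^ 3)"
    "integral {-1..1} (\<lambda>y. (s * y + d) ^ 4) = 2 * (s ^ 4 / 5 + 2 * s\<^sup>2 * d\<^sup>2 + d ^ 4)"
    "integral {-1..1} (\<lambda>y. (s * y + d) ^ 5) = 2 * (s ^ 4 * d + 10 / 3 * s\<^sup>2 * d ^ 3 + d ^ 5)"
proof -
  have m: "moment 0 = 2" "moment (Suc 0) = 0" "moment (Suc (Suc 0)) = 2 / 3" "moment (Suc (Suc (Suc 0))) = 0"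
    "moment (Suc (Suc (Suc (Suc 0)))) = 2 / 5" "moment (Suc (Suc (Suc (Suc (Suc 0))))) = 0"
    by (simp_all add: moment_def)
  show "integral {-1..1} (\<lambda>y. (s * y + d) ^ 0) = 2"
    "integral {-1..1} (\<lambda>y. (s * y + d) ^ 1) = 2 * d"
    "integral {-1..1} (\<lambda>y. (s * y + d) ^ 2) = 2 * (s\<^sup>2 / 3 + d\<^sup>2)"
    "integral {-1..1} (\<lambda>y. (s * y + d) ^ 3) = 2 * (s\<^sup>2 * d + d ^ 3)"
    "integral {-1..1} (\<lambda>y. (s * y + d) ^ 4) = 2 * (s ^ 4 / 5 + 2 * s\<^sup>2 * d\<^sup>2 + d ^ 4)"
    "integral {-1..1} (\<lambda>y. (s * y + d) ^ 5) = 2 * (s ^ 4 * d + 10 / 3 * s\<^sup>2 * d ^ 3 + d ^ 5)"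
    unfolding integral_binomial_power by (simp_all add: eval_nat_numeral m field_simps)
qed

lemma sum_0_6: "(\<Sum>j=0..6. F j) = F 0 + F 1 + F 2 + F 3 + F 4 + F 5 + F 6" for F :: "nat \<Rightarrow> real"
  by (simp add: eval_nat_numeral)

definition beta_moment :: "(real \<Rightarrow> real) \<Rightarrow> (real \<Rightarrow> real) \<Rightarrow> (real \<Rightarrow> real) \<Rightarrow> real \<Rightarrow> real \<Rightarrow> nat \<Rightarrow> real" where
  "beta_moment a b c t x k = integral {-1..1} (\<lambda>y. (\<Sum>j=0..6. beta a b c j t x * y ^ j) * y ^ k)"

lemma beta_moment_eq: "beta_moment a b c t x k = (\<Sum>j=0..6. beta a b c j t x * moment (j + k))"
proof -
  have "(\<lambda>y. (\<Sum>j=0..6. beta a b c j t x * y ^ j) * y ^ k) = (\<lambda>y. \<Sum>j=0..6. beta a b c j t x * y ^ (j + k))"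
    by (rule ext) (simp add: sum_distrib_right power_add mult.assoc)
  then show ?thesis unfolding beta_moment_def by (simp only: integral_polynomial[OF finite_atLeastAtMost])
qed

lemma beta_values:
  "beta a b c 0 t x = 1225 / 1024 * coefP a b c x * t ^ 2 - 11025 / 512 * coefR a b x * t powr (3 / 2)
        + 14553 / 64 * (a x)\<^sup>2 * t"
  "beta a b c 1 t x = 3675 / 256 * coefQ a b c x * t powr (7 / 4) - 19845 / 32 * a x * deriv a x * t powr (5 / 4)"
  "beta a b c 2 t x = - (11025 / 1024) * coefP a b c x * t ^ 2 + 178605 / 512 * coefR a b x * t powr (3 / 2)
        - 280665 / 64 * (a x)\<^sup>2 * t"
  "beta a b c 3 t x = - (6615 / 128) * coefQ a b c x * t powr (7 / 4) + 42525 / 16 * a x * deriv a x * t powr (5 / 4)"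
  "beta a b c 4 t x = 24255 / 1024 * coefP a b c x * t ^ 2 - 467775 / 512 * coefR a b x * t powr (3 / 2)
        + 800415 / 64 * (a x)\<^sup>2 * t"
  "beta a b c 5 t x = 10395 / 256 * coefQ a b c x * t powr (7 / 4) - 72765 / 32 * a x * deriv a x * t powr (5 / 4)"
  "beta a b c 6 t x = - (15015 / 1024) * coefP a b c x * t ^ 2 + 315315 / 512 * coefR a b x * t powr (3 / 2)
        - 567567 / 64 * (a x)\<^sup>2 * t"
  by (simp_all add: beta_def)

text \<open>Up to order six these moments supply the terms of \<open>f + t L f + t\<^sup>2 L\<^sup>2 f / 2\<close> that the first integral
  lacks; the seventh is the first one that contributes to the error.\<close>

lemma beta_moments:
  "beta_moment a b c t x 0 = coefP a b c x * t\<^sup>2 / 2"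
  "beta_moment a b c t x 1 = coefQ a b c x * t powr (7 / 4) / 2"
  "beta_moment a b c t x 2 = coefR a b x * t powr (3 / 2)"
  "beta_moment a b c t x 3 = 6 * a x * deriv a x * t powr (5 / 4)"
  "beta_moment a b c t x 4 = 24 / 5 * (a x)\<^sup>2 * t"
  "beta_moment a b c t x 5 = 0"
  "beta_moment a b c t x 6 = 0"
  "beta_moment a b c t x 7 = 35 / 858 * coefQ a b c x * t powr (7 / 4) - 630 / 143 * a x * deriv a x * t powr (5 / 4)"
  unfolding beta_moment_eq sum_0_6 beta_values by (simp_all add: moment_def algebra_simps)

lemma powr_quarter:
  fixes t :: real
  assumes "0 < t"
  shows "(t powr (1 / 4)) ^ 4 = t" "t powr (3 / 2) = (t powr (1 / 4)) ^ 6"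
    "t powr (7 / 4) = (t powr (1 / 4)) ^ 7" "t powr (5 / 4) = (t powr (1 / 4)) ^ 5"
  using assms by (simp_all add: powr_power)

text \<open>The coefficients of all remainders are polynomials in functions with this property.\<close>

definition unif_bdd :: "(real \<Rightarrow> real \<Rightarrow> real) \<Rightarrow> bool" where
  "unif_bdd F \<longleftrightarrow> (\<exists>K\<ge>0. \<forall>t x. 0 < t \<longrightarrow> t \<le> 1 \<longrightarrow> \<bar>F t x\<bar> \<le> K)"

lemma unif_bddI: "0 \<le> K \<Longrightarrow> (\<And>t x. 0 < t \<Longrightarrow> t \<le> 1 \<Longrightarrow> \<bar>F t x\<bar> \<le> K) \<Longrightarrow> unif_bdd F"
  by (auto simp: unif_bdd_def)

lemma unif_bddE:
  assumes "unif_bdd F" obtains K where "0 \<le> K" "\<And>t x. 0 < t \<Longrightarrow> t \<le> 1 \<Longrightarrow> \<bar>F t x\<bar> \<le> K"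
  using assms by (auto simp: unif_bdd_def)

lemma unif_bdd_const: "unif_bdd (\<lambda>t x. k)"
  by (rule unif_bddI[of "\<bar>k\<bar>"]) auto

lemma unif_bdd_t: "unif_bdd (\<lambda>t x. t)"
  by (rule unif_bddI[of 1]) auto

lemma unif_bdd_powr: "unif_bdd (\<lambda>t x. t powr (1 / 4))"
  by (rule unif_bddI[of 1]) (auto intro: powr_le1)

lemma unif_bdd_UCb: "f \<in> UCb \<Longrightarrow> unif_bdd (\<lambda>t. f)"
  by (rule unif_bddI[of "sup_norm f"]) (auto intro: abs_le_sup_norm)

lemma unif_bdd_add:
  assumes "unif_bdd F" "unif_bdd G" shows "unif_bdd (\<lambda>t x. F t x + G t x)"
proof -
  obtain K M where K: "0 \<le> K" "\<And>t x. 0 < t \<Longrightarrow> t \<le> 1 \<Longrightarrow> \<bar>F t x\<bar> \<le> K"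
    and M: "0 \<le> M" "\<And>t x. 0 < t \<Longrightarrow> t \<le> 1 \<Longrightarrow> \<bar>G t x\<bar> \<le> M"
    using assms unif_bddE by metis
  show ?thesis
  proof (rule unif_bddI[of "K + M"])
    fix t x :: real assume "0 < t" "t \<le> 1"
    from K(2)[OF this, of x] M(2)[OF this, of x] show "\<bar>F t x + G t x\<bar> \<le> K + M" by linarith
  qed (use K M in simp)
qed

lemma unif_bdd_mult:
  assumes "unif_bdd F" "unif_bdd G" shows "unif_bdd (\<lambda>t x. F t x * G t x)"
proof -
  obtain K M where "0 \<le> K" "\<And>t x. 0 < t \<Longrightarrow> t \<le> 1 \<Longrightarrow> \<bar>F t x\<bar> \<le> K"
    "0 \<le> M" "\<And>t x. 0 < t \<Longrightarrow> t \<le> 1 \<Longrightarrow> \<bar>G t x\<bar> \<le> M"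
    using assms unif_bddE by metis
  then show ?thesis
    by (intro unif_bddI[of "K * M"]) (auto simp: abs_mult intro: mult_mono)
qed

lemma unif_bdd_minus: "unif_bdd F \<Longrightarrow> unif_bdd (\<lambda>t x. - F t x)"
  by (auto simp: unif_bdd_def)

lemma unif_bdd_diff: "unif_bdd F \<Longrightarrow> unif_bdd G \<Longrightarrow> unif_bdd (\<lambda>t x. F t x - G t x)"
  using unif_bdd_add[OF _ unif_bdd_minus, of F G] by simp

lemma unif_bdd_power: "unif_bdd F \<Longrightarrow> unif_bdd (\<lambda>t x. F t x ^ n)"
  by (induction n) (auto intro: unif_bdd_const unif_bdd_mult)

lemma unif_bdd_abs: "unif_bdd F \<Longrightarrow> unif_bdd (\<lambda>t x. \<bar>F t x\<bar>)"
  by (auto simp: unif_bdd_def)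

lemmas unif_bdd_intros = unif_bdd_const unif_bdd_t unif_bdd_powr unif_bdd_add unif_bdd_mult
  unif_bdd_diff unif_bdd_minus unif_bdd_power unif_bdd_abs

text \<open>Quarter powers are written as powers of \<open>r\<close>, \<open>s\<close> is the factor of \<open>y\<close> in the first integral, and
  \<open>Dk\<close> stands for the \<open>k\<close>-th derivative of \<open>f\<close>. The left-hand side is what the moments leave of the two integrals, the
  last group on the right is the remainder of order \<open>t\<^sup>3\<close>. There is no \<open>D6\<close>: the first integral is expanded up to order
  five, and the sixth moment of the second one vanishes.\<close>

lemma order_3_identity:
  fixes r t s D0 D1 D2 D3 D4 D5 D7 a b c a' P Q R :: real
  assumes "t = r ^ 4" "s\<^sup>2 = 6 * a * t"
  shows "(1 + c * t) * (D0 + D1 * (b * t) + D2 / 2 * (s\<^sup>2 / 3 + (b * t)\<^sup>2) + D3 / 6 * (s\<^sup>2 * (b * t) + (b * t) ^ 3)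
      + D4 / 24 * (s ^ 4 / 5 + 2 * s\<^sup>2 * (b * t)\<^sup>2 + (b * t) ^ 4)
      + D5 / 120 * (s ^ 4 * (b * t) + 10 / 3 * s\<^sup>2 * (b * t) ^ 3 + (b * t) ^ 5))
    + (D0 * (P * t\<^sup>2 / 2) + D1 * (r * (Q * r ^ 7 / 2)) + D2 / 2 * (r\<^sup>2 * (R * r ^ 6))
      + D3 / 6 * (r ^ 3 * (6 * a * a' * r ^ 5)) + D4 / 24 * (r ^ 4 * (24 / 5 * a\<^sup>2 * t))
      + D7 / 5040 * (r ^ 7 * (35 / 858 * Q * r ^ 7 - 630 / 143 * a * a' * r ^ 5)))
    = D0 + t * (a * D2 + b * D1 + c * D0)
      + t\<^sup>2 / 2 * (a\<^sup>2 * D4 + (2 * a * a' + 2 * a * b) * D3 + (R + 2 * a * c + b\<^sup>2) * D2 + (Q + 2 * b * c) * D1 + P * D0)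
    + t ^ 3 * (D2 * (b\<^sup>2 * c / 2) + D3 * (b ^ 3 / 6 + a * b * c + b ^ 3 * c * t / 6)
      + D4 * (a * b\<^sup>2 / 2 + b ^ 4 * t / 24 + c * (3 / 10 * a\<^sup>2 + a * b\<^sup>2 * t / 2 + b ^ 4 * t\<^sup>2 / 24))
      + D5 * ((1 + c * t) * (36 * a\<^sup>2 * b + 20 * a * b ^ 3 * t + b ^ 5 * t\<^sup>2) / 120)
      + D7 * ((35 / 858 * Q * r\<^sup>2 - 630 / 143 * a * a') / 5040))"
proof -
  have "s ^ 4 = (s\<^sup>2)\<^sup>2" by simp
  then have s4: "s ^ 4 = 36 * a\<^sup>2 * t\<^sup>2" unfolding assms(2) by (simp add: power_mult_distrib)
  show ?thesis unfolding s4 assms(2) unfolding assms(1)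
    by (simp add: field_simps eval_nat_numeral)
qed

locale chernoff_coefficients =
  fixes a b c :: "real \<Rightarrow> real"
  assumes abc_UCb2: "a \<in> UCb_n 2" "b \<in> UCb_n 2" "c \<in> UCb_n 2" and a_nonneg: "\<And>x. 0 \<le> a x"
begin

lemma bdd_coefs [intro]:
  "unif_bdd (\<lambda>t. a)" "unif_bdd (\<lambda>t. b)" "unif_bdd (\<lambda>t. c)" "unif_bdd (\<lambda>t. deriv a)"
  "unif_bdd (\<lambda>t. deriv b)" "unif_bdd (\<lambda>t. deriv c)"
  "unif_bdd (\<lambda>t. (deriv ^^ 2) a)" "unif_bdd (\<lambda>t. (deriv ^^ 2) b)" "unif_bdd (\<lambda>t. (deriv ^^ 2) c)"
  by (intro unif_bdd_UCb; use abc_UCb2 in \<open>simp add: numeral_2_eq_2 UCb_n_Suc UCb_n_0 UCb_n_imp_UCb\<close>)+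

lemma bdd_PQR: "unif_bdd (\<lambda>t. coefP a b c)" "unif_bdd (\<lambda>t. coefQ a b c)" "unif_bdd (\<lambda>t. coefR a b)"
  unfolding coefP_def[abs_def] coefQ_def[abs_def] coefR_def[abs_def]
  by (intro unif_bdd_intros bdd_coefs)+

text \<open>Every power of \<open>t\<close> in the coefficients is at least the first.\<close>

lemma beta_bound:
  obtains K where "K \<ge> 0" "\<And>t x y. 0 < t \<Longrightarrow> t \<le> 1 \<Longrightarrow> y \<in> {-1..1} \<Longrightarrow>
    \<bar>\<Sum>j=0..6. beta a b c j t x * y ^ j\<bar> \<le> K * t"
proof -
  have p: "unif_bdd (\<lambda>t x. t powr p / t)" if "p \<ge> 1" for p
  proof (rule unif_bddI[of 1])
    fix t :: real assume t: "0 < t" "t \<le> 1"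
    have "t powr p \<le> t powr 1" using t that by (intro powr_mono') auto
    then show "\<bar>t powr p / t\<bar> \<le> 1" using t by simp
  qed simp
  have p': "unif_bdd (\<lambda>t x. t powr (3 / 2) / t)" "unif_bdd (\<lambda>t x. t powr (7 / 4) / t)"
    "unif_bdd (\<lambda>t x. t powr (5 / 4) / t)"
    by (intro p; simp)+
  have q: "unif_bdd (\<lambda>t x. t\<^sup>2 / t)" "unif_bdd (\<lambda>t x. t / t)"
    by (rule unif_bddI[of 1]; simp add: power2_eq_square)+
  define G where "G t x = \<bar>beta a b c 0 t x / t\<bar> + \<bar>beta a b c 1 t x / t\<bar> + \<bar>beta a b c 2 t x / t\<bar> + \<bar>beta a b c 3 t x / t\<bar>
     + \<bar>beta a b c 4 t x / t\<bar> + \<bar>beta a b c 5 t x / t\<bar> + \<bar>beta a b c 6 t x / t\<bar>" for t x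
  have "unif_bdd G"
    unfolding G_def[abs_def] beta_values add_divide_distrib diff_divide_distrib
    unfolding times_divide_eq_right[symmetric]
    by (intro unif_bdd_intros p' q bdd_PQR bdd_coefs)
  then obtain K where K: "0 \<le> K" "\<And>t x. 0 < t \<Longrightarrow> t \<le> 1 \<Longrightarrow> \<bar>G t x\<bar> \<le> K"
    by (rule unif_bddE) blast
  show ?thesis
  proof (rule that[OF K(1)])
    fix t x y :: real assume t: "0 < t" "t \<le> 1" and y: "y \<in> {-1..1}"
    have "\<bar>\<Sum>j=0..6. beta a b c j t x * y ^ j\<bar> \<le> (\<Sum>j=0..6. \<bar>beta a b c j t x\<bar>)"
    proof (rule order_trans[OF sum_abs sum_mono])
      fix j :: nat
      have "\<bar>y ^ j\<bar> \<le> 1" using y by (simp add: power_abs power_le_one abs_le_iff)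
      then show "\<bar>beta a b c j t x * y ^ j\<bar> \<le> \<bar>beta a b c j t x\<bar>"
        unfolding abs_mult by (rule mult_left_le) simp
    qed
    also have "\<dots> = t * G t x"
      unfolding sum_0_6 G_def using t by (simp add: distrib_left)
    also have "\<dots> \<le> t * K" using K(2)[OF t, of x] t by simp
    finally show "\<bar>\<Sum>j=0..6. beta a b c j t x * y ^ j\<bar> \<le> K * t" by (simp add: mult.commute)
  qed
qed

definition diffusion_part :: "real \<Rightarrow> (real \<Rightarrow> real) \<Rightarrow> real \<Rightarrow> real" where
  "diffusion_part t f x = integral {-1..1} (\<lambda>y. 1 / 2 * (1 + c x * t) * f (x + (sqrt (6 * a x * t) * y + b x * t)))"

definition correction_part :: "real \<Rightarrow> (real \<Rightarrow> real) \<Rightarrow> real \<Rightarrow> real" where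
  "correction_part t f x = integral {-1..1} (\<lambda>y. (\<Sum>j=0..6. beta a b c j t x * y ^ j) * f (x + y * t powr (1 / 4)))"

lemma chernoff_split: "chernoff_expr a b c t f x = diffusion_part t f x + correction_part t f x"
  by (simp add: chernoff_expr_def diffusion_part_def correction_part_def add.assoc)

lemma continuous_on_beta_sum: "continuous_on S (\<lambda>y. \<Sum>j=0..6. beta a b c j t x * y ^ j)"
  by (intro continuous_intros)

lemma abc_UCb: "a \<in> UCb" "b \<in> UCb" "c \<in> UCb"
  using abc_UCb2 by (auto intro: UCb_n_imp_UCb)

lemma sqrt_eq_quarter: "0 < (t::real) \<Longrightarrow> sqrt t = (t powr (1 / 4))\<^sup>2"
  by (simp add: powr_power powr_half_sqrt)

lemma quarter_le_1: "0 < t \<Longrightarrow> t \<le> 1 \<Longrightarrow> t powr (1 / 4) \<le> (1::real)"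
  by (rule powr_le1) auto

text \<open>The displacement is \<open>O (sqrt t)\<close>; in terms of \<open>t\<^bsup>1/4\<^esup>\<close> the remainder of order \<open>n\<close> has the exponent \<open>2 n\<close>.\<close>

lemma diffusion_taylor:
  assumes n: "n > 0"
  obtains K where "K \<ge> 0" "\<And>f t x. f \<in> UCb_n n \<Longrightarrow> 0 < t \<Longrightarrow> t \<le> 1 \<Longrightarrow>
    \<bar>diffusion_part t f x - (1 + c x * t) / 2 *
      (\<Sum>k<n. (deriv ^^ k) f x / fact k * integral {-1..1} (\<lambda>y. (sqrt (6 * a x * t) * y + b x * t) ^ k))\<bar>
    \<le> K * sup_norm ((deriv ^^ n) f) * (t powr (1 / 4)) ^ (2 * n)"
proof -
  define M where "M = sqrt (6 * sup_norm a) + sup_norm b"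
  define W where "W = (1 + sup_norm c) / 2"
  have M: "M \<ge> 0" and W: "W \<ge> 0" by (simp_all add: M_def W_def add_nonneg_nonneg)
  show ?thesis
  proof (rule that[of "2 * W * M ^ n"])
    show "0 \<le> 2 * W * M ^ n" using M W by simp
    fix f t x assume f: "f \<in> UCb_n n" and t: "0 < t" "t \<le> (1::real)"
    define w where "w = 1 / 2 * (1 + c x * t)"
    define g where "g y = sqrt (6 * a x * t) * y + b x * t" for y
    have ct: "\<bar>c x * t\<bar> \<le> sup_norm c * 1"
      unfolding abs_mult using t by (intro mult_mono abs_le_sup_norm abc_UCb) auto
    have "\<bar>1 + c x * t\<bar> \<le> 1 + sup_norm c" using ct by linarith
    then have wW: "\<bar>w\<bar> \<le> W" unfolding w_def W_def by (simp add: abs_mult)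
    have "t * t \<le> 1 * t" using t by (intro mult_right_mono) auto
    then have tt: "t \<le> sqrt t" by (intro real_le_rsqrt) (simp add: power2_eq_square)
    have gM: "\<bar>g y\<bar> \<le> M * sqrt t" if y: "y \<in> {-1..1}" for y
    proof -
      have "\<bar>sqrt (6 * a x * t) * y\<bar> \<le> sqrt (6 * sup_norm a * t) * 1"
        unfolding abs_mult using y t a_nonneg[of x] abs_le_sup_norm[OF abc_UCb(1), of x]
        by (intro mult_mono) (auto simp: abs_le_iff intro!: mult_right_mono)
      also have "\<dots> = sqrt (6 * sup_norm a) * sqrt t" by (simp add: real_sqrt_mult)
      finally have 1: "\<bar>sqrt (6 * a x * t) * y\<bar> \<le> sqrt (6 * sup_norm a) * sqrt t" .
      have "\<bar>b x * t\<bar> \<le> sup_norm b * sqrt t"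
        unfolding abs_mult using t tt by (intro mult_mono abs_le_sup_norm abc_UCb) auto
      with 1 show ?thesis unfolding g_def M_def distrib_right by linarith
    qed
    have cg: "continuous_on {-1..1} g" unfolding g_def by (intro continuous_intros)
    have "\<bar>integral {-1..1} (\<lambda>y. w * f (x + g y)) -
      (\<Sum>k<n. (deriv ^^ k) f x / fact k * integral {-1..1} (\<lambda>y. w * g y ^ k))\<bar>
      \<le> 2 * W * (sup_norm ((deriv ^^ n) f) * (M * sqrt t) ^ n)"
      by (rule taylor_integral[OF f n continuous_on_const wW cg gM])
    also have "(M * sqrt t) ^ n = M ^ n * (t powr (1 / 4)) ^ (2 * n)"
      by (simp add: sqrt_eq_quarter[OF t(1)] power_mult_distrib power_mult)
    also have "integral {-1..1} (\<lambda>y. w * f (x + g y)) = diffusion_part t f x"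
      by (simp add: diffusion_part_def w_def g_def)
    also have "(\<Sum>k<n. (deriv ^^ k) f x / fact k * integral {-1..1} (\<lambda>y. w * g y ^ k))
       = (1 + c x * t) / 2 * (\<Sum>k<n. (deriv ^^ k) f x / fact k * integral {-1..1} (\<lambda>y. (sqrt (6 * a x * t) * y + b x * t) ^ k))"
    proof -
      have w2: "(1 + c x * t) / 2 = w" by (simp add: w_def)
      show ?thesis
        unfolding w2 sum_distrib_left integral_mult_right by (rule sum.cong) (simp_all only: g_def mult_ac)
    qed
    finally show "\<bar>diffusion_part t f x - (1 + c x * t) / 2 *
      (\<Sum>k<n. (deriv ^^ k) f x / fact k * integral {-1..1} (\<lambda>y. (sqrt (6 * a x * t) * y + b x * t) ^ k))\<bar>
      \<le> 2 * W * M ^ n * sup_norm ((deriv ^^ n) f) * (t powr (1 / 4)) ^ (2 * n)"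
      by (simp add: mult_ac)
  qed
qed

lemma correction_taylor:
  assumes n: "n > 0"
  obtains K where "K \<ge> 0" "\<And>f t x. f \<in> UCb_n n \<Longrightarrow> 0 < t \<Longrightarrow> t \<le> 1 \<Longrightarrow>
    \<bar>correction_part t f x - (\<Sum>k<n. (deriv ^^ k) f x / fact k * ((t powr (1 / 4)) ^ k * beta_moment a b c t x k))\<bar>
    \<le> K * sup_norm ((deriv ^^ n) f) * (t * (t powr (1 / 4)) ^ n)"
proof -
  obtain K where K: "K \<ge> 0" "\<And>t x y. 0 < t \<Longrightarrow> t \<le> 1 \<Longrightarrow> y \<in> {-1..1} \<Longrightarrow>
    \<bar>\<Sum>j=0..6. beta a b c j t x * y ^ j\<bar> \<le> K * t" by (rule beta_bound) blast
  show ?thesis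
  proof (rule that[of "2 * K"])
    show "0 \<le> 2 * K" using K by simp
    fix f t x assume f: "f \<in> UCb_n n" and t: "0 < t" "t \<le> (1::real)"
    define r where "r = t powr (1 / 4)"
    have r: "r > 0" using t by (simp add: r_def)
    define q where "q y = (\<Sum>j=0..6. beta a b c j t x * y ^ j)" for y
    have cq: "continuous_on {-1..1} q" unfolding q_def by (rule continuous_on_beta_sum)
    have cg: "continuous_on {-1..1} (\<lambda>y. y * r)" by (intro continuous_intros)
    have gr: "\<bar>y * r\<bar> \<le> r" if "y \<in> {-1..1}" for y
      using that r by (simp add: abs_mult abs_le_iff)
    have "\<bar>integral {-1..1} (\<lambda>y. q y * f (x + y * r)) -
      (\<Sum>k<n. (deriv ^^ k) f x / fact k * integral {-1..1} (\<lambda>y. q y * (y * r) ^ k))\<bar>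
      \<le> 2 * (K * t) * (sup_norm ((deriv ^^ n) f) * r ^ n)"
      by (rule taylor_integral[OF f n cq _ cg gr]) (use K(2)[OF t] in \<open>simp add: q_def\<close>)
    also have "integral {-1..1} (\<lambda>y. q y * f (x + y * r)) = correction_part t f x"
      by (simp add: correction_part_def q_def r_def)
    also have "(\<Sum>k<n. (deriv ^^ k) f x / fact k * integral {-1..1} (\<lambda>y. q y * (y * r) ^ k))
       = (\<Sum>k<n. (deriv ^^ k) f x / fact k * (r ^ k * beta_moment a b c t x k))"
    proof (rule sum.cong[OF refl])
      fix k
      have "(\<lambda>y. q y * (y * r) ^ k) = (\<lambda>y. r ^ k * (q y * y ^ k))"
        by (simp add: power_mult_distrib mult_ac)
      then show "(deriv ^^ k) f x / fact k * integral {-1..1} (\<lambda>y. q y * (y * r) ^ k)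
        = (deriv ^^ k) f x / fact k * (r ^ k * beta_moment a b c t x k)"
        by (simp only: integral_mult_right beta_moment_def q_def)
    qed
    finally show "\<bar>correction_part t f x - (\<Sum>k<n. (deriv ^^ k) f x / fact k * ((t powr (1 / 4)) ^ k * beta_moment a b c t x k))\<bar>
    \<le> 2 * K * sup_norm ((deriv ^^ n) f) * (t * (t powr (1 / 4)) ^ n)"
      by (simp add: r_def mult_ac)
  qed
qed

lemma chernoff_diff:
  assumes "f \<in> UCb" "g \<in> UCb"
  shows "chernoff_expr a b c t (\<lambda>x. f x - g x) x = chernoff_expr a b c t f x - chernoff_expr a b c t g x"
proof -
  have i: "(\<lambda>y. w y * h (u y)) integrable_on {-1..1}"
    if "h \<in> UCb" "continuous_on {-1..1} w" "continuous_on {-1..1} u" for h and w u :: "real \<Rightarrow> real"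
    by (intro integrable_continuous_interval continuous_on_mult that
        continuous_on_compose2[OF UCb_continuous_on[OF that(1), of UNIV]]) auto
  have 1: "integral {-1..1} (\<lambda>y. w y * (f (u y) - g (u y))) =
      integral {-1..1} (\<lambda>y. w y * f (u y)) - integral {-1..1} (\<lambda>y. w y * g (u y))"
    if "continuous_on {-1..1} w" "continuous_on {-1..1} u" for w u :: "real \<Rightarrow> real"
    unfolding right_diff_distrib by (rule integral_diff[OF i[OF assms(1) that] i[OF assms(2) that]])
  have w: "continuous_on {-1..1} (\<lambda>y::real. 1 / 2 * (1 + c x * t))"
    "continuous_on {-1..1} (\<lambda>y. x + sqrt (6 * a x * t) * y + b x * t)"
    "continuous_on {-1..1} (\<lambda>y. x + y * t powr (1 / 4))"
    by (intro continuous_intros)+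
  show ?thesis unfolding chernoff_expr_def
    by (simp only: 1[OF w(1,2)] 1[OF continuous_on_beta_sum w(3)])
qed

text \<open>The first integral is \<open>1 + c t\<close> times an average of \<open>f\<close>, the second one has a weight of size \<open>O (t)\<close>.\<close>

lemma chernoff_bounded:
  obtains K where "K \<ge> 0" "\<And>f t x. f \<in> UCb \<Longrightarrow> 0 < t \<Longrightarrow> t \<le> 1 \<Longrightarrow>
    \<bar>chernoff_expr a b c t f x\<bar> \<le> (1 + K * t) * sup_norm f"
proof -
  obtain K where K: "K \<ge> 0" "\<And>t x y. 0 < t \<Longrightarrow> t \<le> 1 \<Longrightarrow> y \<in> {-1..1} \<Longrightarrow>
    \<bar>\<Sum>j=0..6. beta a b c j t x * y ^ j\<bar> \<le> K * t" by (rule beta_bound) blast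
  show ?thesis
  proof (rule that[of "sup_norm c + 2 * K"])
    show "0 \<le> sup_norm c + 2 * K" using K by (simp add: add_nonneg_nonneg)
    fix f t x assume f: "f \<in> UCb" and t: "0 < t" "t \<le> (1::real)"
    have bnd: "\<bar>integral {-1..1} (\<lambda>y. w y * f (u y))\<bar> \<le> (W * sup_norm f) * (1 - (-1))"
      if "continuous_on {-1..1} w" "continuous_on {-1..1} u" "\<And>y. y \<in> {-1..1} \<Longrightarrow> \<bar>w y\<bar> \<le> W"
      for w u :: "real \<Rightarrow> real" and W
      unfolding real_norm_def[symmetric]
    proof (rule integral_bound)
      show "continuous_on {-1..1} (\<lambda>y. w y * f (u y))"
        by (intro continuous_on_mult that continuous_on_compose2[OF UCb_continuous_on[OF f, of UNIV]]) auto
      show "norm (w y * f (u y)) \<le> W * sup_norm f" if "y \<in> {-1..1}" for y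
        using \<open>\<And>y. y \<in> {-1..1} \<Longrightarrow> \<bar>w y\<bar> \<le> W\<close>[OF that] abs_le_sup_norm[OF f, of "u y"]
        unfolding real_norm_def abs_mult by (intro mult_mono) auto
    qed simp
    have "\<bar>c x * t\<bar> \<le> sup_norm c * t"
      unfolding abs_mult using t by (intro mult_mono abs_le_sup_norm abc_UCb) auto
    then have "\<bar>1 + c x * t\<bar> \<le> 1 + sup_norm c * t" by linarith
    then have w: "\<bar>1 / 2 * (1 + c x * t)\<bar> \<le> (1 + sup_norm c * t) / 2" by (simp add: abs_mult)
    have "\<bar>diffusion_part t f x\<bar> \<le> ((1 + sup_norm c * t) / 2 * sup_norm f) * (1 - (-1))"
      unfolding diffusion_part_def by (rule bnd[OF _ _ w]) (intro continuous_intros)+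
    moreover have "\<bar>correction_part t f x\<bar> \<le> ((K * t) * sup_norm f) * (1 - (-1))"
      unfolding correction_part_def by (rule bnd[OF continuous_on_beta_sum _ K(2)[OF t]]) (intro continuous_intros)+
    ultimately have "\<bar>chernoff_expr a b c t f x\<bar> \<le> (1 + sup_norm c * t) * sup_norm f + 2 * (K * t) * sup_norm f"
      unfolding chernoff_split by (simp add: algebra_simps)
    then show "\<bar>chernoff_expr a b c t f x\<bar> \<le> (1 + (sup_norm c + 2 * K) * t) * sup_norm f"
      by (simp add: algebra_simps)
  qed
qed

lemma sum_lessThan_3: "(\<Sum>k<3. F k) = F 0 + F 1 + F (2::nat)" for F :: "nat \<Rightarrow> real"
  by (simp add: eval_nat_numeral)

lemma sum_lessThan_6: "(\<Sum>k<6. F k) = F 0 + F 1 + F 2 + F 3 + F 4 + F (5::nat)" for F :: "nat \<Rightarrow> real"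
  by (simp add: eval_nat_numeral)

lemma sum_lessThan_8: "(\<Sum>k<8. F k) = F 0 + F 1 + F 2 + F 3 + F 4 + F 5 + F 6 + F (7::nat)" for F :: "nat \<Rightarrow> real"
  by (simp add: eval_nat_numeral)

lemma diff_expr_twice:
  assumes f: "f \<in> UCb_n 4"
  shows "diff_expr a b c (diff_expr a b c f) x =
    (a x)\<^sup>2 * (deriv ^^ 4) f x + (2 * a x * deriv a x + 2 * a x * b x) * (deriv ^^ 3) f x
    + (coefR a b x + 2 * a x * c x + (b x)\<^sup>2) * (deriv ^^ 2) f x
    + (coefQ a b c x + 2 * b x * c x) * deriv f x + coefP a b c x * f x"
proof -
  have D: "(f has_real_derivative deriv f x) (at x)"
    "(deriv f has_real_derivative (deriv ^^ 2) f x) (at x)"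
    "((deriv ^^ 2) f has_real_derivative (deriv ^^ 3) f x) (at x)"
    "((deriv ^^ 3) f has_real_derivative (deriv ^^ 4) f x) (at x)" for x
    using UCb_n_DERIV[OF f, of 0] UCb_n_DERIV[OF f, of 1] UCb_n_DERIV[OF f, of 2] UCb_n_DERIV[OF f, of 3]
    by (simp_all add: eval_nat_numeral)
  have Dg: "(g has_real_derivative deriv g x) (at x)" "(deriv g has_real_derivative (deriv ^^ 2) g x) (at x)"
    if "g \<in> UCb_n 2" for g x
    using UCb_n_DERIV[OF that, of 0] UCb_n_DERIV[OF that, of 1] by (simp_all add: eval_nat_numeral)
  note Dabc = Dg[OF abc_UCb2(1)] Dg[OF abc_UCb2(2)] Dg[OF abc_UCb2(3)]
  have 1: "deriv (diff_expr a b c f) = (\<lambda>x. deriv a x * (deriv ^^ 2) f x + a x * (deriv ^^ 3) f x + deriv b x * deriv f x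
      + b x * (deriv ^^ 2) f x + deriv c x * f x + c x * deriv f x)"
    unfolding diff_expr_def[abs_def]
    by (rule ext, rule DERIV_imp_deriv) (auto intro!: derivative_eq_intros D Dabc)
  have 2: "deriv (deriv (diff_expr a b c f)) x = (deriv ^^ 2) a x * (deriv ^^ 2) f x + 2 * deriv a x * (deriv ^^ 3) f x + a x * (deriv ^^ 4) f x
      + (deriv ^^ 2) b x * deriv f x + 2 * deriv b x * (deriv ^^ 2) f x + b x * (deriv ^^ 3) f x
      + (deriv ^^ 2) c x * f x + 2 * deriv c x * deriv f x + c x * (deriv ^^ 2) f x" for x
    unfolding 1 by (rule DERIV_imp_deriv) (auto intro!: derivative_eq_intros D Dabc simp: algebra_simps)
  show ?thesis
    unfolding diff_expr_def[of a b c "diff_expr a b c f"] deriv_2_eq[of "diff_expr a b c f"] 2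
    unfolding 1 unfolding diff_expr_def coefP_def coefQ_def coefR_def by (simp add: algebra_simps power2_eq_square)
qed

text \<open>The first integral is expanded to order six, as its displacement is \<open>O (t\<^bsup>1/2\<^esup>)\<close>. The second one needs order eight: its
  displacement is \<open>O (t\<^bsup>1/4\<^esup>)\<close> and its weight \<open>O (t)\<close>.\<close>

lemma chernoff_order_3:
  obtains K where "K \<ge> 0" "\<And>f t x. f \<in> UCb_n 8 \<Longrightarrow> 0 < t \<Longrightarrow> t \<le> 1 \<Longrightarrow>
    \<bar>chernoff_expr a b c t f x - (f x + t * diff_expr a b c f x + t\<^sup>2 / 2 * diff_expr a b c (diff_expr a b c f) x)\<bar>
    \<le> K * t ^ 3 * Ck_norm 8 f"
proof -
  define r where "r t = t powr (1 / 4)" for t :: real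
  define Q where "Q = coefQ a b c"
  define C2 where "C2 x = (b x)\<^sup>2 * c x / 2" for x
  define C3 where "C3 t x = b x ^ 3 / 6 + a x * b x * c x + b x ^ 3 * c x * t / 6" for t x
  define C4 where "C4 t x = a x * (b x)\<^sup>2 / 2 + b x ^ 4 * t / 24
    + c x * (3 / 10 * (a x)\<^sup>2 + a x * (b x)\<^sup>2 * t / 2 + b x ^ 4 * t\<^sup>2 / 24)" for t x
  define C5 where "C5 t x = (1 + c x * t) * (36 * (a x)\<^sup>2 * b x + 20 * a x * b x ^ 3 * t + b x ^ 5 * t\<^sup>2) / 120" for t x
  define C7 where "C7 t x = (35 / 858 * Q x * (r t)\<^sup>2 - 630 / 143 * a x * deriv a x) / 5040" for t x
  have br: "unif_bdd (\<lambda>t x. r t)" unfolding r_def by (rule unif_bdd_powr)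
  have "unif_bdd (\<lambda>t x. \<bar>C2 x\<bar> + \<bar>C3 t x\<bar> + \<bar>C4 t x\<bar> + \<bar>C5 t x\<bar> + \<bar>C7 t x\<bar>)"
    unfolding C2_def C3_def C4_def C5_def C7_def Q_def divide_inverse
    by (intro unif_bdd_intros br bdd_coefs bdd_PQR)
  then obtain K0 where K0: "K0 \<ge> 0" "\<And>t x. 0 < t \<Longrightarrow> t \<le> 1 \<Longrightarrow>
      \<bar>\<bar>C2 x\<bar> + \<bar>C3 t x\<bar> + \<bar>C4 t x\<bar> + \<bar>C5 t x\<bar> + \<bar>C7 t x\<bar>\<bar> \<le> K0"
    by (rule unif_bddE) blast
  obtain K1 where K1: "K1 \<ge> 0" "\<And>f t x. f \<in> UCb_n 6 \<Longrightarrow> 0 < t \<Longrightarrow> t \<le> 1 \<Longrightarrow>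
    \<bar>diffusion_part t f x - (1 + c x * t) / 2 *
      (\<Sum>k<6. (deriv ^^ k) f x / fact k * integral {-1..1} (\<lambda>y. (sqrt (6 * a x * t) * y + b x * t) ^ k))\<bar>
    \<le> K1 * sup_norm ((deriv ^^ 6) f) * (t powr (1 / 4)) ^ (2 * 6)"
    by (rule diffusion_taylor[of 6]) auto
  obtain K2 where K2: "K2 \<ge> 0" "\<And>f t x. f \<in> UCb_n 8 \<Longrightarrow> 0 < t \<Longrightarrow> t \<le> 1 \<Longrightarrow>
    \<bar>correction_part t f x - (\<Sum>k<8. (deriv ^^ k) f x / fact k * ((t powr (1 / 4)) ^ k * beta_moment a b c t x k))\<bar>
    \<le> K2 * sup_norm ((deriv ^^ 8) f) * (t * (t powr (1 / 4)) ^ 8)"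
    by (rule correction_taylor[of 8]) auto
  show ?thesis
  proof (rule that[of "K1 + K2 + K0"])
    show "K1 + K2 + K0 \<ge> 0" using K0 K1 K2 by simp
    fix f t x assume f: "f \<in> UCb_n 8" and t: "0 < t" "t \<le> (1::real)"
    let ?N = "Ck_norm 8 f"
    define D where "D k = (deriv ^^ k) f x" for k
    have DN: "\<bar>D k\<bar> \<le> ?N" if "k \<le> 8" for k
      unfolding D_def by (rule abs_deriv_le_Ck_norm[OF f that])
    have f6: "f \<in> UCb_n 6" and f4: "f \<in> UCb_n 4" using f UCb_n_mono[of 6 8] UCb_n_mono[of 4 8] by auto
    note q = powr_quarter[OF t(1), folded r_def]
    have r: "r t > 0" using t by (simp add: r_def)
    have r12: "r t ^ 12 = t ^ 3" "t * r t ^ 8 = t ^ 3"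
    proof -
      have "r t ^ 12 = (r t ^ 4) ^ 3" by (simp flip: power_mult)
      then show "r t ^ 12 = t ^ 3" using q(1) by simp
      have "r t ^ 8 = (r t ^ 4) ^ 2" by (simp flip: power_mult)
      then show "t * r t ^ 8 = t ^ 3" using q(1) by (simp add: power2_eq_square power3_eq_cube)
    qed
    define E1 where "E1 = (1 + c x * t) * (D 0 + D 1 * (b x * t) + D 2 / 2 * ((sqrt (6 * a x * t))\<^sup>2 / 3 + (b x * t)\<^sup>2)
      + D 3 / 6 * ((sqrt (6 * a x * t))\<^sup>2 * (b x * t) + (b x * t) ^ 3)
      + D 4 / 24 * ((sqrt (6 * a x * t)) ^ 4 / 5 + 2 * (sqrt (6 * a x * t))\<^sup>2 * (b x * t)\<^sup>2 + (b x * t) ^ 4)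
      + D 5 / 120 * ((sqrt (6 * a x * t)) ^ 4 * (b x * t) + 10 / 3 * (sqrt (6 * a x * t))\<^sup>2 * (b x * t) ^ 3 + (b x * t) ^ 5))"
    define E2 where "E2 = D 0 * (coefP a b c x * t\<^sup>2 / 2) + D 1 * (r t * (Q x * r t ^ 7 / 2)) + D 2 / 2 * ((r t)\<^sup>2 * (coefR a b x * r t ^ 6))
      + D 3 / 6 * (r t ^ 3 * (6 * a x * deriv a x * r t ^ 5)) + D 4 / 24 * (r t ^ 4 * (24 / 5 * (a x)\<^sup>2 * t))
      + D 7 / 5040 * (r t ^ 7 * (35 / 858 * Q x * r t ^ 7 - 630 / 143 * a x * deriv a x * r t ^ 5))"
    define Rem where "Rem = D 2 * C2 x + D 3 * C3 t x + D 4 * C4 t x + D 5 * C5 t x + D 7 * C7 t x"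
    have fct: "fact 2 = (2::real)" "fact 3 = (6::real)" "fact 4 = (24::real)" "fact 5 = (120::real)"
      "fact 6 = (720::real)" "fact 7 = (5040::real)" by (simp_all add: eval_nat_numeral)
    have e1: "(1 + c x * t) / 2 *
      (\<Sum>k<6. (deriv ^^ k) f x / fact k * integral {-1..1} (\<lambda>y. (sqrt (6 * a x * t) * y + b x * t) ^ k)) = E1"
      unfolding sum_lessThan_6 integral_affine_powers E1_def D_def[symmetric] fct fact_0 fact_1
      by (simp only: div_by_1) (simp add: field_simps)
    have e2: "(\<Sum>k<8. (deriv ^^ k) f x / fact k * ((t powr (1 / 4)) ^ k * beta_moment a b c t x k)) = E2"
      unfolding sum_lessThan_8 beta_moments E2_def D_def[symmetric] fct fact_0 fact_1 r_def[symmetric] q(2-4) Q_def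
      by simp
    have st: "(sqrt (6 * a x * t))\<^sup>2 = 6 * a x * t" using t a_nonneg[of x] by simp
    have "E1 + E2 = D 0 + t * (a x * D 2 + b x * D 1 + c x * D 0)
      + t\<^sup>2 / 2 * ((a x)\<^sup>2 * D 4 + (2 * a x * deriv a x + 2 * a x * b x) * D 3 + (coefR a b x + 2 * a x * c x + (b x)\<^sup>2) * D 2
      + (Q x + 2 * b x * c x) * D 1 + coefP a b c x * D 0)
      + t ^ 3 * Rem"
      unfolding E1_def E2_def Rem_def C2_def C3_def C4_def C5_def C7_def
      by (rule order_3_identity[OF q(1)[symmetric] st])
    also have "\<dots> = f x + t * diff_expr a b c f x + t\<^sup>2 / 2 * diff_expr a b c (diff_expr a b c f) x + t ^ 3 * Rem"
      unfolding diff_expr_twice[OF f4] unfolding D_def Q_def diff_expr_def by simp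
    finally have main: "E1 + E2 = f x + t * diff_expr a b c f x + t\<^sup>2 / 2 * diff_expr a b c (diff_expr a b c f) x + t ^ 3 * Rem" .
    have "\<bar>Rem\<bar> \<le> \<bar>D 2\<bar> * \<bar>C2 x\<bar> + \<bar>D 3\<bar> * \<bar>C3 t x\<bar> + \<bar>D 4\<bar> * \<bar>C4 t x\<bar> + \<bar>D 5\<bar> * \<bar>C5 t x\<bar> + \<bar>D 7\<bar> * \<bar>C7 t x\<bar>"
      unfolding Rem_def abs_mult[symmetric] by linarith
    also have "\<dots> \<le> ?N * \<bar>C2 x\<bar> + ?N * \<bar>C3 t x\<bar> + ?N * \<bar>C4 t x\<bar> + ?N * \<bar>C5 t x\<bar> + ?N * \<bar>C7 t x\<bar>"
      by (intro add_mono mult_right_mono DN) auto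
    also have "\<dots> = ?N * (\<bar>C2 x\<bar> + \<bar>C3 t x\<bar> + \<bar>C4 t x\<bar> + \<bar>C5 t x\<bar> + \<bar>C7 t x\<bar>)"
      by (simp add: distrib_left)
    also have "\<dots> \<le> ?N * K0" using K0(2)[OF t, of x] by (intro mult_left_mono) auto
    finally have "t ^ 3 * \<bar>Rem\<bar> \<le> t ^ 3 * (?N * K0)" using t by (intro mult_left_mono) auto
    then have b0: "\<bar>t ^ 3 * Rem\<bar> \<le> K0 * t ^ 3 * ?N" using t by (simp add: abs_mult mult_ac)
    have "\<bar>diffusion_part t f x - E1\<bar> \<le> K1 * sup_norm ((deriv ^^ 6) f) * t ^ 3"
      using K1(2)[OF f6 t, of x] unfolding e1 using r12(1) by (simp add: r_def)
    also have "\<dots> \<le> K1 * ?N * t ^ 3"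
      using K1(1) t by (intro mult_right_mono mult_left_mono sup_norm_deriv_le_Ck_norm) auto
    finally have b1: "\<bar>diffusion_part t f x - E1\<bar> \<le> K1 * t ^ 3 * ?N" by (simp add: mult_ac)
    have "\<bar>correction_part t f x - E2\<bar> \<le> K2 * sup_norm ((deriv ^^ 8) f) * t ^ 3"
      using K2(2)[OF f t, of x] unfolding e2 using r12(2) by (simp add: r_def)
    also have "\<dots> \<le> K2 * ?N * t ^ 3"
      using K2(1) t by (intro mult_right_mono mult_left_mono sup_norm_deriv_le_Ck_norm) auto
    finally have b2: "\<bar>correction_part t f x - E2\<bar> \<le> K2 * t ^ 3 * ?N" by (simp add: mult_ac)
    have "(K1 + K2 + K0) * t ^ 3 * ?N = K1 * t ^ 3 * ?N + K2 * t ^ 3 * ?N + K0 * t ^ 3 * ?N"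
      by (simp add: algebra_simps)
    then show "\<bar>chernoff_expr a b c t f x - (f x + t * diff_expr a b c f x + t\<^sup>2 / 2 * diff_expr a b c (diff_expr a b c f) x)\<bar>
      \<le> (K1 + K2 + K0) * t ^ 3 * ?N"
      using b0 b1 b2 main unfolding chernoff_split by linarith
  qed
qed

text \<open>Orders three and one are enough for the two integrals: the remainders are \<open>O (t\<^bsup>3/2\<^esup>)\<close> and \<open>O (t t\<^bsup>1/4\<^esup>)\<close>.\<close>

lemma chernoff_order_1:
  obtains K where "K \<ge> 0" "\<And>f t x. f \<in> UCb_n 3 \<Longrightarrow> 0 < t \<Longrightarrow> t \<le> 1 \<Longrightarrow>
    \<bar>chernoff_expr a b c t f x - (f x + t * diff_expr a b c f x)\<bar> \<le> K * (t * t powr (1 / 4)) * Ck_norm 3 f"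
proof -
  define r where "r t = t powr (1 / 4)" for t :: real
  define C0 where "C0 = coefP a b c"
  define C1 where "C1 x = b x * c x" for x
  define C2 where "C2 t x = (b x)\<^sup>2 / 2 + a x * c x + (b x)\<^sup>2 * c x * t / 2" for t x
  have "unif_bdd (\<lambda>t x. \<bar>C0 x / 2\<bar> + \<bar>C1 x\<bar> + \<bar>C2 t x\<bar>)"
    unfolding C0_def C1_def C2_def divide_inverse
    by (intro unif_bdd_intros bdd_coefs bdd_PQR)
  then obtain K0 where K0: "K0 \<ge> 0" "\<And>t x. 0 < t \<Longrightarrow> t \<le> 1 \<Longrightarrow> \<bar>\<bar>C0 x / 2\<bar> + \<bar>C1 x\<bar> + \<bar>C2 t x\<bar>\<bar> \<le> K0"
    by (rule unif_bddE) blast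
  obtain K1 where K1: "K1 \<ge> 0" "\<And>f t x. f \<in> UCb_n 3 \<Longrightarrow> 0 < t \<Longrightarrow> t \<le> 1 \<Longrightarrow>
    \<bar>diffusion_part t f x - (1 + c x * t) / 2 *
      (\<Sum>k<3. (deriv ^^ k) f x / fact k * integral {-1..1} (\<lambda>y. (sqrt (6 * a x * t) * y + b x * t) ^ k))\<bar>
    \<le> K1 * sup_norm ((deriv ^^ 3) f) * (t powr (1 / 4)) ^ (2 * 3)"
    by (rule diffusion_taylor[of 3]) auto
  obtain K2 where K2: "K2 \<ge> 0" "\<And>f t x. f \<in> UCb_n 1 \<Longrightarrow> 0 < t \<Longrightarrow> t \<le> 1 \<Longrightarrow>
    \<bar>correction_part t f x - (\<Sum>k<1. (deriv ^^ k) f x / fact k * ((t powr (1 / 4)) ^ k * beta_moment a b c t x k))\<bar>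
    \<le> K2 * sup_norm ((deriv ^^ 1) f) * (t * (t powr (1 / 4)) ^ 1)"
    by (rule correction_taylor[of 1]) auto
  show ?thesis
  proof (rule that[of "K1 + K2 + K0"])
    show "K1 + K2 + K0 \<ge> 0" using K0 K1 K2 by simp
    fix f t x assume f: "f \<in> UCb_n 3" and t: "0 < t" "t \<le> (1::real)"
    let ?N = "Ck_norm 3 f"
    define D where "D k = (deriv ^^ k) f x" for k
    have DN: "\<bar>D k\<bar> \<le> ?N" if "k \<le> 3" for k
      unfolding D_def by (rule abs_deriv_le_Ck_norm[OF f that])
    have f1: "f \<in> UCb_n 1" using f UCb_n_mono[of 1 3] by auto
    note q = powr_quarter[OF t(1), folded r_def]
    have r: "r t > 0" "r t \<le> 1" using t quarter_le_1 by (simp_all add: r_def)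
    have r3: "t = r t * r t ^ 3" using q(1) by (simp add: eval_nat_numeral)
    have "r t * r t ^ 3 \<le> r t * 1" using r by (intro mult_left_mono power_le_one) auto
    then have t_r: "t \<le> r t" using r3 by simp
    have t2: "t\<^sup>2 \<le> t * r t" using t t_r by (simp add: power2_eq_square)
    have "r t ^ 6 = t * (r t)\<^sup>2" by (subst q(1)[symmetric]) (simp add: eval_nat_numeral)
    also have "\<dots> \<le> t * r t" using t r by (intro mult_left_mono) (auto simp: power2_eq_square mult_left_le)
    finally have r6: "r t ^ 6 \<le> t * r t" .
    define E1 where "E1 = (1 + c x * t) * (D 0 + D 1 * (b x * t) + D 2 / 2 * ((sqrt (6 * a x * t))\<^sup>2 / 3 + (b x * t)\<^sup>2))"
    define E2 where "E2 = D 0 * (coefP a b c x * t\<^sup>2 / 2)"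
    define Rem where "Rem = D 0 * (C0 x / 2) + D 1 * C1 x + D 2 * C2 t x"
    have fct: "fact 2 = (2::real)" by (simp_all add: eval_nat_numeral)
    have e1: "(1 + c x * t) / 2 *
      (\<Sum>k<3. (deriv ^^ k) f x / fact k * integral {-1..1} (\<lambda>y. (sqrt (6 * a x * t) * y + b x * t) ^ k)) = E1"
      unfolding sum_lessThan_3 integral_affine_powers E1_def D_def[symmetric] fct fact_0 fact_1
      by (simp only: div_by_1) (simp add: field_simps)
    have e2: "(\<Sum>k<1. (deriv ^^ k) f x / fact k * ((t powr (1 / 4)) ^ k * beta_moment a b c t x k)) = E2"
      by (simp add: beta_moments E2_def D_def)
    have st: "(sqrt (6 * a x * t))\<^sup>2 = 6 * a x * t" using t a_nonneg[of x] by simp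
    have main: "E1 + E2 = f x + t * diff_expr a b c f x + t\<^sup>2 * Rem"
      unfolding E1_def E2_def Rem_def C0_def C1_def C2_def st D_def diff_expr_def
      by (simp add: field_simps power2_eq_square)
    have "\<bar>Rem\<bar> \<le> \<bar>D 0\<bar> * \<bar>C0 x / 2\<bar> + \<bar>D 1\<bar> * \<bar>C1 x\<bar> + \<bar>D 2\<bar> * \<bar>C2 t x\<bar>"
      unfolding Rem_def abs_mult[symmetric] by linarith
    also have "\<dots> \<le> ?N * \<bar>C0 x / 2\<bar> + ?N * \<bar>C1 x\<bar> + ?N * \<bar>C2 t x\<bar>"
      by (intro add_mono mult_right_mono DN) auto
    also have "\<dots> = ?N * (\<bar>C0 x / 2\<bar> + \<bar>C1 x\<bar> + \<bar>C2 t x\<bar>)"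
      by (simp add: distrib_left)
    also have "\<dots> \<le> ?N * K0" using K0(2)[OF t, of x] by (intro mult_left_mono) auto
    finally have "t\<^sup>2 * \<bar>Rem\<bar> \<le> (t * r t) * (?N * K0)" using t r t2 by (intro mult_mono) auto
    then have b0: "\<bar>t\<^sup>2 * Rem\<bar> \<le> K0 * (t * r t) * ?N" by (simp add: abs_mult mult_ac)
    have "\<bar>diffusion_part t f x - E1\<bar> \<le> K1 * sup_norm ((deriv ^^ 3) f) * r t ^ 6"
      using K1(2)[OF f t, of x] unfolding e1 by (simp add: r_def)
    also have "\<dots> \<le> K1 * ?N * (t * r t)"
      using K1(1) t r r6 by (intro mult_mono mult_left_mono sup_norm_deriv_le_Ck_norm) auto
    finally have b1: "\<bar>diffusion_part t f x - E1\<bar> \<le> K1 * (t * r t) * ?N" by (simp add: mult_ac)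
    have "\<bar>correction_part t f x - E2\<bar> \<le> K2 * sup_norm ((deriv ^^ 1) f) * (t * r t)"
      using K2(2)[OF f1 t, of x] unfolding e2 by (simp add: r_def)
    also have "\<dots> \<le> K2 * ?N * (t * r t)"
      using K2(1) t r by (intro mult_right_mono mult_left_mono sup_norm_deriv_le_Ck_norm) auto
    finally have b2: "\<bar>correction_part t f x - E2\<bar> \<le> K2 * (t * r t) * ?N" by (simp add: mult_ac)
    have "(K1 + K2 + K0) * (t * r t) * ?N = K1 * (t * r t) * ?N + K2 * (t * r t) * ?N + K0 * (t * r t) * ?N"
      by (simp add: algebra_simps)
    then show "\<bar>chernoff_expr a b c t f x - (f x + t * diff_expr a b c f x)\<bar> \<le> (K1 + K2 + K0) * (t * t powr (1 / 4)) * ?N"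
      using b0 b1 b2 main unfolding chernoff_split r_def by linarith
  qed
qed

end

section \<open>Convergence of the Chernoff approximations\<close>

context elliptic_operator
begin

sublocale chernoff_coefficients a b c
  by unfold_locales (use abc2 a_ge \<alpha>_pos in \<open>auto intro: order_trans less_imp_le\<close>)

lemma apply_chernoff_expr: "apply_ucb (chernoff a b c t f) = chernoff_expr a b c t (apply_ucb f)"
  by (rule apply_chernoff[OF abc2])

lemma chernoff_op_diff: "chernoff a b c t (f - g) = chernoff a b c t f - chernoff a b c t g"
proof (rule ucb_eqI)
  fix x
  have "apply_ucb (f - g) = (\<lambda>x. apply_ucb f x - apply_ucb g x)" by auto
  then show "apply_ucb (chernoff a b c t (f - g)) x = apply_ucb (chernoff a b c t f - chernoff a b c t g) x"
    by (simp add: apply_chernoff_expr chernoff_diff)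
qed

lemma norm_chernoff_le:
  obtains K where "K \<ge> 0" "\<And>f t. 0 < t \<Longrightarrow> t \<le> 1 \<Longrightarrow> norm (chernoff a b c t f) \<le> exp (K * t) * norm f"
proof -
  obtain K where K: "K \<ge> 0" "\<And>f t x. f \<in> UCb \<Longrightarrow> 0 < t \<Longrightarrow> t \<le> 1 \<Longrightarrow>
    \<bar>chernoff_expr a b c t f x\<bar> \<le> (1 + K * t) * sup_norm f" by (rule chernoff_bounded) blast
  show ?thesis
  proof (rule that[OF K(1)])
    fix f and t :: real assume t: "0 < t" "t \<le> 1"
    have "norm (chernoff a b c t f) \<le> (1 + K * t) * norm f"
      using K(2)[OF apply_ucb_mem t, of f] by (intro norm_ucb_leI) (simp add: apply_chernoff_expr)
    also have "\<dots> \<le> exp (K * t) * norm f" by (intro mult_right_mono) auto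
    finally show "norm (chernoff a b c t f) \<le> exp (K * t) * norm f" .
  qed
qed

lemma chernoff_pow_diff: "(chernoff a b c t ^^ n) (f - g) = (chernoff a b c t ^^ n) f - (chernoff a b c t ^^ n) g"
  by (induction n) (simp_all add: chernoff_op_diff)

text \<open>Lax's telescoping: stability turns the local error along the exact orbit into a global one.\<close>

lemma telescoping:
  assumes S: "\<And>f. norm (chernoff a b c \<tau> f) \<le> M * norm f" and M: "1 \<le> M" and \<tau>: "0 \<le> \<tau>" and \<epsilon>: "0 \<le> \<epsilon>"
    and loc: "\<And>i. i < n \<Longrightarrow> norm (chernoff a b c \<tau> (T (real i * \<tau>) f) - T \<tau> (T (real i * \<tau>) f)) \<le> \<epsilon>"
  shows "norm ((chernoff a b c \<tau> ^^ n) f - T (real n * \<tau>) f) \<le> real n * M ^ n * \<epsilon>"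
  using loc
proof (induction n)
  case (Suc n)
  let ?S = "chernoff a b c \<tau>"
  let ?v = "T (real n * \<tau>) f"
  have "T (real (Suc n) * \<tau>) f = T \<tau> ?v"
    using add[of \<tau> "real n * \<tau>" f] \<tau> by (simp add: algebra_simps)
  then have split: "(?S ^^ Suc n) f - T (real (Suc n) * \<tau>) f = ?S ((?S ^^ n) f - ?v) + (?S ?v - T \<tau> ?v)"
    by (simp add: chernoff_op_diff)
  have "norm ((?S ^^ Suc n) f - T (real (Suc n) * \<tau>) f) \<le> M * norm ((?S ^^ n) f - ?v) + \<epsilon>"
    unfolding split using Suc.prems[of n] by (intro norm_triangle_mono S) auto
  also have "\<dots> \<le> M * (real n * M ^ n * \<epsilon>) + M ^ Suc n * \<epsilon>"
  proof (rule add_mono)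
    have "norm ((?S ^^ n) f - ?v) \<le> real n * M ^ n * \<epsilon>"
      by (rule Suc.IH, rule Suc.prems) simp
    then show "M * norm ((?S ^^ n) f - ?v) \<le> M * (real n * M ^ n * \<epsilon>)"
      using M by (intro mult_left_mono) auto
    show "\<epsilon> \<le> M ^ Suc n * \<epsilon>"
      using mult_right_mono[OF one_le_power[OF M, of "Suc n"] \<epsilon>] by simp
  qed
  also have "\<dots> = real (Suc n) * M ^ Suc n * \<epsilon>" by (simp add: algebra_simps)
  finally show ?case .
qed simp

lemma stable_consistent_convergent:
  assumes K: "K \<ge> 0" "\<And>f t. 0 < t \<Longrightarrow> t \<le> 1 \<Longrightarrow> norm (chernoff a b c t f) \<le> exp (K * t) * norm f"
    and t: "0 < t" and n: "0 < n" "t \<le> real n" and \<epsilon>: "0 \<le> \<epsilon>"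
    and loc: "\<And>s. 0 \<le> s \<Longrightarrow> s \<le> t \<Longrightarrow>
      norm (chernoff a b c (t / real n) (T s f) - T (t / real n) (T s f)) \<le> \<epsilon>"
  shows "norm ((chernoff a b c (t / real n) ^^ n) f - T t f) \<le> real n * exp (K * t) * \<epsilon>"
proof -
  define \<tau> where "\<tau> = t / real n"
  have \<tau>: "0 < \<tau>" "\<tau> \<le> 1" "real n * \<tau> = t" using t n by (auto simp: \<tau>_def)
  have "norm ((chernoff a b c \<tau> ^^ n) f - T (real n * \<tau>) f) \<le> real n * exp (K * \<tau>) ^ n * \<epsilon>"
  proof (rule telescoping)
    show "norm (chernoff a b c \<tau> f) \<le> exp (K * \<tau>) * norm f" for f by (rule K(2)[OF \<tau>(1,2)])
    fix i assume "i < n"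
    then have "real i * \<tau> \<le> real n * \<tau>" using \<tau>(1) by (intro mult_right_mono) auto
    then have i: "0 \<le> real i * \<tau>" "real i * \<tau> \<le> t" using \<tau> by auto
    show "norm (chernoff a b c \<tau> (T (real i * \<tau>) f) - T \<tau> (T (real i * \<tau>) f)) \<le> \<epsilon>"
      using loc[OF i] unfolding \<tau>_def[symmetric] .
  qed (use K(1) \<tau>(1) \<epsilon> in auto)
  also have "exp (K * \<tau>) ^ n = exp (K * t)"
    by (simp add: exp_of_nat_mult[symmetric] \<tau>(3)[symmetric] mult_ac)
  finally show ?thesis unfolding \<tau>(3) unfolding \<tau>_def .
qed

lemma L_step:
  assumes "a \<in> UCb_n m" "b \<in> UCb_n m" "c \<in> UCb_n m"
  obtains K where "K \<ge> 0" "\<And>f. apply_ucb f \<in> UCb_n (m + 2) \<Longrightarrow>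
    (f, diff_op a b c f) \<in> L_graph \<and> apply_ucb (diff_op a b c f) = diff_expr a b c (apply_ucb f) \<and>
    apply_ucb (diff_op a b c f) \<in> UCb_n m \<and>
    Ck_norm m (apply_ucb (diff_op a b c f)) \<le> K * Ck_norm (m + 2) (apply_ucb f)"
proof -
  obtain K where K: "K \<ge> 0" "\<And>u. u \<in> UCb_n (m + 2) \<Longrightarrow> Ck_norm m (diff_expr a b c u) \<le> K * Ck_norm (m + 2) u"
    using diff_expr_bounded[OF assms] by blast
  show ?thesis
  proof (rule that[OF K(1)])
    fix f assume f: "apply_ucb f \<in> UCb_n (m + 2)"
    have f2: "apply_ucb f \<in> UCb_n 2" using f UCb_n_mono[of 2 "m + 2"] by auto
    note e = apply_diff_op[OF abc f2]
    show "(f, diff_op a b c f) \<in> L_graph \<and> apply_ucb (diff_op a b c f) = diff_expr a b c (apply_ucb f) \<and>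
      apply_ucb (diff_op a b c f) \<in> UCb_n m \<and>
      Ck_norm m (apply_ucb (diff_op a b c f)) \<le> K * Ck_norm (m + 2) (apply_ucb f)"
      using diff_op_in_L_graph[OF f2] e diff_expr_UCb_n[OF assms f] K(2)[OF f] by simp
  qed
qed

lemma chernoff_expansion:
  obtains K where "K \<ge> 0" "\<And>f t. apply_ucb f \<in> UCb_n 8 \<Longrightarrow> 0 < t \<Longrightarrow> t \<le> 1 \<Longrightarrow>
    norm (chernoff a b c t f - (f + t *\<^sub>R diff_op a b c f + (1 / 2 * t\<^sup>2) *\<^sub>R diff_op a b c (diff_op a b c f)))
    \<le> K * t ^ 3 * Ck_norm 8 (apply_ucb f)"
proof -
  obtain K where K: "K \<ge> 0" "\<And>f t x. f \<in> UCb_n 8 \<Longrightarrow> 0 < t \<Longrightarrow> t \<le> 1 \<Longrightarrow>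
    \<bar>chernoff_expr a b c t f x - (f x + t * diff_expr a b c f x + t\<^sup>2 / 2 * diff_expr a b c (diff_expr a b c f) x)\<bar>
    \<le> K * t ^ 3 * Ck_norm 8 f" by (rule chernoff_order_3) blast
  show ?thesis
  proof (rule that[OF K(1)])
    fix f t assume f: "apply_ucb f \<in> UCb_n 8" and t: "0 < t" "t \<le> (1::real)"
    have f2: "apply_ucb f \<in> UCb_n 2" "apply_ucb f \<in> UCb_n (2 + 2)"
      using f UCb_n_mono[of 2 8] UCb_n_mono[of "2 + 2" 8] by auto
    have e: "apply_ucb (diff_op a b c f) = diff_expr a b c (apply_ucb f)"
      by (rule apply_diff_op[OF abc f2(1)])
    have "apply_ucb (diff_op a b c f) \<in> UCb_n 2"
      unfolding e by (rule diff_expr_UCb_n[OF abc2 f2(2)])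
    from apply_diff_op[OF abc this]
    have ee: "apply_ucb (diff_op a b c (diff_op a b c f)) = diff_expr a b c (diff_expr a b c (apply_ucb f))"
      unfolding e .
    show "norm (chernoff a b c t f - (f + t *\<^sub>R diff_op a b c f + (1 / 2 * t\<^sup>2) *\<^sub>R diff_op a b c (diff_op a b c f)))
      \<le> K * t ^ 3 * Ck_norm 8 (apply_ucb f)"
      using K(2)[OF f t] by (intro norm_ucb_leI) (simp add: apply_chernoff_expr e ee)
  qed
qed

text \<open>Both \<open>S t f\<close> and \<open>T t f\<close> have the second order Taylor polynomial \<open>f + t L f + t\<^sup>2 L\<^sup>2 f / 2\<close>. For \<open>T\<close>, the remainder is
  governed by \<open>L\<^sup>3 f\<close>, which six derivatives of \<open>f\<close> control.\<close>

lemma local_error_3: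
  assumes abc6: "a \<in> UCb_n 6" "b \<in> UCb_n 6" "c \<in> UCb_n 6"
  obtains K where "K \<ge> 0" "\<And>f t. apply_ucb f \<in> UCb_n 8 \<Longrightarrow> 0 < t \<Longrightarrow> t \<le> 1 \<Longrightarrow>
    norm (chernoff a b c t f - T t f) \<le> K * t ^ 3 * Ck_norm 8 (apply_ucb f)"
proof -
  let ?L = "diff_op a b c"
  obtain K where K: "K \<ge> 0" "\<And>f t. apply_ucb f \<in> UCb_n 8 \<Longrightarrow> 0 < t \<Longrightarrow> t \<le> 1 \<Longrightarrow>
    norm (chernoff a b c t f - (f + t *\<^sub>R ?L f + (1 / 2 * t\<^sup>2) *\<^sub>R ?L (?L f)))
    \<le> K * t ^ 3 * Ck_norm 8 (apply_ucb f)" by (rule chernoff_expansion) blast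
  have abc4: "a \<in> UCb_n 4" "b \<in> UCb_n 4" "c \<in> UCb_n 4"
    using abc6 UCb_n_mono[of 4 6] by auto
  obtain K1 where K1: "K1 \<ge> 0" "\<And>f. apply_ucb f \<in> UCb_n (6 + 2) \<Longrightarrow> (f, ?L f) \<in> L_graph \<and>
    apply_ucb (?L f) = diff_expr a b c (apply_ucb f) \<and> apply_ucb (?L f) \<in> UCb_n 6 \<and>
    Ck_norm 6 (apply_ucb (?L f)) \<le> K1 * Ck_norm (6 + 2) (apply_ucb f)" by (rule L_step[OF abc6]) blast
  obtain K2 where K2: "K2 \<ge> 0" "\<And>f. apply_ucb f \<in> UCb_n (4 + 2) \<Longrightarrow> (f, ?L f) \<in> L_graph \<and>
    apply_ucb (?L f) = diff_expr a b c (apply_ucb f) \<and> apply_ucb (?L f) \<in> UCb_n 4 \<and>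
    Ck_norm 4 (apply_ucb (?L f)) \<le> K2 * Ck_norm (4 + 2) (apply_ucb f)" by (rule L_step[OF abc4]) blast
  obtain K3 where K3: "K3 \<ge> 0" "\<And>f. apply_ucb f \<in> UCb_n (2 + 2) \<Longrightarrow> (f, ?L f) \<in> L_graph \<and>
    apply_ucb (?L f) = diff_expr a b c (apply_ucb f) \<and> apply_ucb (?L f) \<in> UCb_n 2 \<and>
    Ck_norm 2 (apply_ucb (?L f)) \<le> K3 * Ck_norm (2 + 2) (apply_ucb f)" by (rule L_step[OF abc2]) blast
  define K' where "K' = exp \<bar>\<gamma>\<bar> * (K3 * (K2 * K1))"
  show ?thesis
  proof (rule that[of "K + K'"])
    show "K + K' \<ge> 0" using K(1) K1(1) K2(1) K3(1) by (simp add: K'_def)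
    fix f t assume f: "apply_ucb f \<in> UCb_n 8" and t: "0 < t" "t \<le> (1::real)"
    let ?N = "Ck_norm 8 (apply_ucb f)"
    have f1: "(f, ?L f) \<in> L_graph" "apply_ucb (?L f) \<in> UCb_n (4 + 2)" "Ck_norm (4 + 2) (apply_ucb (?L f)) \<le> K1 * ?N"
      using K1(2)[of f] f by auto
    have f2: "(?L f, ?L (?L f)) \<in> L_graph" "apply_ucb (?L (?L f)) \<in> UCb_n (2 + 2)"
      "Ck_norm (2 + 2) (apply_ucb (?L (?L f))) \<le> K2 * Ck_norm (4 + 2) (apply_ucb (?L f))"
      using K2(2)[OF f1(2)] by auto
    have f3: "(?L (?L f), ?L (?L (?L f))) \<in> L_graph"
      "Ck_norm 2 (apply_ucb (?L (?L (?L f)))) \<le> K3 * Ck_norm (2 + 2) (apply_ucb (?L (?L f)))"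
      using K3(2)[OF f2(2)] by auto
    have "norm (?L (?L (?L f))) \<le> Ck_norm 2 (apply_ucb (?L (?L (?L f))))"
      using sup_norm_le_Ck_norm[of "apply_ucb (?L (?L (?L f)))" 2] by simp
    also have "\<dots> \<le> K3 * (K2 * (K1 * ?N))"
      by (rule order_trans[OF f3(2) mult_left_mono[OF order_trans[OF f2(3) mult_left_mono[OF f1(3)]]]]) (use K2 K3 in auto)
    finally have n3: "norm (?L (?L (?L f))) \<le> K3 * (K2 * (K1 * ?N))" .
    have "norm (T t f - f - t *\<^sub>R ?L f - (t\<^sup>2 / 2) *\<^sub>R ?L (?L f)) \<le> t ^ 3 * (exp (\<bar>\<gamma>\<bar> * 1) * norm (?L (?L (?L f))))"
      using t by (intro orbit_taylor_3[OF f1(1) f2(1) f3(1)]) auto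
    also have "\<dots> \<le> t ^ 3 * (exp (\<bar>\<gamma>\<bar> * 1) * (K3 * (K2 * (K1 * ?N))))"
      using n3 t by (intro mult_left_mono) auto
    finally have B: "norm (T t f - f - t *\<^sub>R ?L f - (t\<^sup>2 / 2) *\<^sub>R ?L (?L f)) \<le> K' * t ^ 3 * ?N"
      by (simp add: K'_def mult_ac)
    have eq: "chernoff a b c t f - T t f = (chernoff a b c t f - (f + t *\<^sub>R ?L f + (1 / 2 * t\<^sup>2) *\<^sub>R ?L (?L f)))
        - (T t f - f - t *\<^sub>R ?L f - (t\<^sup>2 / 2) *\<^sub>R ?L (?L f))" by simp
    have "norm (chernoff a b c t f - T t f) \<le> K * t ^ 3 * ?N + K' * t ^ 3 * ?N"
      unfolding eq by (rule order_trans[OF norm_triangle_ineq4 add_mono[OF K(2)[OF f t] B]])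
    then show "norm (chernoff a b c t f - T t f) \<le> (K + K') * t ^ 3 * ?N"
      by (simp add: algebra_simps)
  qed
qed

lemma local_error_1:
  obtains K where "K \<ge> 0" "\<And>f t. apply_ucb f \<in> UCb_n 4 \<Longrightarrow> 0 < t \<Longrightarrow> t \<le> 1 \<Longrightarrow>
    norm (chernoff a b c t f - T t f) \<le> K * (t * t powr (1 / 4)) * Ck_norm 4 (apply_ucb f)"
proof -
  let ?L = "diff_op a b c"
  obtain K where K: "K \<ge> 0" "\<And>f t x. f \<in> UCb_n 3 \<Longrightarrow> 0 < t \<Longrightarrow> t \<le> 1 \<Longrightarrow>
    \<bar>chernoff_expr a b c t f x - (f x + t * diff_expr a b c f x)\<bar> \<le> K * (t * t powr (1 / 4)) * Ck_norm 3 f"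
    by (rule chernoff_order_1) blast
  have m: "a \<in> UCb_n 0" "b \<in> UCb_n 0" "c \<in> UCb_n 0"
    using abc2 UCb_n_mono[of 0 2] by auto
  obtain K2 where K2: "K2 \<ge> 0" "\<And>f. apply_ucb f \<in> UCb_n (2 + 2) \<Longrightarrow> (f, ?L f) \<in> L_graph \<and>
    apply_ucb (?L f) = diff_expr a b c (apply_ucb f) \<and> apply_ucb (?L f) \<in> UCb_n 2 \<and>
    Ck_norm 2 (apply_ucb (?L f)) \<le> K2 * Ck_norm (2 + 2) (apply_ucb f)" by (rule L_step[OF abc2]) blast
  obtain K3 where K3: "K3 \<ge> 0" "\<And>f. apply_ucb f \<in> UCb_n 2 \<Longrightarrow> (f, ?L f) \<in> L_graph \<and>
    apply_ucb (?L f) = diff_expr a b c (apply_ucb f) \<and> apply_ucb (?L f) \<in> UCb_n 0 \<and>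
    Ck_norm 0 (apply_ucb (?L f)) \<le> K3 * Ck_norm 2 (apply_ucb f)" by (rule L_step[OF m, unfolded add_0_left]) blast
  define K' where "K' = exp \<bar>\<gamma>\<bar> * (K3 * K2)"
  show ?thesis
  proof (rule that[of "K + K'"])
    show "K + K' \<ge> 0" using K(1) K2(1) K3(1) by (simp add: K'_def)
    fix f t assume f: "apply_ucb f \<in> UCb_n 4" and t: "0 < t" "t \<le> (1::real)"
    let ?N = "Ck_norm 4 (apply_ucb f)" and ?p = "t * t powr (1 / 4)"
    have f1: "(f, ?L f) \<in> L_graph" "apply_ucb (?L f) = diff_expr a b c (apply_ucb f)"
      "apply_ucb (?L f) \<in> UCb_n 2" "Ck_norm 2 (apply_ucb (?L f)) \<le> K2 * ?N"
      using K2(2)[of f] f by auto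
    have f2: "(?L f, ?L (?L f)) \<in> L_graph" "norm (?L (?L f)) \<le> K3 * Ck_norm 2 (apply_ucb (?L f))"
      using K3(2)[OF f1(3)] by auto
    have n2: "norm (?L (?L f)) \<le> K3 * (K2 * ?N)"
      by (rule order_trans[OF f2(2) mult_left_mono[OF f1(4)]]) (use K3 in auto)
    have "t powr 1 \<le> t powr (1 / 4)" using t by (intro powr_mono') auto
    then have tp: "t\<^sup>2 \<le> ?p" using t by (simp add: power2_eq_square)
    have "norm (T t f - f - t *\<^sub>R ?L f) \<le> t\<^sup>2 * (exp (\<bar>\<gamma>\<bar> * 1) * norm (?L (?L f)))"
      using t by (intro orbit_taylor_2[OF f1(1) f2(1)]) auto
    also have "\<dots> \<le> ?p * (exp (\<bar>\<gamma>\<bar> * 1) * (K3 * (K2 * ?N)))"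
      using n2 t tp K2 K3 by (intro mult_mono mult_left_mono) auto
    finally have B: "norm (T t f - f - t *\<^sub>R ?L f) \<le> K' * ?p * ?N"
      by (simp add: K'_def mult_ac)
    have f3: "apply_ucb f \<in> UCb_n 3" using f UCb_n_mono[of 3 4] by auto
    have A: "norm (chernoff a b c t f - (f + t *\<^sub>R ?L f)) \<le> K * ?p * ?N"
    proof (rule norm_ucb_leI)
      fix x
      have "\<bar>apply_ucb (chernoff a b c t f - (f + t *\<^sub>R ?L f)) x\<bar> \<le> K * ?p * Ck_norm 3 (apply_ucb f)"
        using K(2)[OF f3 t, of x] by (simp add: apply_chernoff_expr f1(2))
      also have "\<dots> \<le> K * ?p * ?N"
        using K(1) t by (intro mult_left_mono Ck_norm_mono) auto
      finally show "\<bar>apply_ucb (chernoff a b c t f - (f + t *\<^sub>R ?L f)) x\<bar> \<le> K * ?p * ?N" .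
    qed
    have eq: "chernoff a b c t f - T t f = (chernoff a b c t f - (f + t *\<^sub>R ?L f)) - (T t f - f - t *\<^sub>R ?L f)" by simp
    have "norm (chernoff a b c t f - T t f) \<le> K * ?p * ?N + K' * ?p * ?N"
      unfolding eq by (rule order_trans[OF norm_triangle_ineq4 add_mono[OF A B]])
    then show "norm (chernoff a b c t f - T t f) \<le> (K + K') * ?p * ?N"
      by (simp add: algebra_simps)
  qed
qed

lemma chernoff_rate:
  assumes abc6: "a \<in> UCb_n 6" "b \<in> UCb_n 6" "c \<in> UCb_n 6"
  obtains w C where "w \<ge> 0" "C \<ge> 0" "\<And>f t n. apply_ucb f \<in> UCb_n 8 \<Longrightarrow> t > 0 \<Longrightarrow> n > 0 \<Longrightarrow> real n \<ge> t \<Longrightarrow>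
    norm ((chernoff a b c (t / real n) ^^ n) f - T t f)
      \<le> exp (w * t) * (t ^ 3 / real n ^ 2) * (C * Ck_norm 8 (apply_ucb f))"
proof -
  obtain K where K: "K \<ge> 0" "\<And>f t. 0 < t \<Longrightarrow> t \<le> 1 \<Longrightarrow> norm (chernoff a b c t f) \<le> exp (K * t) * norm f"
    by (rule norm_chernoff_le) blast
  obtain K3 where K3: "K3 \<ge> 0" "\<And>f t. apply_ucb f \<in> UCb_n 8 \<Longrightarrow> 0 < t \<Longrightarrow> t \<le> 1 \<Longrightarrow>
    norm (chernoff a b c t f - T t f) \<le> K3 * t ^ 3 * Ck_norm 8 (apply_ucb f)"
    by (rule local_error_3[OF abc6]) blast
  obtain KT where KT: "KT \<ge> 0" "\<And>f t. 0 \<le> t \<Longrightarrow> apply_ucb f \<in> UCb_n 8 \<Longrightarrow>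
    apply_ucb (T t f) \<in> UCb_n 8 \<and>
    Ck_norm 8 (apply_ucb (T t f)) \<le> KT * exp (\<gamma> * t) * Ck_norm 8 (apply_ucb f)"
    using T_regularity[OF abc6, of 4] by auto
  show ?thesis
  proof (rule that[of "K + \<bar>\<gamma>\<bar>" "K3 * KT"])
    fix f t n assume f: "apply_ucb f \<in> UCb_n 8" and t: "t > 0" and n: "n > 0" "real n \<ge> t"
    let ?N = "Ck_norm 8 (apply_ucb f)"
    define \<tau> where "\<tau> = t / real n"
    have \<tau>: "0 < \<tau>" "\<tau> \<le> 1" using t n by (auto simp: \<tau>_def)
    define \<epsilon> where "\<epsilon> = K3 * \<tau> ^ 3 * (KT * exp (\<bar>\<gamma>\<bar> * t) * ?N)"
    have "norm ((chernoff a b c (t / real n) ^^ n) f - T t f) \<le> real n * exp (K * t) * \<epsilon>"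
    proof (rule stable_consistent_convergent[OF K t n(1)])
      show "0 \<le> \<epsilon>" using K3(1) KT(1) \<tau>(1) by (simp add: \<epsilon>_def)
      fix s assume s: "0 \<le> s" "s \<le> t"
      have Ts: "apply_ucb (T s f) \<in> UCb_n 8" "Ck_norm 8 (apply_ucb (T s f)) \<le> KT * exp (\<gamma> * s) * ?N"
        using KT(2)[OF s(1) f] by auto
      have "norm (chernoff a b c \<tau> (T s f) - T \<tau> (T s f)) \<le> K3 * \<tau> ^ 3 * Ck_norm 8 (apply_ucb (T s f))"
        by (rule K3(2)[OF Ts(1) \<tau>])
      also have "\<dots> \<le> K3 * \<tau> ^ 3 * (KT * exp (\<gamma> * s) * ?N)"
        using Ts(2) K3(1) \<tau>(1) by (intro mult_left_mono) auto
      also have "\<dots> \<le> \<epsilon>"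
        unfolding \<epsilon>_def using K3(1) KT(1) \<tau>(1) exp_le[OF s] by (intro mult_left_mono mult_right_mono) auto
      finally show "norm (chernoff a b c (t / real n) (T s f) - T (t / real n) (T s f)) \<le> \<epsilon>"
        by (simp add: \<tau>_def)
    qed (use n in auto)
    also have "real n * exp (K * t) * \<epsilon> = (real n * \<tau> ^ 3) * (exp (K * t) * exp (\<bar>\<gamma>\<bar> * t)) * (K3 * KT * ?N)"
      by (simp add: \<epsilon>_def mult_ac)
    also have "real n * \<tau> ^ 3 = t ^ 3 / real n ^ 2"
      using n by (simp add: \<tau>_def power_divide power2_eq_square power3_eq_cube)
    also have "exp (K * t) * exp (\<bar>\<gamma>\<bar> * t) = exp ((K + \<bar>\<gamma>\<bar>) * t)"
      by (simp add: exp_add[symmetric] distrib_right)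
    finally show "norm ((chernoff a b c (t / real n) ^^ n) f - T t f)
      \<le> exp ((K + \<bar>\<gamma>\<bar>) * t) * (t ^ 3 / real n ^ 2) * (K3 * KT * ?N)" by (simp only: mult_ac)
  qed (use K K3 KT in auto)
qed

lemma chernoff_convergence:
  assumes \<T>: "\<T> > 0" and e: "e > 0"
  shows "\<forall>\<^sub>F n in sequentially. \<forall>t\<in>{0<..\<T>}. norm ((chernoff a b c (t / real n) ^^ n) g - T t g) \<le> e"
proof -
  obtain K where K: "K \<ge> 0" "\<And>f t. 0 < t \<Longrightarrow> t \<le> 1 \<Longrightarrow> norm (chernoff a b c t f) \<le> exp (K * t) * norm f"
    by (rule norm_chernoff_le) blast
  obtain K1 where K1: "K1 \<ge> 0" "\<And>f t. apply_ucb f \<in> UCb_n 4 \<Longrightarrow> 0 < t \<Longrightarrow> t \<le> 1 \<Longrightarrow>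
    norm (chernoff a b c t f - T t f) \<le> K1 * (t * t powr (1 / 4)) * Ck_norm 4 (apply_ucb f)"
    by (rule local_error_1) blast
  obtain KT where KT: "KT \<ge> 0" "\<And>f t. 0 \<le> t \<Longrightarrow> apply_ucb f \<in> UCb_n 4 \<Longrightarrow>
    apply_ucb (T t f) \<in> UCb_n 4 \<and>
    Ck_norm 4 (apply_ucb (T t f)) \<le> KT * exp (\<gamma> * t) * Ck_norm 4 (apply_ucb f)"
    using T_regularity[OF abc2, of 2] by auto
  define B where "B = exp (K * \<T>) + exp (\<bar>\<gamma>\<bar> * \<T>)"
  have B: "B > 0" by (simp add: B_def add_pos_pos)
  \<comment> \<open>Replacing \<open>g\<close> by a smooth \<open>f\<close> within \<open>\<delta>\<close> costs at most \<open>B \<delta> = e / 2\<close>.\<close>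
  define \<delta> where "\<delta> = e / 2 / B"
  have \<delta>: "\<delta> > 0" using e B by (simp add: \<delta>_def)
  obtain f' where f': "f' \<in> UCb_n 4" "\<And>x. \<bar>f' x - apply_ucb g x\<bar> \<le> \<delta>"
    using UCb_n_dense[OF apply_ucb_mem[of g] \<delta>] by blast
  define f where "f = Abs_ucb f'"
  have af: "apply_ucb f = f'" using f'(1) by (simp add: f_def Abs_ucb_inverse UCb_n_imp_UCb)
  have f: "apply_ucb f \<in> UCb_n 4" using f'(1) af by simp
  have gf: "norm (g - f) \<le> \<delta>"
    using f'(2) by (intro norm_ucb_leI) (simp add: af abs_minus_commute)
  let ?N = "Ck_norm 4 (apply_ucb f)"
  define C where "C = \<T> * (exp (K * \<T>) * (K1 * (KT * exp (\<bar>\<gamma>\<bar> * \<T>) * ?N)))"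
  have C: "C \<ge> 0" using \<T> K1(1) KT(1) by (simp add: C_def)
  have err: "norm ((chernoff a b c (t / real n) ^^ n) g - T t g) \<le> C * (\<T> / real n) powr (1 / 4) + e / 2"
    if t: "0 < t" "t \<le> \<T>" and n: "0 < n" "\<T> \<le> real n" for t n
  proof -
    let ?S = "chernoff a b c (t / real n)"
    define \<tau> where "\<tau> = t / real n"
    have tn: "t \<le> real n" using t n by simp
    have \<tau>: "0 < \<tau>" "\<tau> \<le> 1" "real n * \<tau> = t" using t n tn by (auto simp: \<tau>_def)
    have eK: "exp (K * t) \<le> exp (K * \<T>)" using K(1) t by (simp add: mult_left_mono)
    define \<epsilon> where "\<epsilon> = K1 * (\<tau> * \<tau> powr (1 / 4)) * (KT * exp (\<bar>\<gamma>\<bar> * \<T>) * ?N)"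
    have \<epsilon>0: "0 \<le> \<epsilon>" using K1(1) KT(1) \<tau>(1) by (simp add: \<epsilon>_def)
    have "norm ((?S ^^ n) f - T t f) \<le> real n * exp (K * t) * \<epsilon>"
    proof (rule stable_consistent_convergent[OF K t(1) n(1) tn \<epsilon>0])
      fix s assume s: "0 \<le> s" "s \<le> t"
      have Ts: "apply_ucb (T s f) \<in> UCb_n 4" "Ck_norm 4 (apply_ucb (T s f)) \<le> KT * exp (\<gamma> * s) * ?N"
        using KT(2)[OF s(1) f] by auto
      have "norm (chernoff a b c \<tau> (T s f) - T \<tau> (T s f)) \<le> K1 * (\<tau> * \<tau> powr (1 / 4)) * Ck_norm 4 (apply_ucb (T s f))"
        by (rule K1(2)[OF Ts(1) \<tau>(1,2)])
      also have "\<dots> \<le> K1 * (\<tau> * \<tau> powr (1 / 4)) * (KT * exp (\<gamma> * s) * ?N)"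
        using Ts(2) K1(1) \<tau>(1) by (intro mult_left_mono) auto
      also have "\<dots> \<le> \<epsilon>"
        unfolding \<epsilon>_def using K1(1) KT(1) \<tau>(1) exp_le[of s \<T>] s t
        by (intro mult_left_mono mult_right_mono) auto
      finally show "norm (chernoff a b c (t / real n) (T s f) - T (t / real n) (T s f)) \<le> \<epsilon>"
        by (simp add: \<tau>_def)
    qed
    also have "\<dots> \<le> real n * exp (K * \<T>) * \<epsilon>"
      using eK \<epsilon>0 by (intro mult_right_mono mult_left_mono) auto
    also have "\<dots> = (real n * \<tau>) * (exp (K * \<T>) * (K1 * (KT * exp (\<bar>\<gamma>\<bar> * \<T>) * ?N))) * \<tau> powr (1 / 4)"
      by (simp add: \<epsilon>_def mult_ac)
    also have "\<dots> \<le> C * (\<T> / real n) powr (1 / 4)"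
      unfolding \<tau>(3) C_def using t n \<tau>(1) K1(1) KT(1)
      by (intro mult_mono powr_mono2) (auto simp: \<tau>_def divide_right_mono)
    finally have 1: "norm ((?S ^^ n) f - T t f) \<le> C * (\<T> / real n) powr (1 / 4)" .
    have pow: "norm ((?S ^^ m) h) \<le> exp (K * \<tau>) ^ m * norm h" for m h
    proof (induction m)
      case (Suc m)
      have "norm (?S ((?S ^^ m) h)) \<le> exp (K * \<tau>) * norm ((?S ^^ m) h)"
        using K(2)[OF \<tau>(1,2)] by (simp add: \<tau>_def)
      also have "\<dots> \<le> exp (K * \<tau>) * (exp (K * \<tau>) ^ m * norm h)"
        using Suc by (intro mult_left_mono) auto
      finally show ?case by (simp add: mult.assoc)
    qed simp
    have "norm ((?S ^^ n) (g - f)) \<le> exp (K * t) * norm (g - f)"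
      using pow[of n "g - f"] by (simp add: exp_of_nat_mult[symmetric] \<tau>(3)[symmetric] mult_ac)
    also have "\<dots> \<le> exp (K * \<T>) * \<delta>" using eK gf by (intro mult_mono) auto
    finally have 2: "norm ((?S ^^ n) g - (?S ^^ n) f) \<le> exp (K * \<T>) * \<delta>" by (simp add: chernoff_pow_diff)
    have "norm (T t (g - f)) \<le> exp (\<bar>\<gamma>\<bar> * \<T>) * norm (g - f)" using t by (intro norm_orbit_le) auto
    also have "\<dots> \<le> exp (\<bar>\<gamma>\<bar> * \<T>) * \<delta>" using gf by (intro mult_left_mono) auto
    finally have 3: "norm (T t g - T t f) \<le> exp (\<bar>\<gamma>\<bar> * \<T>) * \<delta>" by (simp add: blinfun.diff_right)
    have "exp (K * \<T>) * \<delta> + exp (\<bar>\<gamma>\<bar> * \<T>) * \<delta> = B * \<delta>" by (simp add: B_def algebra_simps)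
    also have "\<dots> = e / 2" using B by (simp add: \<delta>_def)
    finally have 4: "exp (K * \<T>) * \<delta> + exp (\<bar>\<gamma>\<bar> * \<T>) * \<delta> = e / 2" .
    have eq: "(?S ^^ n) g - T t g = ((?S ^^ n) f - T t f) + (((?S ^^ n) g - (?S ^^ n) f) - (T t g - T t f))" by simp
    have "norm ((?S ^^ n) g - T t g) \<le> C * (\<T> / real n) powr (1 / 4) + (exp (K * \<T>) * \<delta> + exp (\<bar>\<gamma>\<bar> * \<T>) * \<delta>)"
      unfolding eq by (intro norm_triangle_mono 1 order_trans[OF norm_triangle_ineq4 add_mono[OF 2 3]])
    then show ?thesis unfolding 4 .
  qed
  have "(\<lambda>n. \<T> / real n) \<longlonglongrightarrow> 0" by (rule lim_const_over_n)
  then have "(\<lambda>n. (\<T> / real n) powr (1 / 4)) \<longlonglongrightarrow> 0"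
    using \<T> by (intro tendsto_zero_powrI[OF _ tendsto_const]) auto
  from tendsto_mult[OF tendsto_const this, of C]
  have "\<forall>\<^sub>F n in sequentially. C * (\<T> / real n) powr (1 / 4) < e / 2"
    using e by (intro order_tendstoD(2)) auto
  moreover have "\<forall>\<^sub>F n in sequentially. 0 < n \<and> \<T> \<le> real n"
    by (rule eventually_sequentiallyI[of "nat \<lceil>\<T>\<rceil> + 1"]) (auto, linarith)
  ultimately show ?thesis
  proof eventually_elim
    case (elim n)
    show ?case
    proof
      fix t assume "t \<in> {0<..\<T>}"
      then show "norm ((chernoff a b c (t / real n) ^^ n) g - T t g) \<le> e"
        using err[of t n] elim by simp
    qed
  qed
qed

end

theorem theorem5:
  fixes a b c :: "real \<Rightarrow> real"
  assumes "a \<in> UCb_n 2" and "b \<in> UCb_n 2" and "c \<in> UCb_n 2"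
    and "(INF x. a x) > 0"
  shows
    "let H = H_graph a b c; Hbar = closure H; E = semigroup_of Hbar; S = chernoff a b c in
     (closable H \<and> (\<exists>T. generates Hbar T) \<and>
       (\<forall>t\<ge>0. norm (E t) \<le> exp ((SUP x. c x) * t))) \<and>
     (Domain Hbar \<supseteq> {f. apply_ucb f \<in> HCb 2} \<and>
       (\<forall>u0. mild_solution Hbar u0 (\<lambda>t. blinfun_apply (E t) u0) \<and>
             (\<forall>U. mild_solution Hbar u0 U \<longrightarrow> (\<forall>t\<ge>0. U t = blinfun_apply (E t) u0))) \<and>
       (\<forall>u0\<in>Domain Hbar. classical_solution Hbar u0 (\<lambda>t. blinfun_apply (E t) u0) \<and>
             (\<forall>U. classical_solution Hbar u0 U \<longrightarrow> (\<forall>t\<ge>0. U t = blinfun_apply (E t) u0)))) \<and>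
     (\<forall>f. apply_ucb f \<in> Cb_inf \<longrightarrow>
       (\<lambda>t. norm (S t f - (f + t *\<^sub>R diff_op a b c f
                             + (1 / 2 * t\<^sup>2) *\<^sub>R diff_op a b c (diff_op a b c f))))
         \<in> o[at_right 0](\<lambda>t. t\<^sup>2)) \<and>
     (a \<in> HCb 6 \<and> b \<in> HCb 6 \<and> c \<in> HCb 6 \<longrightarrow>
       (\<exists>w\<ge>0. \<exists>C. (\<forall>j\<le>8. C j \<ge> 0) \<and>
         (\<forall>f t n. apply_ucb f \<in> UCb_n 8 \<and> t > 0 \<and> n > 0 \<and> real n \<ge> t \<longrightarrow>
           norm ((S (t / real n) ^^ n) f - blinfun_apply (E t) f)
             \<le> exp (w * t) * (t ^ 3 / real n ^ 2) *
                (\<Sum>j=0..8. C j * norm (Abs_ucb ((deriv ^^ j) (apply_ucb f))))))) \<and>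
     (\<forall>\<T>>0. \<forall>g.
       (\<lambda>n. SUP t\<in>{0<..\<T>}. ereal (norm ((S (t / real n) ^^ n) g - blinfun_apply (E t) g)))
         \<longlonglongrightarrow> 0)"
proof -
  have "bdd_below (range a)"
    using abs_le_sup_norm[OF UCb_n_imp_UCb[OF assms(1)]]
    by (intro bdd_belowI[of _ "- sup_norm a"]) (auto simp: abs_le_iff minus_le_iff)
  then have a_ge: "(INF x. a x) \<le> a x" for x by (intro cINF_lower) auto
  \<comment> \<open>From here on the closure is known to be \<open>L_graph\<close>, generating \<open>T\<close>.\<close>
  interpret elliptic_operator a b c "INF x. a x"
    by unfold_locales (use assms a_ge in auto)
  \<comment> \<open>\<open>semigroup_of\<close> is an arbitrary choice, but uniqueness identifies it with \<open>T\<close> at nonnegative times.\<close>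
  define E where "E = semigroup_of L_graph"
  have gE: "generates L_graph E"
    unfolding E_def semigroup_of_def by (rule someI[of "generates L_graph"]) (rule generates)
  have ET: "E t = T t" if "0 \<le> t" for t by (rule generated_unique[OF gE dense_L_graph that])
  interpret E: exp_bounded_semigroup L_graph E \<gamma>
    by unfold_locales (use gE norm_le ET in auto)
  let ?H = "H_graph a b c" and ?S = "chernoff a b c"
  have sv: "single_valued L_graph"
    by (rule single_valuedI) (metis L_graph_diff_op)
  have part1: "closable ?H \<and> (\<exists>T. generates L_graph T) \<and> (\<forall>t\<ge>0. norm (E t) \<le> exp ((SUP x. c x) * t))"
    unfolding closable_def closure_H_graph
    using sv gE E.norm_le by (auto intro!: norm_blinfun_bound simp: \<gamma>_def[symmetric])
  have part2: "Domain L_graph \<supseteq> {f. apply_ucb f \<in> HCb 2} \<and>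
       (\<forall>u0. mild_solution L_graph u0 (\<lambda>t. E t u0) \<and>
             (\<forall>U. mild_solution L_graph u0 U \<longrightarrow> (\<forall>t\<ge>0. U t = E t u0))) \<and>
       (\<forall>u0\<in>Domain L_graph. classical_solution L_graph u0 (\<lambda>t. E t u0) \<and>
             (\<forall>U. classical_solution L_graph u0 U \<longrightarrow> (\<forall>t\<ge>0. U t = E t u0)))"
    using E.mild_solution_orbit E.mild_solution_unique E.classical_solution_orbit E.classical_solution_unique
      diff_op_in_L_graph HCb_subset_UCb_n[of 2] by blast
  have part3: "(\<lambda>t. norm (?S t f - (f + t *\<^sub>R diff_op a b c f
                             + (1 / 2 * t\<^sup>2) *\<^sub>R diff_op a b c (diff_op a b c f))))
         \<in> o[at_right 0](\<lambda>t. t\<^sup>2)" if f: "apply_ucb f \<in> Cb_inf" for f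
  proof -
    have f8: "apply_ucb f \<in> UCb_n 8" using f by (auto simp: Cb_inf_def)
    obtain K where K: "K \<ge> 0" "\<And>t. 0 < t \<Longrightarrow> t \<le> 1 \<Longrightarrow>
      norm (?S t f - (f + t *\<^sub>R diff_op a b c f + (1 / 2 * t\<^sup>2) *\<^sub>R diff_op a b c (diff_op a b c f)))
      \<le> K * t ^ 3 * Ck_norm 8 (apply_ucb f)"
      by (rule chernoff_expansion) (use f8 in blast)
    define M where "M = K * Ck_norm 8 (apply_ucb f) + 1"
    have M: "M > 0" using K(1) by (simp add: M_def add_nonneg_pos)
    show ?thesis
    proof (rule landau_o.smallI)
      fix e :: real assume e: "e > 0"
      have small: "norm (?S t f - (f + t *\<^sub>R diff_op a b c f + (1 / 2 * t\<^sup>2) *\<^sub>R diff_op a b c (diff_op a b c f))) \<le> e * t\<^sup>2"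
        if t: "0 < t" "t < min 1 (e / M)" for t
      proof -
        have "M * t \<le> e" using t M by (simp add: field_simps)
        then have "(K * Ck_norm 8 (apply_ucb f)) * t \<le> e" using t by (simp add: M_def algebra_simps)
        then have "(K * Ck_norm 8 (apply_ucb f)) * t * t\<^sup>2 \<le> e * t\<^sup>2" by (rule mult_right_mono) simp
        then have "K * t ^ 3 * Ck_norm 8 (apply_ucb f) \<le> e * t\<^sup>2"
          by (simp add: power2_eq_square power3_eq_cube mult_ac)
        then show ?thesis using K(2)[of t] t by force
      qed
      show "\<forall>\<^sub>F t in at_right 0. norm (norm (?S t f - (f + t *\<^sub>R diff_op a b c f
          + (1 / 2 * t\<^sup>2) *\<^sub>R diff_op a b c (diff_op a b c f)))) \<le> e * norm (t\<^sup>2)"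
        unfolding eventually_at_right_field
        by (rule exI[of _ "min 1 (e / M)"]) (use e M small in auto)
    qed
  qed
  have part4: "\<exists>w\<ge>0. \<exists>C. (\<forall>j\<le>8. C j \<ge> 0) \<and>
         (\<forall>f t n. apply_ucb f \<in> UCb_n 8 \<and> t > 0 \<and> n > 0 \<and> real n \<ge> t \<longrightarrow>
           norm ((?S (t / real n) ^^ n) f - E t f)
             \<le> exp (w * t) * (t ^ 3 / real n ^ 2) *
                (\<Sum>j=0..8. C j * norm (Abs_ucb ((deriv ^^ j) (apply_ucb f)))))"
    if hc: "a \<in> HCb 6 \<and> b \<in> HCb 6 \<and> c \<in> HCb 6"
  proof -
    have "a \<in> UCb_n 6" "b \<in> UCb_n 6" "c \<in> UCb_n 6" using hc HCb_subset_UCb_n[of 6] by auto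
    then obtain w C where wC: "w \<ge> 0" "C \<ge> 0" "\<And>f t n. apply_ucb f \<in> UCb_n 8 \<Longrightarrow> t > 0 \<Longrightarrow> n > 0 \<Longrightarrow> real n \<ge> t \<Longrightarrow>
    norm ((?S (t / real n) ^^ n) f - T t f)
      \<le> exp (w * t) * (t ^ 3 / real n ^ 2) * (C * Ck_norm 8 (apply_ucb f))"
      by (rule chernoff_rate) blast
    have "C * Ck_norm 8 f = (\<Sum>j=0..8. C * norm (Abs_ucb ((deriv ^^ j) f)))" for f
      by (simp add: Ck_norm_def sup_norm_def sum_distrib_left atMost_atLeast0)
    then show ?thesis using wC ET
      by (intro exI[of _ w] conjI exI[of _ "\<lambda>j. C"]) (auto simp: less_imp_le)
  qed
  have part5: "(\<lambda>n. SUP t\<in>{0<..\<T>}. ereal (norm ((?S (t / real n) ^^ n) g - E t g))) \<longlonglongrightarrow> 0"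
    if \<T>: "\<T> > 0" for \<T> g
  proof (rule order_tendstoI)
    fix l :: ereal assume "l < 0"
    moreover have "0 \<le> (SUP t\<in>{0<..\<T>}. ereal (norm ((?S (t / real n) ^^ n) g - E t g)))" for n
      using \<T> by (intro SUP_upper2[of \<T>]) auto
    ultimately show "\<forall>\<^sub>F n in sequentially. l < (SUP t\<in>{0<..\<T>}. ereal (norm ((?S (t / real n) ^^ n) g - E t g)))"
      by (intro always_eventually allI) (meson less_le_trans)
  next
    fix l :: ereal assume "0 < l"
    then obtain e where e: "0 < ereal e" "ereal e < l" using ereal_dense2 by blast
    from chernoff_convergence[OF \<T>, of e g]
    show "\<forall>\<^sub>F n in sequentially. (SUP t\<in>{0<..\<T>}. ereal (norm ((?S (t / real n) ^^ n) g - E t g))) < l"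
    proof (rule eventually_mono)
      show "0 < e" using e(1) by simp
      fix n assume n: "\<forall>t\<in>{0<..\<T>}. norm ((?S (t / real n) ^^ n) g - T t g) \<le> e"
      have "(SUP t\<in>{0<..\<T>}. ereal (norm ((?S (t / real n) ^^ n) g - E t g))) \<le> ereal e"
        by (rule SUP_least) (use n ET in auto)
      then show "(SUP t\<in>{0<..\<T>}. ereal (norm ((?S (t / real n) ^^ n) g - E t g))) < l"
        using e(2) by (rule le_less_trans)
    qed
  qed
  show ?thesis
    unfolding Let_def closure_H_graph E_def[symmetric]
    using part1 part2 part3 part4 part5 by blast
qed

end
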